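(* Consider either of the following two settings (both described in the context). (a) Curved setting: the active-grid geometry assumptions and the local extrapolation assumption hold, the block $P_2$ of the chosen (single- or double-layer) construction is invertible, $\Gamma^h$ is connected, and the one-sided harmonic trace estimate holds: for every $v_2\in\mathbb R^{|\gamma_2|}$, $\|\mathcal E_hv_2\|_{L^2(\Omega_h^\Gamma)}^2\le C_{\rm tr}\,h\,\|\operatorname{Tr}_h\mathcal E_hv_2\|_{L^2(\Gamma^h)}^2$ with $C_{\rm tr}$ independent of $h$ and of the cut position. (b) The flat periodic model, with fixed tangential period $L=Mh$. Let $K_{\rm red}$ be the reduced stiffness matrix, i.e. the symmetric matrix on $\mathbb R^{|\gamma_2|}$ with $v_2^TK_{\rm red}v_2=\|\nabla_{\Gamma^h}\operatorname{Tr}_h\mathcal E_hv_2\|_{L^2(\Gamma^h)}^2$. Then the nonzero eigenvalues of $K_{\rm red}$ (with respect to the Euclidean coefficient norm) satisfy $$\lambda_{\min}^+(K_{\rm red})\ge c\,h,\qquad\lambda_{\max}(K_{\rm red})\le C\,h^{-1},\qquad\kappa^+(K_{\rm red}):=\frac{\lambda_{\max}(K_{\rm red})}{\lambda_{\min}^+(K_{\rm red})}\le C'h^{-2},$$ where $\lambda_{\min}^+$ denotes the smallest nonzero eigenvalue and the constants $c,C,C'>0$ are independent of $h$ and of the cut configuration.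
   Context: **Geometry and mesh (curved setting).** $\Omega\subset\mathbb R^2$ is a bounded domain (possibly nonconvex) whose boundary $\Gamma$ is a smooth connected closed curve; $\psi$ is a level-set function with $\Gamma=\{\psi=0\}$, $\psi<0$ in $\Omega$, $\psi>0$ outside $\overline\Omega$. $\mathcal T_h$ is the uniform Cartesian mesh of closed squares of side $h$ with vertex set $h\mathbb Z^2$; $x\sim y$ means that $x,y\in h\mathbb Z^2$ are nearest (axial) lattice neighbours. A cell $K$ is active if $K\cap\Gamma\ne\varnothing$; $\mathcal T_h^\Gamma$ is the set of active cells, $\gamma$ the set of their vertices, $\Omega_h^\Gamma$ their union. Put $\gamma_1=\{x\in\gamma:\psi(x)<0\}$, $\gamma_2=\{x\in\gamma:\psi(x)>0,\ x\sim y\text{ for some }y\in\gamma_1\}$, $\gamma_3=\{x\in\gamma:\psi(x)>0\}\setminus\gamma_2$, $\mathcal V_h^{\rm int}=\{\xi\in h\mathbb Z^2:\psi(\xi)<0\}$. *Active-grid geometry assumptions* ($h$ sufficiently small): no lattice vertex lies on $\Gamma$; all intersections of $\Gamma$ with mesh edges are transverse; each active cell is cut by at most one connected interface segment; every active cell has vertices of both signs of $\psi$; $\mathcal V_h^{\rm int}$ is finite and connected as a lattice graph. No lower bound on cut ratios is imposed; "cut position/configuration" is the position of $\Gamma$ relative to the mesh. **Discrete surface and finite elements.** $V_h$ is the continuous bilinear ($\mathcal Q_1$) finite element space on $\mathcal T_h^\Gamma$ with nodal basis $\{\phi_\xi\}_{\xi\in\gamma}$. In each active cell $K$, $\Gamma_K^h$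 is the straight segment joining the zero crossings of $\psi$ on $\partial K$; $\Gamma^h=\bigcup_K\Gamma^h_K$, a closed polygon whose length satisfies $|\Gamma^h|\to|\Gamma|$. $\operatorname{Tr}_hv_h=v_h|_{\Gamma^h}$; $\nabla_{\Gamma^h}$ is the tangential gradient on $\Gamma^h$. With $K_{\xi\eta}=\int_{\Gamma^h}\nabla_{\Gamma^h}\phi_\xi\cdot\nabla_{\Gamma^h}\phi_\eta\,ds_h$ one has $K_{\rm red}=E^TKE$, $E$ as below. **Layer potentials and harmonic extension.** $L_hv(x)=h^{-2}\bigl(\sum_{y\sim x}v(y)-4v(x)\bigr)$. $G_h$ is the lattice Green's function on $h\mathbb Z^2$: $-L_hG_h=\delta_0$ with $\delta_0(0)=h^{-2}$, $\delta_0=0$ elsewhere, normalized by $G_h(0)=0$; explicitly $G_h(hm)=\frac1{4\pi^2}\int_{[-\pi,\pi]^2}\frac{\cos(m\cdot t)-1}{4-2\cos t_1-2\cos t_2}\,dt$. Set $S_{ij}=G_h(x_i-x_j)$ and $D_{ij}=\sum_{x_k\sim x_j,\,x_k\notin\gamma}[G_h(x_i-x_k)-G_h(x_i-x_j)]$. With sources in $\gamma_2$ and targets in $\gamma_1$, resp. $\gamma_2$, one gets the blocks $S_{12},D_{12}$, resp. $S_{22},D_{22}$. Either $(P_1,P_2)=(S_{12},S_{22})$ (single layer) or $(P_1,P_2)=(D_{12},D_{22})$ (double layer). If $P_2$ is invertible, $H:=P_1P_2^{-1}$. **Local extrapolation assumption.** For $\eta\in\gamma_3$, a direction $e\in\{\pm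 e_1,\pm e_2\}$ is admissible if $\eta-he,\eta-2he\in\gamma_1\cup\gamma_2$; then one sets $v(\eta)=2v(\eta-he)-v(\eta-2he)$, averaging over two orthogonal admissible directions when available. Assume every $\eta\in\gamma_3$ has at least one admissible direction, and the stencil patches have diameter $O(h)$ and uniformly finite overlap, independently of the cut position. (A local least-squares affine extrapolation may be substituted provided each stencil uses a uniformly bounded number of nodes with uniformly bounded weights, is exact on affine functions, and patches keep uniformly finite overlap.) The relations are written $R_1u_1+R_2u_2+u_3=0$, where $u_i$ is the vector of values on $\gamma_i$; $J:=R_1H+R_2$. **Reduction map.** For $v_2\in\mathbb R^{|\gamma_2|}$, $Ev_2=(Hv_2,v_2,-Jv_2)\in\mathbb R^{|\gamma|}$ (blocks on $\gamma_1,\gamma_2,\gamma_3$) and $\mathcal E_hv_2=\sum_{\xi\in\gamma}(Ev_2)_\xi\phi_\xi\in V_h$. **Flat periodic model.** Nodes are $(mh,j)$ with tangential index $m\in\mathbb Z_M=\mathbb Z/M\mathbb Z$ and layer index $j\in\mathbb Z$; consecutive layers are at distance $h$, and $j\ge0$ counts layers from $\gamma_2$ (the layer $j=0$) into the harmonic side. For data $v_2=(V_m)_{m\in\mathbb Z_M}$ on $\gamma_2$, $(Ev_2)_{j,m}=U_{j,m}$ for $j\ge 0$, where $U$ is the bounded discrete harmonic (five-point) extension of $V$ to $j\ge0$; in terms of the discrete Fourier transform in $m$, $\widehat U_j(\theta)=e^{-j\alpha(\theta)}\widehat V(\theta)$, $\alpha(\theta)\ge0$, $\cosh\alpha(\theta)=2-\cos\theta$.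 The active nodes $\gamma$ form a fixed number (independent of $h$) of layers $-J_-\le j\le J_+$; on the layers $j<0$ (the block $\gamma_3$) the values of $Ev_2$ are $-Jv_2$ with $\|Jv_2\|_{\ell^2_h(\gamma_3)}\le C\|v_2\|_{\ell_h^2(\gamma_2)}$, where $\|v\|^2_{\ell_h^2(\gamma')}=h\sum_{\gamma'}|v_\xi|^2$. The discrete interface $\Gamma^h$ is the (periodic) line at height $(d+\rho)h$, with integer $0\le d\le D$, $D$ fixed, $D+1\le J_+$, and $0\le\rho\le1$ (the cut offset). $\mathcal E_hv_2$ is the periodic $\mathcal Q_1$ function on the active band $\Omega_h^\Gamma$ (layers $-J_-$ to $J_+$) with nodal values $Ev_2$, and $\operatorname{Tr}_h$ is restriction to $\Gamma^h$; thus the trace is the periodic piecewise linear function with nodal values $(1-\rho)U_{d,m}+\rho U_{d+1,m}$. *)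

theory Defs
  imports "HOL-Analysis.Analysis"
begin

type_synonym plane = "real \<times> real"
type_synonym node = "int \<times> int"

section \<open>Matrices indexed by a finite set\<close>

definition is_inverse_on :: "'a set \<Rightarrow> ('a \<Rightarrow> 'a \<Rightarrow> real) \<Rightarrow> ('a \<Rightarrow> 'a \<Rightarrow> real) \<Rightarrow> bool" where
  "is_inverse_on I A B \<longleftrightarrow> (\<forall>i\<in>I. \<forall>j\<in>I.
     (\<Sum>k\<in>I. A i k * B k j) = of_bool (i = j) \<and> (\<Sum>k\<in>I. B i k * A k j) = of_bool (i = j))"

definition invertible_on :: "'a set \<Rightarrow> ('a \<Rightarrow> 'a \<Rightarrow> real) \<Rightarrow> bool" where
  "invertible_on I A \<longleftrightarrow> (\<exists>B. is_inverse_on I A B)"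

definition inverse_on :: "'a set \<Rightarrow> ('a \<Rightarrow> 'a \<Rightarrow> real) \<Rightarrow> 'a \<Rightarrow> 'a \<Rightarrow> real" where
  "inverse_on I A = (SOME B. is_inverse_on I A B)"

definition eigenvalues_on :: "'a set \<Rightarrow> ('a \<Rightarrow> 'a \<Rightarrow> real) \<Rightarrow> real set" where
  "eigenvalues_on I A =
     {l. \<exists>v. (\<exists>i\<in>I. v i \<noteq> 0) \<and> (\<forall>i\<in>I. (\<Sum>j\<in>I. A i j * v j) = l * v i)}"

definition lambda_max :: "'a set \<Rightarrow> ('a \<Rightarrow> 'a \<Rightarrow> real) \<Rightarrow> real" where
  "lambda_max I A = Max (eigenvalues_on I A)"

definition lambda_min_pos :: "'a set \<Rightarrow> ('a \<Rightarrow> 'a \<Rightarrow> real) \<Rightarrow> real" where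
  "lambda_min_pos I A = Min (eigenvalues_on I A - {0})"

definition kappa_pos :: "'a set \<Rightarrow> ('a \<Rightarrow> 'a \<Rightarrow> real) \<Rightarrow> real" where
  "kappa_pos I A = lambda_max I A / lambda_min_pos I A"

definition symmetric_with_form ::
  "'a set \<Rightarrow> ('a \<Rightarrow> 'a \<Rightarrow> real) \<Rightarrow> (('a \<Rightarrow> real) \<Rightarrow> real) \<Rightarrow> bool" where
  "symmetric_with_form I A q \<longleftrightarrow>
     (\<forall>i\<in>I. \<forall>j\<in>I. A i j = A j i) \<and> (\<forall>v. (\<Sum>i\<in>I. \<Sum>j\<in>I. v i * A i j * v j) = q v)"

(* The first conjunct makes the minimum in lambda_min_pos meaningful. *)
definition spectral_bounds ::
  "'a set \<Rightarrow> ('a \<Rightarrow> 'a \<Rightarrow> real) \<Rightarrow> real \<Rightarrow> real \<Rightarrow> real \<Rightarrow> real \<Rightarrow> bool" where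
  "spectral_bounds I A h c C C' \<longleftrightarrow>
     eigenvalues_on I A - {0} \<noteq> {} \<and>
     lambda_min_pos I A \<ge> c * h \<and>
     lambda_max I A \<le> C / h \<and>
     kappa_pos I A \<le> C' / h\<^sup>2"

section \<open>Lattice, bilinear elements, integrals along segments\<close>

definition pt :: "real \<Rightarrow> node \<Rightarrow> plane" where
  "pt h \<xi> = (h * of_int (fst \<xi>), h * of_int (snd \<xi>))"

definition adj :: "node \<Rightarrow> node \<Rightarrow> bool" where
  "adj x y \<longleftrightarrow> \<bar>fst x - fst y\<bar> + \<bar>snd x - snd y\<bar> = 1"

definition lattice_connected :: "node set \<Rightarrow> bool" where
  "lattice_connected V \<longleftrightarrow> (\<forall>x\<in>V. \<forall>y\<in>V. (x, y) \<in> {(a, b). a \<in> V \<and> b \<in> V \<and> adj a b}\<^sup>*)"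

text \<open>A cell is indexed by its lower left vertex.\<close>

definition cell :: "real \<Rightarrow> node \<Rightarrow> plane set" where
  "cell h k = cbox (pt h k) (pt h (k + (1, 1)))"

definition cell_vertices :: "node \<Rightarrow> node set" where
  "cell_vertices k = {k, k + (1, 0), k + (0, 1), k + (1, 1)}"

definition hat :: "real \<Rightarrow> real" where
  "hat t = max 0 (1 - \<bar>t\<bar>)"

text \<open>On each cell \<open>hat_basis h \<xi>\<close> is bilinear, and it is 1 at the vertex \<open>\<xi>\<close> and 0 at all other
  vertices; so these functions, restricted to a union of cells, are the \<open>Q\<^sub>1\<close> nodal basis.\<close>

definition hat_basis :: "real \<Rightarrow> node \<Rightarrow> plane \<Rightarrow> real" where
  "hat_basis h \<xi> x = hat (fst x / h - of_int (fst \<xi>)) * hat (snd x / h - of_int (snd \<xi>))"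

definition fe_function :: "real \<Rightarrow> node set \<Rightarrow> (node \<Rightarrow> real) \<Rightarrow> plane \<Rightarrow> real" where
  "fe_function h N u x = (\<Sum>\<xi>\<in>N. u \<xi> * hat_basis h \<xi> x)"

definition segment_integral :: "plane \<Rightarrow> plane \<Rightarrow> (plane \<Rightarrow> real) \<Rightarrow> real" where
  "segment_integral p q f = norm (q - p) * (LINT t:{0..1}|lborel. f (p + t *\<^sub>R (q - p)))"

text \<open>Tangential gradient along the segment from \<open>p\<close> to \<open>q\<close>; for \<open>p \<noteq> q\<close> the vector
  \<open>sgn (q - p)\<close> is the unit tangent. Swapping \<open>p\<close> and \<open>q\<close> changes nothing.\<close>

definition tangential_gradient :: "plane \<Rightarrow> plane \<Rightarrow> (plane \<Rightarrow> real) \<Rightarrow> plane \<Rightarrow> plane" where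
  "tangential_gradient p q f x = deriv (\<lambda>s. f (x + s *\<^sub>R sgn (q - p))) 0 *\<^sub>R sgn (q - p)"

definition segment_form :: "plane \<Rightarrow> plane \<Rightarrow> (plane \<Rightarrow> real) \<Rightarrow> (plane \<Rightarrow> real) \<Rightarrow> real" where
  "segment_form p q f g =
     segment_integral p q (\<lambda>x. tangential_gradient p q f x \<bullet> tangential_gradient p q g x)"

section \<open>The curved setting\<close>

subsection \<open>Domain, level-set function and position relative to the mesh\<close>

text \<open>A one-periodic regular \<open>C\<^sup>\<infinity>\<close> parametrization; \<open>D n\<close> is the \<open>n\<close>-th derivative.\<close>

definition smooth_closed_curve :: "(real \<Rightarrow> plane) \<Rightarrow> bool" where
  "smooth_closed_curve g \<longleftrightarrow>
     (\<exists>D. D 0 = g \<and> (\<forall>n t. (D n has_vector_derivative D (Suc n) t) (at t))) \<and>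
     (\<forall>t. g (t + 1) = g t) \<and> inj_on g {0..<1} \<and> (\<forall>t. vector_derivative g (at t) \<noteq> 0)"

definition smooth_domain :: "plane set \<Rightarrow> (real \<Rightarrow> plane) \<Rightarrow> bool" where
  "smooth_domain \<Omega> g \<longleftrightarrow>
     open \<Omega> \<and> connected \<Omega> \<and> bounded \<Omega> \<and> \<Omega> \<noteq> {} \<and>
     smooth_closed_curve g \<and> frontier \<Omega> = range g"

definition level_set_function :: "plane set \<Rightarrow> (plane \<Rightarrow> real) \<Rightarrow> bool" where
  "level_set_function \<Omega> \<psi> \<longleftrightarrow>
     frontier \<Omega> = {x. \<psi> x = 0} \<and> (\<forall>x\<in>\<Omega>. \<psi> x < 0) \<and> (\<forall>x. x \<notin> closure \<Omega> \<longrightarrow> \<psi> x > 0)"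

text \<open>The mesh stays at \<open>h\<int>\<^sup>2\<close>; the position of the interface relative to the mesh is
  varied by moving the interface.\<close>

definition rigid_motion :: "(plane \<Rightarrow> plane) \<Rightarrow> bool" where
  "rigid_motion T \<longleftrightarrow> (\<exists>A a. orthogonal_transformation A \<and> T = (\<lambda>x. a + A x))"

subsection \<open>Lattice potentials\<close>

text \<open>The value at \<open>h m\<close> of the lattice Green's function; it does not depend on \<open>h\<close>.\<close>

definition lattice_green :: "node \<Rightarrow> real" where
  "lattice_green m = 1 / (4 * pi\<^sup>2) *
     (LINT t:{-pi..pi} \<times> {-pi..pi}|lborel.
        (cos (of_int (fst m) * fst t + of_int (snd m) * snd t) - 1)
          / (4 - 2 * cos (fst t) - 2 * cos (snd t)))"

datatype layer = Single_Layer | Double_Layer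

definition axis_directions :: "node set" where
  "axis_directions = {(1, 0), (-1, 0), (0, 1), (0, -1)}"

definition lattice_affine :: "(node \<Rightarrow> real) \<Rightarrow> bool" where
  "lattice_affine p \<longleftrightarrow>
     (\<exists>a b c. \<forall>\<xi>. p \<xi> = a + b * of_int (fst \<xi>) + c * of_int (snd \<xi>))"

context
  fixes \<psi> :: "plane \<Rightarrow> real" and h :: real
begin

definition interface :: "plane set" where
  "interface = {x. \<psi> x = 0}"

definition active_cells :: "node set" where
  "active_cells = {k. cell h k \<inter> interface \<noteq> {}}"

definition active_nodes :: "node set" where
  "active_nodes = (\<Union>k\<in>active_cells. cell_vertices k)"

definition active_band :: "plane set" where
  "active_band = (\<Union>k\<in>active_cells. cell h k)"

definition gamma1 :: "node set" where
  "gamma1 = {x \<in> active_nodes. \<psi> (pt h x) < 0}"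

definition gamma2 :: "node set" where
  "gamma2 = {x \<in> active_nodes. \<psi> (pt h x) > 0 \<and> (\<exists>y\<in>gamma1. adj x y)}"

definition gamma3 :: "node set" where
  "gamma3 = {x \<in> active_nodes. \<psi> (pt h x) > 0} - gamma2"

definition interior_nodes :: "node set" where
  "interior_nodes = {x. \<psi> (pt h x) < 0}"

text \<open>Here \<open>g\<close> parametrizes the interface. A point of the interface lies on a horizontal (vertical)
  mesh edge iff its second (first) coordinate is a multiple of \<open>h\<close>.\<close>

definition active_grid_geometry :: "(real \<Rightarrow> plane) \<Rightarrow> bool" where
  "active_grid_geometry g \<longleftrightarrow>
     (\<forall>\<xi>. pt h \<xi> \<notin> interface) \<and>
     (\<forall>t j. fst (g t) = h * of_int j \<longrightarrow> fst (vector_derivative g (at t)) \<noteq> 0) \<and>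
     (\<forall>t j. snd (g t) = h * of_int j \<longrightarrow> snd (vector_derivative g (at t)) \<noteq> 0) \<and>
     (\<forall>k\<in>active_cells. \<exists>s t. s \<le> t \<and> cell h k \<inter> interface = g ` {s..t}) \<and>
     (\<forall>k\<in>active_cells. (\<exists>x\<in>cell_vertices k. \<psi> (pt h x) < 0) \<and>
                      (\<exists>x\<in>cell_vertices k. \<psi> (pt h x) > 0)) \<and>
     finite interior_nodes \<and> lattice_connected interior_nodes"

text \<open>Under \<open>active_grid_geometry\<close> the interface meets the boundary of an active cell in exactly
  two points, and \<open>crossings\<close> lists them in some order.\<close>

definition crossings :: "node \<Rightarrow> plane \<times> plane" where
  "crossings k = (SOME (p, q). interface \<inter> frontier (cell h k) = {p, q})"

definition discrete_interface :: "plane set" where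
  "discrete_interface = (\<Union>k\<in>active_cells. case crossings k of (p, q) \<Rightarrow> closed_segment p q)"

definition surface_integral :: "(plane \<Rightarrow> real) \<Rightarrow> real" where
  "surface_integral f = (\<Sum>k\<in>active_cells. case crossings k of (p, q) \<Rightarrow> segment_integral p q f)"

definition surface_form :: "(plane \<Rightarrow> real) \<Rightarrow> (plane \<Rightarrow> real) \<Rightarrow> real" where
  "surface_form f g = (\<Sum>k\<in>active_cells. case crossings k of (p, q) \<Rightarrow> segment_form p q f g)"

definition layer_kernel :: "layer \<Rightarrow> node \<Rightarrow> node \<Rightarrow> real" where
  "layer_kernel lay i j = (case lay of
     Single_Layer \<Rightarrow> lattice_green (i - j)
   | Double_Layer \<Rightarrow> (\<Sum>k\<in>{k. adj k j \<and> k \<notin> active_nodes}. lattice_green (i - k) - lattice_green (i - j)))"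

definition harmonic_map :: "layer \<Rightarrow> node \<Rightarrow> node \<Rightarrow> real" where
  "harmonic_map lay i j = (\<Sum>k\<in>gamma2. layer_kernel lay i k * inverse_on gamma2 (layer_kernel lay) k j)"

subsection \<open>Extrapolation\<close>

definition admissible :: "node \<Rightarrow> node \<Rightarrow> bool" where
  "admissible \<eta> e \<longleftrightarrow> e \<in> axis_directions \<and> \<eta> - e \<in> gamma1 \<union> gamma2 \<and> \<eta> - e - e \<in> gamma1 \<union> gamma2"

text \<open>\<open>R \<eta> \<xi>\<close> for \<open>\<eta>\<close> in \<open>gamma3\<close> and \<open>\<xi>\<close> in \<open>gamma1\<close> (\<open>gamma2\<close>) are the entries of \<open>R\<^sub>1\<close> (\<open>R\<^sub>2\<close>), so that
  the extrapolated value is \<open>u \<eta> = - (\<Sum>\<xi>. R \<eta> \<xi> * u \<xi>)\<close>. In the axis rule \<open>A\<close> is the set of directions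
  that is averaged over.\<close>

definition axis_rule :: "node \<Rightarrow> (node \<Rightarrow> real) \<Rightarrow> bool" where
  "axis_rule \<eta> r \<longleftrightarrow>
     (\<exists>A. (\<forall>e\<in>A. admissible \<eta> e) \<and>
        (if \<exists>e f. admissible \<eta> e \<and> admissible \<eta> f \<and> fst e * fst f + snd e * snd f = 0
         then \<exists>e f. A = {e, f} \<and> fst e * fst f + snd e * snd f = 0
         else \<exists>e. A = {e}) \<and>
        (\<forall>\<xi>\<in>gamma1 \<union> gamma2.
           r \<xi> = - (\<Sum>e\<in>A. 2 * of_bool (\<xi> = \<eta> - e) - of_bool (\<xi> = \<eta> - e - e)) / real (card A)))"

definition least_squares_rule :: "nat \<Rightarrow> node \<Rightarrow> (node \<Rightarrow> real) \<Rightarrow> bool" where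
  "least_squares_rule B \<eta> r \<longleftrightarrow>
     (\<exists>S \<omega>. S \<subseteq> gamma1 \<union> gamma2 \<and> finite S \<and> card S \<le> B \<and>
        (\<forall>\<xi>\<in>S. \<omega> \<xi> > (0::real)) \<and>
        (\<forall>\<xi>\<in>gamma1 \<union> gamma2 - S. r \<xi> = 0) \<and> (\<forall>\<xi>\<in>S. \<bar>r \<xi>\<bar> \<le> real B) \<and>
        (\<forall>u. \<exists>p. lattice_affine p \<and>
           (\<forall>p'. lattice_affine p' \<longrightarrow>
              (\<Sum>\<xi>\<in>S. \<omega> \<xi> * (p \<xi> - u \<xi>)\<^sup>2) \<le> (\<Sum>\<xi>\<in>S. \<omega> \<xi> * (p' \<xi> - u \<xi>)\<^sup>2)) \<and>
           p \<eta> = - (\<Sum>\<xi>\<in>S. r \<xi> * u \<xi>)) \<and>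
        (\<forall>p. lattice_affine p \<longrightarrow> p \<eta> = - (\<Sum>\<xi>\<in>S. r \<xi> * p \<xi>)))"

definition patch :: "(node \<Rightarrow> node \<Rightarrow> real) \<Rightarrow> node \<Rightarrow> node set" where
  "patch R \<eta> = insert \<eta> {\<xi> \<in> gamma1 \<union> gamma2. R \<eta> \<xi> \<noteq> 0}"

definition local_extrapolation :: "nat \<Rightarrow> (node \<Rightarrow> node \<Rightarrow> real) \<Rightarrow> bool" where
  "local_extrapolation B R \<longleftrightarrow>
     (\<forall>\<eta>\<in>gamma3. axis_rule \<eta> (R \<eta>) \<or> least_squares_rule B \<eta> (R \<eta>)) \<and>
     (\<forall>\<eta>\<in>gamma3. diameter (pt h ` patch R \<eta>) \<le> real B * h) \<and>
     (\<forall>\<xi>. card {\<eta> \<in> gamma3. \<xi> \<in> patch R \<eta>} \<le> B)"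

subsection \<open>Reduction map and reduced stiffness matrix\<close>

context
  fixes lay :: layer and R :: "node \<Rightarrow> node \<Rightarrow> real"
begin

definition J_matrix :: "node \<Rightarrow> node \<Rightarrow> real" where
  "J_matrix \<eta> j = (\<Sum>\<xi>\<in>gamma1. R \<eta> \<xi> * harmonic_map lay \<xi> j) + R \<eta> j"

definition E_matrix :: "node \<Rightarrow> node \<Rightarrow> real" where
  "E_matrix \<xi> j =
     (if \<xi> \<in> gamma1 then harmonic_map lay \<xi> j
      else if \<xi> \<in> gamma2 then of_bool (\<xi> = j)
      else - J_matrix \<xi> j)"

definition E_fe :: "(node \<Rightarrow> real) \<Rightarrow> plane \<Rightarrow> real" where
  "E_fe v = fe_function h active_nodes (\<lambda>\<xi>. \<Sum>j\<in>gamma2. E_matrix \<xi> j * v j)"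

definition K_reduced :: "node \<Rightarrow> node \<Rightarrow> real" where
  "K_reduced i j = (\<Sum>\<xi>\<in>active_nodes. \<Sum>\<eta>\<in>active_nodes.
     E_matrix \<xi> i * surface_form (hat_basis h \<xi>) (hat_basis h \<eta>) * E_matrix \<eta> j)"

definition trace_estimate :: "real \<Rightarrow> bool" where
  "trace_estimate Ctr \<longleftrightarrow>
     (\<forall>v. (LINT x:active_band|lborel. (E_fe v x)\<^sup>2) \<le> Ctr * h * surface_integral (\<lambda>x. (E_fe v x)\<^sup>2))"

end

end

section \<open>The flat periodic model\<close>

text \<open>Functions on \<open>\<int>/M\<int>\<close> are given by their values on \<open>{0..<M}\<close>, or by an \<open>M\<close>-periodic function
  on the integers.\<close>

definition bounded_harmonic_extension :: "nat \<Rightarrow> (int \<Rightarrow> real) \<Rightarrow> (nat \<Rightarrow> int \<Rightarrow> real) \<Rightarrow> bool" where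
  "bounded_harmonic_extension M V U \<longleftrightarrow>
     (\<forall>j m. U j (m + int M) = U j m) \<and>
     (\<exists>b. \<forall>j m. \<bar>U j m\<bar> \<le> b) \<and>
     (\<forall>m\<in>{0..<int M}. U 0 m = V m) \<and>
     (\<forall>j m. U (Suc (Suc j)) m + U j m + U (Suc j) (m + 1) + U (Suc j) (m - 1) = 4 * U (Suc j) m)"

definition flat_U :: "nat \<Rightarrow> (int \<Rightarrow> real) \<Rightarrow> nat \<Rightarrow> int \<Rightarrow> real" where
  "flat_U M V = (THE U. bounded_harmonic_extension M V U)"

text \<open>A node \<open>(m, j)\<close> has tangential index \<open>m\<close> and layer index \<open>j\<close>. The matrix \<open>J\<close> (row \<open>(m, j)\<close> with
  \<open>j < 0\<close>, column \<open>n\<close>) supplies the values on the block \<open>\<gamma>\<^sub>3\<close>.\<close>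

definition flat_J :: "nat \<Rightarrow> (node \<Rightarrow> int \<Rightarrow> real) \<Rightarrow> (int \<Rightarrow> real) \<Rightarrow> node \<Rightarrow> real" where
  "flat_J M J V \<xi> = (\<Sum>n\<in>{0..<int M}. J \<xi> n * V n)"

definition flat_E :: "nat \<Rightarrow> (node \<Rightarrow> int \<Rightarrow> real) \<Rightarrow> (int \<Rightarrow> real) \<Rightarrow> node \<Rightarrow> real" where
  "flat_E M J V \<xi> = (if snd \<xi> \<ge> 0 then flat_U M V (nat (snd \<xi>)) (fst \<xi>) else - flat_J M J V \<xi>)"

definition l2h_norm :: "real \<Rightarrow> 'a set \<Rightarrow> ('a \<Rightarrow> real) \<Rightarrow> real" where
  "l2h_norm h I v = sqrt (h * (\<Sum>i\<in>I. (v i)\<^sup>2))"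

definition flat_J_bound :: "real \<Rightarrow> real \<Rightarrow> nat \<Rightarrow> nat \<Rightarrow> (node \<Rightarrow> int \<Rightarrow> real) \<Rightarrow> bool" where
  "flat_J_bound CJ h M Jm J \<longleftrightarrow>
     (\<forall>V. l2h_norm h ({0..<int M} \<times> {- int Jm..-1}) (flat_J M J V) \<le> CJ * l2h_norm h {0..<int M} V)"

text \<open>The periodic \<open>Q\<^sub>1\<close> function, on the period \<open>0 \<le> x \<le> M h\<close>: node columns \<open>0\<close> and \<open>M\<close> are identified.\<close>

definition flat_E_fe ::
  "nat \<Rightarrow> real \<Rightarrow> nat \<Rightarrow> nat \<Rightarrow> (node \<Rightarrow> int \<Rightarrow> real) \<Rightarrow> (int \<Rightarrow> real) \<Rightarrow> plane \<Rightarrow> real" where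
  "flat_E_fe M h Jm Jp J V =
     fe_function h ({0..int M} \<times> {- int Jm..int Jp}) (\<lambda>(m, j). flat_E M J V (m mod int M, j))"

text \<open>\<open>\<Gamma>\<^sup>h\<close> is the segment at height \<open>y = (d + \<rho>) h\<close> over one period.\<close>

definition flat_form ::
  "nat \<Rightarrow> real \<Rightarrow> nat \<Rightarrow> real \<Rightarrow> (plane \<Rightarrow> real) \<Rightarrow> (plane \<Rightarrow> real) \<Rightarrow> real" where
  "flat_form M h d \<rho> =
     segment_form (0, (real d + \<rho>) * h) (real M * h, (real d + \<rho>) * h)"

definition flat_K_reduced ::
  "nat \<Rightarrow> real \<Rightarrow> nat \<Rightarrow> nat \<Rightarrow> (node \<Rightarrow> int \<Rightarrow> real) \<Rightarrow> nat \<Rightarrow> real \<Rightarrow> int \<Rightarrow> int \<Rightarrow> real" where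
  "flat_K_reduced M h Jm Jp J d \<rho> m n =
     flat_form M h d \<rho> (flat_E_fe M h Jm Jp J (\<lambda>i. of_bool (i = m)))
                       (flat_E_fe M h Jm Jp J (\<lambda>i. of_bool (i = n)))"

end

theory Submission
  imports Defs
begin

text \<open>
  Both settings reduce to two inequalities for the quadratic form \<open>q\<close> of the reduced matrix:
  \<open>q v \<le> (C / h) |v|\<^sup>2\<close>, and \<open>c h |v - a|\<^sup>2 \<le> q v\<close> for some constant \<open>a\<close>. As the constants lie in
  the kernel, eigenvectors of nonzero eigenvalues have mean zero, so the second one bounds these
  eigenvalues from below.

  Curved setting. Lattice potentials with sources outside the interior are discrete harmonic there,
  so \<open>H\<close> solves a discrete Dirichlet problem; testing with a superharmonic weight shows that \<open>H\<close> is
  bounded in \<open>\<ell>\<^sup>2\<close> and preserves constants, whence the upper bound by an inverse estimate. For the lower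
  bound, subtract the value of the trace at one point: on the connected polygon, whose length is bounded
  because a curve of length \<open>L\<close> meets \<open>O(L / h + 1)\<close> cells, the oscillation of the trace is controlled by its
  tangential derivative, and the trace estimate together with the mass matrix bound recovers the
  nodal values.

  Flat setting. The layer energies of the bounded harmonic extension decrease, but at most by the factor
  49 per layer, and consecutive layers have nonnegative inner product. So the trace has a norm
  comparable to that of the data, and the discrete Poincare inequality on the period gives the rest.
\<close>

section \<open>Spectral bounds from the quadratic form\<close>

text \<open>Two things could spoil uniformity: the cut position and the inverse of the block P_2.
  Very short cut segments do no harm, because squared parameter derivatives bring the segment length
  in twice and arc length removes it only once: from above the length is at most 2 h, and from below
  only the total length of the polygon enters. Of P_2 only invertibility is known, with no bound on
  its inverse; the upper bound is saved by the fact that any potential with poles outside the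
  interior solves the same discrete Dirichlet problem. All quantitative information on the curve is
  one Lipschitz constant \<Lambda>, which isometries preserve, so the constants do not see the
  position. In the lower bound the powers balance: the mass matrix yields h^2, the trace estimate
  costs h, and the Poincare inequality is free of h, which leaves c h. \<open>Min\<close> and
  \<open>Max\<close> of the spectrum mean something only once it is known to be finite and to
  contain a nonzero eigenvalue; both facts are proved by hand for matrices over an abstract index
  set.\<close>

lemma eigenvalues_on_finite:
  assumes I: "finite I" and sym: "\<And>i j. i \<in> I \<Longrightarrow> j \<in> I \<Longrightarrow> A i j = A j i"
  shows "finite (eigenvalues_on I A)"
proof -
  have "\<exists>e. (\<Sum>i\<in>I. (e i)\<^sup>2) = 1 \<and> (\<forall>i\<in>I. (\<Sum>j\<in>I. A i j * e j) = l * e i)"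
    if l: "l \<in> eigenvalues_on I A" for l
  proof -
    obtain v i0 where v: "i0 \<in> I" "v i0 \<noteq> 0" "\<forall>i\<in>I. (\<Sum>j\<in>I. A i j * v j) = l * v i"
      using l unfolding eigenvalues_on_def by auto
    define n where "n = sqrt (\<Sum>i\<in>I. (v i)\<^sup>2)"
    have pos: "(\<Sum>i\<in>I. (v i)\<^sup>2) > 0"
      using v(1,2) I by (intro sum_pos2[of _ i0]) auto
    then have n: "n > 0" "n\<^sup>2 = (\<Sum>i\<in>I. (v i)\<^sup>2)"
      unfolding n_def by auto
    have "(\<Sum>i\<in>I. (v i / n)\<^sup>2) = 1"
      using n pos by (simp add: power_divide flip: sum_divide_distrib)
    moreover have "\<forall>i\<in>I. (\<Sum>j\<in>I. A i j * (v j / n)) = l * (v i / n)"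
      using v(3) by (simp flip: sum_divide_distrib)
    ultimately show ?thesis by (intro exI[of _ "\<lambda>i. v i / n"]) auto
  qed
  then obtain e where e: "\<And>l. l \<in> eigenvalues_on I A \<Longrightarrow> (\<Sum>i\<in>I. (e l i)\<^sup>2) = 1"
    "\<And>l i. l \<in> eigenvalues_on I A \<Longrightarrow> i \<in> I \<Longrightarrow> (\<Sum>j\<in>I. A i j * e l j) = l * e l i"
    by metis
  have orth: "(\<Sum>i\<in>I. e l i * e k i) = of_bool (l = k)"
    if lk: "l \<in> eigenvalues_on I A" "k \<in> eigenvalues_on I A" for l k
  proof (cases "l = k")
    case True
    then show ?thesis using e(1)[OF lk(1)] by (simp add: power2_eq_square)
  next
    case False
    have "l * (\<Sum>i\<in>I. e l i * e k i) = (\<Sum>i\<in>I. (\<Sum>j\<in>I. A i j * e l j) * e k i)"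
      using e(2)[OF lk(1)] by (simp add: sum_distrib_left mult.assoc)
    also have "\<dots> = (\<Sum>i\<in>I. \<Sum>j\<in>I. A i j * e l j * e k i)"
      by (simp add: sum_distrib_right)
    also have "\<dots> = (\<Sum>j\<in>I. \<Sum>i\<in>I. A i j * e l j * e k i)" by (rule sum.swap)
    also have "\<dots> = (\<Sum>j\<in>I. (\<Sum>i\<in>I. A j i * e k i) * e l j)"
      unfolding sum_distrib_right by (intro sum.cong refl) (simp add: sym mult_ac)
    also have "\<dots> = k * (\<Sum>i\<in>I. e l i * e k i)"
      using e(2)[OF lk(2)] by (simp add: sum_distrib_left mult_ac)
    finally show ?thesis using False by simp
  qed
  \<comment> \<open>Orthonormal eigenvectors, one per eigenvalue, obey Bessel's inequality against
    each coordinate vector; summing it over I counts the eigenvalues in F.\<close>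
  have "card F \<le> card I" if F: "F \<subseteq> eigenvalues_on I A" "finite F" for F
  proof -
    have bessel: "(\<Sum>l\<in>F. (e l i)\<^sup>2) \<le> 1" if i: "i \<in> I" for i
    proof -
      let ?s = "\<lambda>j. \<Sum>l\<in>F. e l i * e l j"
      have "0 \<le> (\<Sum>j\<in>I. (of_bool (j = i) - ?s j)\<^sup>2)" by (simp add: sum_nonneg)
      also have "\<dots> = (\<Sum>j\<in>I. of_bool (j = i) - 2 * (of_bool (j = i) * ?s j) + ?s j * ?s j)"
        by (intro sum.cong refl) (simp add: power2_eq_square algebra_simps)
      also have "\<dots> = (\<Sum>j\<in>I. of_bool (j = i)) - 2 * (\<Sum>j\<in>I. of_bool (j = i) * ?s j) + (\<Sum>j\<in>I. ?s j * ?s j)"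
        by (simp add: sum.distrib sum_subtractf sum_distrib_left)
      also have "(\<Sum>j\<in>I. of_bool (j = i)) = (1::real)" using i I by simp
      also have "(\<Sum>j\<in>I. of_bool (j = i) * ?s j) = (\<Sum>j\<in>I. if j = i then ?s j else 0)"
        by (intro sum.cong) auto
      also have "\<dots> = ?s i" using i I by simp
      also have "?s i = (\<Sum>l\<in>F. (e l i)\<^sup>2)" by (simp add: power2_eq_square)
      also have "(\<Sum>j\<in>I. ?s j * ?s j) = (\<Sum>l\<in>F. (e l i)\<^sup>2)"
      proof -
        have "(\<Sum>j\<in>I. ?s j * ?s j) = (\<Sum>j\<in>I. \<Sum>l\<in>F. \<Sum>k\<in>F. e l i * e k i * (e l j * e k j))"
          by (simp add: sum_product algebra_simps)
        also have "\<dots> = (\<Sum>l\<in>F. \<Sum>k\<in>F. e l i * e k i * (\<Sum>j\<in>I. e l j * e k j))"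
          by (subst sum.swap, rule sum.cong, simp, subst sum.swap) (simp add: sum_distrib_left)
        also have "\<dots> = (\<Sum>l\<in>F. \<Sum>k\<in>F. if l = k then e l i * e k i else 0)"
          using orth F(1) by (intro sum.cong refl) (auto simp: subset_iff)
        also have "\<dots> = (\<Sum>l\<in>F. (e l i)\<^sup>2)" using F(2) by (simp add: power2_eq_square)
        finally show ?thesis .
      qed
      finally show ?thesis by simp
    qed
    have "real (card F) = (\<Sum>l\<in>F. \<Sum>i\<in>I. (e l i)\<^sup>2)"
      using e(1) F(1) by (simp add: subset_iff)
    also have "\<dots> = (\<Sum>i\<in>I. \<Sum>l\<in>F. (e l i)\<^sup>2)" by (rule sum.swap)
    also have "\<dots> \<le> (\<Sum>i\<in>I. 1)" using bessel by (intro sum_mono) auto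
    finally show ?thesis by simp
  qed
  then show ?thesis using finite_if_finite_subsets_card_bdd by blast
qed

text \<open>A maximizer of the form on the unit sphere is an eigenvector, and its eigenvalue is the
  maximum, hence positive.\<close>

lemma positive_eigenvalue_exists:
  assumes I: "finite I" and sym: "\<And>i j. i \<in> I \<Longrightarrow> j \<in> I \<Longrightarrow> A i j = A j i"
    and v0: "(\<Sum>i\<in>I. \<Sum>j\<in>I. v0 i * A i j * v0 j) > (0::real)"
  shows "\<exists>l\<in>eigenvalues_on I A. l > 0"
proof -
  define q where "q v = (\<Sum>i\<in>I. \<Sum>j\<in>I. v i * A i j * v j)" for v
  \<comment> \<open>Vanishing off I and coordinates in [-1, 1] make the sphere a closed subset of a
    product of compact intervals, so that Tychonoff's theorem gives compactness in the function
    space.\<close>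
  define S where "S = {v :: 'a \<Rightarrow> real. (\<forall>i. v i \<in> (if i \<in> I then {-1..1} else {0})) \<and> (\<Sum>i\<in>I. (v i)\<^sup>2) = 1}"
  have "compactin (product_topology (\<lambda>i::'a. euclideanreal) UNIV) (PiE UNIV (\<lambda>i. if i \<in> I then {-1..1} else {0}))"
    by (subst compactin_PiE) auto
  then have c1: "compact {v :: 'a \<Rightarrow> real. \<forall>i. v i \<in> (if i \<in> I then {-1..1} else {0})}"
    unfolding euclidean_product_topology compactin_euclidean_iff
    by (simp add: PiE_def Pi_def extensional_def)
  have cont: "continuous_on UNIV (\<lambda>v::'a \<Rightarrow> real. v i)" for i
    by (rule continuous_on_product_coordinates)
  have "closed {v :: 'a \<Rightarrow> real. (\<Sum>i\<in>I. (v i)\<^sup>2) = 1}"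
    by (intro closed_Collect_eq continuous_intros cont)
  with c1 have "compact ({v :: 'a \<Rightarrow> real. \<forall>i. v i \<in> (if i \<in> I then {-1..1} else {0})} \<inter> {v. (\<Sum>i\<in>I. (v i)\<^sup>2) = 1})"
    by (rule compact_Int_closed)
  then have S: "compact S" unfolding S_def by (simp add: Collect_conj_eq)
  have norm_S: "(\<lambda>i. if i \<in> I then v i / sqrt (\<Sum>i\<in>I. (v i)\<^sup>2) else 0) \<in> S \<and>
      q (\<lambda>i. if i \<in> I then v i / sqrt (\<Sum>i\<in>I. (v i)\<^sup>2) else 0) = q v / (\<Sum>i\<in>I. (v i)\<^sup>2)"
    if pos: "(\<Sum>i\<in>I. (v i)\<^sup>2) > 0" for v
  proof -
    define n where "n = sqrt (\<Sum>i\<in>I. (v i)\<^sup>2)"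
    have n: "n > 0" "n\<^sup>2 = (\<Sum>i\<in>I. (v i)\<^sup>2)" using pos by (auto simp: n_def)
    have "(v i)\<^sup>2 \<le> n\<^sup>2" if "i \<in> I" for i
      unfolding n(2) using I that by (intro member_le_sum) auto
    then have "\<bar>v i\<bar> \<le> n" if "i \<in> I" for i
      using n(1) that by (metis abs_le_square_iff abs_of_pos)
    then have "v i / n \<in> {-1..1}" if "i \<in> I" for i
      using n(1) that by (force simp: field_simps abs_le_iff)
    moreover have "(\<Sum>i\<in>I. (v i / n)\<^sup>2) = 1"
      using n pos by (simp add: power_divide flip: sum_divide_distrib)
    moreover have "q (\<lambda>i. if i \<in> I then v i / n else 0) = q v / n\<^sup>2"
      unfolding q_def sum_divide_distrib
      by (intro sum.cong refl) (simp add: power2_eq_square field_simps)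
    ultimately show ?thesis
      unfolding S_def n_def[symmetric] unfolding n(2)[symmetric] by (simp cong: if_cong)
  qed
  have v0pos: "(\<Sum>i\<in>I. (v0 i)\<^sup>2) > 0"
  proof (rule ccontr)
    assume "\<not> ?thesis"
    then have "(\<Sum>i\<in>I. (v0 i)\<^sup>2) = 0" by (simp add: not_less order_antisym sum_nonneg)
    then have "\<forall>i\<in>I. v0 i = 0" using I by (simp add: sum_nonneg_eq_0_iff)
    then show False using v0 by simp
  qed
  have "continuous_on UNIV q" unfolding q_def by (intro continuous_intros cont)
  then have "continuous_on S q" by (rule continuous_on_subset) simp
  moreover have "S \<noteq> {}" using norm_S[OF v0pos] by auto
  ultimately obtain u where u: "u \<in> S" "\<And>v. v \<in> S \<Longrightarrow> q v \<le> q u"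
    using continuous_attains_sup[OF S] by blast
  define l where "l = q u"
  have le: "q v \<le> l * (\<Sum>i\<in>I. (v i)\<^sup>2)" for v
  proof (cases "(\<Sum>i\<in>I. (v i)\<^sup>2) > 0")
    case True
    then show ?thesis using u(2)[OF conjunct1[OF norm_S[OF True]]] norm_S[OF True]
      by (simp add: l_def field_simps)
  next
    case False
    then have "(\<Sum>i\<in>I. (v i)\<^sup>2) = 0" by (simp add: not_less order_antisym sum_nonneg)
    then have "\<forall>i\<in>I. v i = 0" using I by (simp add: sum_nonneg_eq_0_iff)
    then show ?thesis by (simp add: q_def)
  qed
  have "0 < q v0" using v0 by (simp add: q_def)
  then have "0 < l * (\<Sum>i\<in>I. (v0 i)\<^sup>2)" using le[of v0] by linarith
  then have "0 < l" using v0pos by (simp add: zero_less_mult_iff)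
  have u1: "(\<Sum>i\<in>I. (u i)\<^sup>2) = 1" using u(1) by (simp add: S_def)
  have "(\<Sum>j\<in>I. A i j * u j) = l * u i" if i: "i \<in> I" for i
  proof -
    define a where "a = (\<Sum>j\<in>I. A i j * u j)"
    \<comment> \<open>Maximality of u tested on u plus s times the i-th coordinate vector; the term
      linear in s has to vanish.\<close>
    have "2 * s * (a - l * u i) \<le> s\<^sup>2 * (l - A i i)" for s
    proof -
      let ?w = "\<lambda>j. u j + s * of_bool (j = i)"
      have d: "(\<Sum>j\<in>I. of_bool (j = i) * f j) = f i" for f :: "'a \<Rightarrow> real"
      proof -
        have "(\<Sum>j\<in>I. of_bool (j = i) * f j) = (\<Sum>j\<in>I. if j = i then f j else 0)"
          by (intro sum.cong) auto
        then show ?thesis using i I by simp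
      qed
      have "q ?w = (\<Sum>k\<in>I. \<Sum>j\<in>I. u k * A k j * u j + s * (of_bool (j = i) * (u k * A k j))
           + s * (of_bool (k = i) * (A k j * u j)) + s\<^sup>2 * (of_bool (k = i) * (of_bool (j = i) * A k j)))"
        unfolding q_def by (intro sum.cong refl) (simp add: algebra_simps power2_eq_square)
      also have "\<dots> = q u + s * (\<Sum>k\<in>I. \<Sum>j\<in>I. of_bool (j = i) * (u k * A k j))
          + s * (\<Sum>k\<in>I. of_bool (k = i) * (\<Sum>j\<in>I. A k j * u j))
          + s\<^sup>2 * (\<Sum>k\<in>I. of_bool (k = i) * (\<Sum>j\<in>I. of_bool (j = i) * A k j))"
        unfolding q_def by (simp add: sum.distrib sum_distrib_left)
      also have "\<dots> = l + 2 * s * a + s\<^sup>2 * A i i"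
        unfolding d a_def l_def using sym i by (simp add: mult.commute)
      finally have "q ?w = l + 2 * s * a + s\<^sup>2 * A i i" .
      moreover have "(\<Sum>j\<in>I. (?w j)\<^sup>2) = (\<Sum>j\<in>I. (u j)\<^sup>2 + 2 * s * (of_bool (j = i) * u j) + s\<^sup>2 * (of_bool (j = i) * 1))"
        by (intro sum.cong refl) (simp add: algebra_simps power2_eq_square)
      then have "(\<Sum>j\<in>I. (?w j)\<^sup>2) = 1 + 2 * s * u i + s\<^sup>2"
        unfolding sum.distrib sum_distrib_left[symmetric] d u1 by simp
      ultimately show ?thesis using le[of ?w] by (simp add: algebra_simps)
    qed
    note s = this
    define b where "b = a - l * u i"
    \<comment> \<open>Any positive c above l - A i i works: s = b / c leads to 2 b^2 / c \<le> b^2 /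
      c, which forces b = 0.\<close>
    define c where "c = \<bar>l - A i i\<bar> + 1"
    have c: "c > 0" "l - A i i < c" by (auto simp: c_def)
    have "2 * (b / c) * b \<le> (b / c)\<^sup>2 * (l - A i i)" using s[of "b / c"] by (simp add: b_def)
    also have "\<dots> \<le> (b / c)\<^sup>2 * c" using c by (intro mult_left_mono) auto
    finally have "2 * b\<^sup>2 / c \<le> b\<^sup>2 / c" using c by (simp add: power2_eq_square field_simps)
    then have "b = 0" using c by (simp add: divide_le_cancel)
    then show ?thesis by (simp add: b_def a_def)
  qed
  moreover have "\<exists>i\<in>I. u i \<noteq> 0" using u1 by (rule_tac ccontr) simp
  ultimately show ?thesis using \<open>0 < l\<close> unfolding eigenvalues_on_def by blast
qed

lemma spectral_boundsI:
  fixes A :: "'a \<Rightarrow> 'a \<Rightarrow> real"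
  assumes I: "finite I" "2 \<le> card I" and h: "h > 0" and c: "c > 0" and C: "C > 0"
    and form: "symmetric_with_form I A q"
    and upper: "\<And>v. q v \<le> C / h * (\<Sum>i\<in>I. (v i)\<^sup>2)"
    and lower: "\<And>v. \<exists>a. c * h * (\<Sum>i\<in>I. (v i - a)\<^sup>2) \<le> q v"
    and const: "q (\<lambda>_. 1) = 0"
  shows "spectral_bounds I A h c C (C / c)"
proof -
  have sym: "\<And>i j. i \<in> I \<Longrightarrow> j \<in> I \<Longrightarrow> A i j = A j i"
    and q: "\<And>v. (\<Sum>i\<in>I. \<Sum>j\<in>I. v i * A i j * v j) = q v"
    using form unfolding symmetric_with_form_def by auto
  have fin: "finite (eigenvalues_on I A)" by (rule eigenvalues_on_finite[OF I(1) sym])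
  have q0: "0 \<le> q v" for v
  proof -
    obtain a where "c * h * (\<Sum>i\<in>I. (v i - a)\<^sup>2) \<le> q v" using lower by blast
    moreover have "0 \<le> c * h * (\<Sum>i\<in>I. (v i - a)\<^sup>2)" using c h by (simp add: sum_nonneg)
    ultimately show ?thesis by linarith
  qed
  obtain i0 i1 where i01: "i0 \<in> I" "i1 \<in> I" "i0 \<noteq> i1"
    using I by (metis card_le_Suc0_iff_eq not_less_eq_eq numeral_2_eq_2)
  \<comment> \<open>A point mass is not constant on two or more indices, so the lower bound makes
    the form positive there; this is what guarantees a nonzero eigenvalue.\<close>
  have "q (\<lambda>i. of_bool (i = i0)) > 0"
  proof (rule ccontr)
    assume "\<not> ?thesis"
    moreover obtain a where "c * h * (\<Sum>i\<in>I. (of_bool (i = i0) - a)\<^sup>2) \<le> q (\<lambda>i. of_bool (i = i0))"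
      using lower[of "\<lambda>i. of_bool (i = i0)"] by blast
    ultimately have "c * h * (\<Sum>i\<in>I. (of_bool (i = i0) - a)\<^sup>2) \<le> 0" by linarith
    then have "(\<Sum>i\<in>I. (of_bool (i = i0) - a)\<^sup>2) \<le> 0"
      using c h by (simp add: mult_le_0_iff not_less)
    then have "(\<Sum>i\<in>I. (of_bool (i = i0) - a)\<^sup>2) = 0" by (simp add: not_less order_antisym sum_nonneg)
    then have z: "(of_bool (i = i0) - a)\<^sup>2 = 0" if "i \<in> I" for i
      using I that by (simp add: sum_nonneg_eq_0_iff)
    show False using z[OF i01(1)] z[OF i01(2)] i01(3) by simp
  qed
  then have "0 < (\<Sum>i\<in>I. \<Sum>j\<in>I. of_bool (i = i0) * A i j * of_bool (j = i0))"
    by (subst q[of "\<lambda>i. of_bool (i = i0)"])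
  from positive_eigenvalue_exists[of I A "\<lambda>i. of_bool (i = i0)", OF I(1) _ this]
  have "\<exists>l\<in>eigenvalues_on I A. l > 0" using sym by simp
  then obtain l0 where l0: "l0 \<in> eigenvalues_on I A" "l0 > 0" by blast
  \<comment> \<open>The constant 1 minimizes the nonnegative form q, since q vanishes there. Its
    first variation in the i-th coordinate, which is the i-th row sum, is therefore zero.\<close>
  have A1: "(\<Sum>j\<in>I. A i j) = 0" if i: "i \<in> I" for i
  proof -
    define b where "b = (\<Sum>j\<in>I. A i j)"
    have "0 \<le> 2 * s * b + s\<^sup>2 * A i i" for s
    proof -
      let ?w = "\<lambda>j. 1 + s * of_bool (j = i)"
      have d: "(\<Sum>j\<in>I. of_bool (j = i) * f j) = f i" for f :: "'a \<Rightarrow> real"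
      proof -
        have "(\<Sum>j\<in>I. of_bool (j = i) * f j) = (\<Sum>j\<in>I. if j = i then f j else 0)"
          by (intro sum.cong) auto
        then show ?thesis using i I by simp
      qed
      have "q ?w = (\<Sum>k\<in>I. \<Sum>j\<in>I. 1 * A k j * 1 + s * (of_bool (j = i) * A k j)
           + s * (of_bool (k = i) * A k j) + s\<^sup>2 * (of_bool (k = i) * (of_bool (j = i) * A k j)))"
        unfolding q[symmetric] by (intro sum.cong refl) (simp add: algebra_simps power2_eq_square)
      also have "\<dots> = q (\<lambda>_. 1) + s * (\<Sum>k\<in>I. \<Sum>j\<in>I. of_bool (j = i) * A k j)
          + s * (\<Sum>k\<in>I. of_bool (k = i) * (\<Sum>j\<in>I. A k j))
          + s\<^sup>2 * (\<Sum>k\<in>I. of_bool (k = i) * (\<Sum>j\<in>I. of_bool (j = i) * A k j))"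
        unfolding q[symmetric] by (simp add: sum.distrib sum_distrib_left)
      also have "\<dots> = 2 * s * b + s\<^sup>2 * A i i"
      proof -
        have "(\<Sum>k\<in>I. A k i) = b" unfolding b_def using sym i by (intro sum.cong) auto
        then show ?thesis unfolding d const by (simp add: b_def)
      qed
      finally show ?thesis using q0[of ?w] by simp
    qed
    note s = this
    define c where "c = \<bar>A i i\<bar> + 1"
    have c: "c > 0" "A i i < c" by (auto simp: c_def)
    have "2 * (b / c) * b \<le> (b / c)\<^sup>2 * A i i" using s[of "- b / c"] by simp
    also have "\<dots> \<le> (b / c)\<^sup>2 * c" using c by (intro mult_left_mono) auto
    finally have "2 * b\<^sup>2 / c \<le> b\<^sup>2 / c" using c by (simp add: power2_eq_square field_simps)
    then have "b = 0" using c by (simp add: divide_le_cancel)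
    then show ?thesis by (simp add: b_def)
  qed
  have eig: "l \<le> C / h \<and> (l \<noteq> 0 \<longrightarrow> c * h \<le> l)" if l: "l \<in> eigenvalues_on I A" for l
  proof -
    obtain v j0 where v: "j0 \<in> I" "v j0 \<noteq> 0" "\<forall>i\<in>I. (\<Sum>j\<in>I. A i j * v j) = l * v i"
      using l unfolding eigenvalues_on_def by auto
    have pos: "(\<Sum>i\<in>I. (v i)\<^sup>2) > 0"
      using v(1,2) I by (intro sum_pos2[of _ j0]) auto
    have "q v = (\<Sum>i\<in>I. v i * (\<Sum>j\<in>I. A i j * v j))"
      unfolding q[symmetric] by (simp add: sum_distrib_left mult.assoc)
    also have "\<dots> = l * (\<Sum>i\<in>I. (v i)\<^sup>2)"
      using v(3) by (simp add: sum_distrib_left power2_eq_square mult_ac)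
    finally have qv: "q v = l * (\<Sum>i\<in>I. (v i)\<^sup>2)" .
    have "l \<le> C / h"
      using upper[of v] unfolding qv by (rule mult_right_le_imp_le) (rule pos)
    moreover have "c * h \<le> l" if "l \<noteq> 0"
    proof -
      have "l * (\<Sum>i\<in>I. v i) = (\<Sum>i\<in>I. \<Sum>j\<in>I. A i j * v j)"
        using v(3) by (simp add: sum_distrib_left)
      also have "\<dots> = (\<Sum>j\<in>I. \<Sum>i\<in>I. A i j * v j)" by (rule sum.swap)
      also have "\<dots> = (\<Sum>j\<in>I. (\<Sum>i\<in>I. A j i) * v j)"
        unfolding sum_distrib_right by (intro sum.cong refl) (simp add: sym)
      also have "\<dots> = 0" using A1 by simp
      finally have mean: "(\<Sum>i\<in>I. v i) = 0" using that by simp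
      obtain a where a: "c * h * (\<Sum>i\<in>I. (v i - a)\<^sup>2) \<le> q v" using lower by blast
      \<comment> \<open>For v of mean zero the cross term drops out, so no constant is closer to v
        than 0 and the unknown a can be removed.\<close>
      have "(\<Sum>i\<in>I. (v i - a)\<^sup>2) = (\<Sum>i\<in>I. (v i)\<^sup>2 - 2 * a * v i + a\<^sup>2)"
        by (intro sum.cong refl) (simp add: power2_eq_square algebra_simps)
      also have "\<dots> = (\<Sum>i\<in>I. (v i)\<^sup>2) - 2 * a * (\<Sum>i\<in>I. v i) + card I * a\<^sup>2"
        by (simp add: sum.distrib sum_subtractf sum_distrib_left)
      finally have "(\<Sum>i\<in>I. (v i)\<^sup>2) \<le> (\<Sum>i\<in>I. (v i - a)\<^sup>2)" using mean by simp
      then have "c * h * (\<Sum>i\<in>I. (v i)\<^sup>2) \<le> c * h * (\<Sum>i\<in>I. (v i - a)\<^sup>2)"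
        using c h by (intro mult_left_mono) auto
      then have "c * h * (\<Sum>i\<in>I. (v i)\<^sup>2) \<le> l * (\<Sum>i\<in>I. (v i)\<^sup>2)" using a qv by linarith
      then show ?thesis using pos by simp
    qed
    ultimately show ?thesis by blast
  qed
  have ne: "eigenvalues_on I A - {0} \<noteq> {}" using l0 by auto
  have mn: "c * h \<le> lambda_min_pos I A"
    unfolding lambda_min_pos_def using fin ne eig by (intro Min.boundedI) auto
  have mx: "lambda_max I A \<le> C / h"
    unfolding lambda_max_def using fin l0 eig by (intro Max.boundedI) auto
  have "l0 \<le> lambda_max I A" unfolding lambda_max_def using fin l0 by (intro Max_ge)
  then have mx0: "0 \<le> lambda_max I A" using l0 by simp
  have "kappa_pos I A \<le> (C / h) / (c * h)"
    unfolding kappa_pos_def using mn mx mx0 c h C by (intro frac_le) auto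
  also have "\<dots> = C / c / h\<^sup>2" by (simp add: power2_eq_square)
  finally show ?thesis unfolding spectral_bounds_def using ne mn mx by blast
qed

section \<open>Lattice potentials and the discrete Dirichlet problem\<close>

lemma abs_sin_of_nat_mult_le: "\<bar>sin (real n * x)\<bar> \<le> real n * \<bar>sin x\<bar>"
proof (induction n)
  case (Suc n)
  have "sin (real (Suc n) * x) = sin (real n * x) * cos x + cos (real n * x) * sin x"
    by (simp add: distrib_right sin_add add.commute)
  also have "\<bar>\<dots>\<bar> \<le> \<bar>sin (real n * x)\<bar> * \<bar>cos x\<bar> + \<bar>cos (real n * x)\<bar> * \<bar>sin x\<bar>"
    by (simp add: abs_mult[symmetric] abs_triangle_ineq)
  also have "\<dots> \<le> \<bar>sin (real n * x)\<bar> * 1 + 1 * \<bar>sin x\<bar>"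
    by (intro add_mono mult_mono) auto
  also have "\<dots> \<le> real (Suc n) * \<bar>sin x\<bar>" using Suc by (simp add: algebra_simps)
  finally show ?case .
qed simp

lemma one_minus_cos_int_mult_le: "1 - cos (of_int m * x) \<le> (of_int m)\<^sup>2 * (1 - cos x)" for x :: real
proof -
  have half: "1 - cos y = 2 * (sin (y / 2))\<^sup>2" for y :: real
    using cos_double_sin[of "y / 2"] by simp
  have "\<bar>sin (of_int m * (x / 2))\<bar> = \<bar>sin (real (nat \<bar>m\<bar>) * (x / 2))\<bar>"
    by (cases "m \<ge> 0") auto
  also have "\<dots> \<le> real (nat \<bar>m\<bar>) * \<bar>sin (x / 2)\<bar>" by (rule abs_sin_of_nat_mult_le)
  finally have "\<bar>sin (of_int m * (x / 2))\<bar>\<^sup>2 \<le> (real (nat \<bar>m\<bar>) * \<bar>sin (x / 2)\<bar>)\<^sup>2"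
    by (intro power_mono) auto
  then show ?thesis unfolding half by (simp add: power_mult_distrib)
qed

lemma one_minus_cos_add_le: "1 - cos (x + y) \<le> 2 * (1 - cos x) + 2 * (1 - cos y)" for x y :: real
proof -
  have half: "1 - cos y = 2 * (sin (y / 2))\<^sup>2" for y :: real
    using cos_double_sin[of "y / 2"] by simp
  define a b c d where "a = sin (x / 2)" and "b = cos (x / 2)" and "c = sin (y / 2)" and "d = cos (y / 2)"
  have "a\<^sup>2 * d\<^sup>2 \<le> a\<^sup>2 * 1" "c\<^sup>2 * b\<^sup>2 \<le> c\<^sup>2 * 1"
    unfolding b_def d_def by (intro mult_left_mono; simp add: abs_square_le_1)+
  moreover have "(a * d + b * c)\<^sup>2 \<le> 2 * (a\<^sup>2 * d\<^sup>2) + 2 * (c\<^sup>2 * b\<^sup>2)"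
    using zero_le_power2[of "a * d - b * c"] by (simp add: power2_eq_square algebra_simps)
  ultimately have "(a * d + b * c)\<^sup>2 \<le> 2 * a\<^sup>2 + 2 * c\<^sup>2" by linarith
  moreover have "sin ((x + y) / 2) = a * d + b * c"
    unfolding a_def b_def c_def d_def by (simp add: add_divide_distrib sin_add)
  ultimately show ?thesis unfolding half a_def c_def by simp
qed

text \<open>This is h^2 L_h in index coordinates: harmonicity is blind to the factor, and the
  lattice Green's function has the same values for all h.\<close>

definition discrete_laplacian :: "(node \<Rightarrow> real) \<Rightarrow> node \<Rightarrow> real" where
  "discrete_laplacian u x = (\<Sum>e\<in>axis_directions. u (x + e)) - 4 * u x"

lemma sum_axis_directions:
  "(\<Sum>e\<in>axis_directions. f e) = f (1, 0) + f (-1, 0) + f (0, 1) + f (0, -1)" for f :: "node \<Rightarrow> real"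
  unfolding axis_directions_def by (simp add: add.assoc)

abbreviation (input) torus_square :: "plane set" where
  "torus_square \<equiv> {-pi..pi} \<times> {-pi..pi}"

definition green_integrand :: "node \<Rightarrow> plane \<Rightarrow> real" where
  "green_integrand m t = (cos (of_int (fst m) * fst t + of_int (snd m) * snd t) - 1)
     / (4 - 2 * cos (fst t) - 2 * cos (snd t))"

text \<open>Numerator and denominator both vanish to second order at the origin. The two cosine
  inequalities above bound the numerator by a multiple of the denominator, which avoids any Taylor
  expansion.\<close>

lemma green_integrand_bound:
  "\<bar>green_integrand m t\<bar> \<le> (of_int (fst m))\<^sup>2 + (of_int (snd m))\<^sup>2"
proof -
  define a b where "a = 1 - cos (fst t)" and "b = 1 - cos (snd t)"
  define p q where "p = (of_int (fst m) :: real)\<^sup>2" and "q = (of_int (snd m) :: real)\<^sup>2"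
  have nn: "0 \<le> a" "0 \<le> b" "0 \<le> p" "0 \<le> q" by (auto simp: a_def b_def p_def q_def)
  define n where "n = 1 - cos (of_int (fst m) * fst t + of_int (snd m) * snd t)"
  have "n \<le> 2 * (1 - cos (of_int (fst m) * fst t)) + 2 * (1 - cos (of_int (snd m) * snd t))"
    unfolding n_def by (rule one_minus_cos_add_le)
  also have "\<dots> \<le> 2 * (p * a) + 2 * (q * b)"
    unfolding a_def b_def p_def q_def by (intro add_mono mult_left_mono one_minus_cos_int_mult_le) auto
  also have "\<dots> \<le> (p + q) * (2 * a + 2 * b)" using nn by (simp add: algebra_simps)
  finally have "n \<le> (p + q) * (2 * a + 2 * b)" .
  moreover have "n \<ge> 0" by (simp add: n_def)
  moreover have "green_integrand m t = - n / (2 * a + 2 * b)"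
    by (simp add: green_integrand_def n_def a_def b_def)
  \<comment> \<open>For d = 0 the quotient is 0 by convention, so the bound holds at the singular
    point as well.\<close>
  moreover have "n / d \<le> p + q" if "n \<le> (p + q) * d" "d \<ge> 0" for d
    using that nn by (cases "d = 0") (auto simp: divide_le_eq)
  ultimately have "\<bar>green_integrand m t\<bar> \<le> p + q"
    using nn by (simp add: abs_of_nonneg)
  then show ?thesis by (simp add: p_def q_def)
qed

lemma torus_square_cbox: "torus_square = cbox (-pi, -pi) (pi, pi)"
  by (auto simp: cbox_Pair_eq)

lemma green_integrand_integrable: "set_integrable lborel torus_square (green_integrand m)"
  unfolding set_integrable_def
proof (rule integrableI_bounded_set_indicator)
  show "torus_square \<in> sets lborel" unfolding torus_square_cbox by simp
  have "green_integrand m \<in> borel_measurable borel"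
    unfolding green_integrand_def
    by (intro borel_measurable_divide borel_measurable_continuous_onI continuous_intros)
  then show "green_integrand m \<in> borel_measurable lborel" by simp
  show "emeasure lborel torus_square < \<infinity>" unfolding torus_square_cbox by (rule emeasure_lborel_cbox_finite)
  show "AE x in lborel. x \<in> torus_square \<longrightarrow> norm (green_integrand m x) \<le> (of_int (fst m))\<^sup>2 + (of_int (snd m))\<^sup>2"
    using green_integrand_bound by simp
qed

lemma integral_cos_int_period:
  "integral {-pi..pi} (\<lambda>t. cos (c + of_int m * t)) = (if m = 0 then 2 * pi * cos c else 0)"
proof (cases "m = 0")
  case False
  have "((\<lambda>t. cos (c + of_int m * t)) has_integral
      sin (c + of_int m * pi) / of_int m - sin (c + of_int m * (-pi)) / of_int m) {-pi..pi}"
    using False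
    by (intro fundamental_theorem_of_calculus)
       (auto intro!: derivative_eq_intros simp flip: has_real_derivative_iff_has_vector_derivative)
  moreover have "sin (c + of_int m * pi) = sin (c + of_int m * (-pi))"
    by (simp add: sin_add sin_diff sin_npi_int mult.commute)
  ultimately show ?thesis using False by (simp add: integral_unique)
qed simp

lemma integral_cos_torus:
  "(LINT t:torus_square|lborel. cos (of_int (fst m) * fst t + of_int (snd m) * snd t))
     = 4 * pi\<^sup>2 * of_bool (m = (0, 0))"
proof -
  let ?f = "\<lambda>t::plane. cos (of_int (fst m) * fst t + of_int (snd m) * snd t)"
  have cont: "continuous_on (cbox (-pi, -pi) (pi, pi)) ?f" by (intro continuous_intros)
  then have "set_integrable lborel torus_square ?f"
    unfolding torus_square_cbox set_integrable_def by (rule borel_integrable_compact[OF compact_cbox])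
  then have "(LINT t:torus_square|lborel. ?f t) = integral (cbox (-pi, -pi) (pi, pi)) ?f"
    unfolding torus_square_cbox by (rule set_borel_integral_eq_integral)
  also have "\<dots> = integral {-pi..pi} (\<lambda>x. integral {-pi..pi} (\<lambda>y. cos (of_int (fst m) * x + of_int (snd m) * y)))"
    by (subst integral_prod_continuous[OF cont]) simp
  also have "\<dots> = integral {-pi..pi} (\<lambda>x. (if snd m = 0 then 2 * pi else 0) * cos (0 + of_int (fst m) * x))"
    unfolding integral_cos_int_period by (intro integral_cong) simp
  also have "\<dots> = (if snd m = 0 then 2 * pi else 0) * (if fst m = 0 then 2 * pi * cos 0 else 0)"
    by (subst integral_mult_right) (simp only: integral_cos_int_period)
  also have "\<dots> = 4 * pi\<^sup>2 * of_bool (m = (0, 0))"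
    by (auto simp: power2_eq_square prod_eq_iff)
  finally show ?thesis .
qed

lemma cos_eq_1_imp_0: "t = 0" if "cos t = 1" "t \<in> {-pi..pi}" for t :: real
proof (rule ccontr)
  assume "t \<noteq> 0"
  then have "cos \<bar>t\<bar> < cos 0" using that by (intro cos_monotone_0_pi) auto
  then show False using that by simp
qed

text \<open>On the cosine the stencil acts as multiplication by minus the denominator, and the
  subtracted 1 drops out because the stencil weights add up to zero. What remains is the integral of
  - cos over the torus, nonzero only for m = 0.\<close>

lemma discrete_laplacian_lattice_green:
  "discrete_laplacian lattice_green m = - of_bool (m = (0, 0))"
proof -
  let ?I = "\<lambda>f. LINT t:torus_square|lborel. f t"
  note int = green_integrand_integrable
  have G: "lattice_green m = 1 / (4 * pi\<^sup>2) * ?I (green_integrand m)" for m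
    by (simp add: lattice_green_def green_integrand_def)
  have "discrete_laplacian lattice_green m = 1 / (4 * pi\<^sup>2) *
     (?I (green_integrand (m + (1, 0))) + ?I (green_integrand (m + (-1, 0)))
      + ?I (green_integrand (m + (0, 1))) + ?I (green_integrand (m + (0, -1))) - 4 * ?I (green_integrand m))"
    unfolding discrete_laplacian_def sum_axis_directions G by (simp add: algebra_simps)
  also have "\<dots> = 1 / (4 * pi\<^sup>2) *
     ?I (\<lambda>t. green_integrand (m + (1, 0)) t + green_integrand (m + (-1, 0)) t
      + green_integrand (m + (0, 1)) t + green_integrand (m + (0, -1)) t - 4 * green_integrand m t)"
    by (simp add: set_integral_add set_integral_diff int)
  also have "?I (\<lambda>t. green_integrand (m + (1, 0)) t + green_integrand (m + (-1, 0)) t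
      + green_integrand (m + (0, 1)) t + green_integrand (m + (0, -1)) t - 4 * green_integrand m t)
    = ?I (\<lambda>t. - cos (of_int (fst m) * fst t + of_int (snd m) * snd t))"
  proof (rule set_lebesgue_integral_cong_AE)
    show "torus_square \<in> sets lborel" unfolding torus_square_cbox by simp
    have "green_integrand m \<in> borel_measurable borel" for m
      unfolding green_integrand_def
      by (intro borel_measurable_divide borel_measurable_continuous_onI continuous_intros)
    then show "(\<lambda>t. green_integrand (m + (1, 0)) t + green_integrand (m + (-1, 0)) t
      + green_integrand (m + (0, 1)) t + green_integrand (m + (0, -1)) t - 4 * green_integrand m t)
       \<in> borel_measurable lborel" by simp
    show "(\<lambda>t::plane. - cos (of_int (fst m) * fst t + of_int (snd m) * snd t)) \<in> borel_measurable lborel"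
      by (simp add: borel_measurable_continuous_onI continuous_intros)
    have eq: "green_integrand (m + (1, 0)) t + green_integrand (m + (-1, 0)) t
      + green_integrand (m + (0, 1)) t + green_integrand (m + (0, -1)) t - 4 * green_integrand m t
      = - cos (of_int (fst m) * fst t + of_int (snd m) * snd t)"
      if t: "t \<in> torus_square" "t \<noteq> 0" for t
    proof -
      define z where "z = of_int (fst m) * fst t + of_int (snd m) * snd t"
      define d where "d = 4 - 2 * cos (fst t) - 2 * cos (snd t)"
      have d: "d \<noteq> 0"
      proof
        assume "d = 0"
        then have "cos (fst t) = 1 \<and> cos (snd t) = 1"
          unfolding d_def using cos_le_one[of "fst t"] cos_le_one[of "snd t"] by linarith
        then have "fst t = 0" "snd t = 0" using t(1) cos_eq_1_imp_0 by (auto simp: mem_Times_iff)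
        then show False using t(2) by (simp add: prod_eq_iff)
      qed
      have "green_integrand (m + (1, 0)) t + green_integrand (m + (-1, 0)) t
        + green_integrand (m + (0, 1)) t + green_integrand (m + (0, -1)) t - 4 * green_integrand m t
        = ((cos (z + fst t) - 1) + (cos (z - fst t) - 1) + (cos (z + snd t) - 1) + (cos (z - snd t) - 1)
           - 4 * (cos z - 1)) / d"
        unfolding green_integrand_def d_def[symmetric]
        by (simp add: z_def algebra_simps add_divide_distrib diff_divide_distrib)
      also have "\<dots> = - cos z * d / d"
        unfolding d_def cos_add cos_diff by (simp add: algebra_simps)
      also have "\<dots> = - cos z" using d by simp
      finally show ?thesis unfolding z_def .
    qed
    \<comment> \<open>The cancellation needs a nonzero denominator, which fails on the square only
      at the origin, a null set.\<close>
    have "AE t in lborel. t \<noteq> (0::plane)" by (rule AE_lborel_singleton)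
    then show "AE t\<in>torus_square in lborel. green_integrand (m + (1, 0)) t + green_integrand (m + (-1, 0)) t
      + green_integrand (m + (0, 1)) t + green_integrand (m + (0, -1)) t - 4 * green_integrand m t
      = - cos (of_int (fst m) * fst t + of_int (snd m) * snd t)"
      by eventually_elim (use eq in blast)
  qed
  also have "\<dots> = - (4 * pi\<^sup>2 * of_bool (m = (0, 0)))"
    unfolding integral_cos_torus[symmetric] set_lebesgue_integral_def by simp
  finally show ?thesis by simp
qed

section \<open>The discrete Dirichlet problem next to the boundary\<close>

lemma adj_iff: "adj x y \<longleftrightarrow> y - x \<in> axis_directions"
  unfolding adj_def axis_directions_def by (cases x; cases y) auto

lemma adj_sym: "adj x y \<longleftrightarrow> adj y x"
  unfolding adj_def by linarith

lemma finite_axis_directions [simp]: "finite axis_directions"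
  by (simp add: axis_directions_def)

lemma card_axis_directions: "card axis_directions = 4"
  by (simp add: axis_directions_def)

lemma uminus_axis_directions: "e \<in> axis_directions \<Longrightarrow> - e \<in> axis_directions"
  by (auto simp: axis_directions_def)

lemma finite_adj: "finite {y. adj x y}"
proof -
  have "{y. adj x y} = (\<lambda>e. x + e) ` axis_directions"
    unfolding adj_iff by (force simp: image_iff algebra_simps)
  then show ?thesis by simp
qed

definition boundary_layer :: "node set \<Rightarrow> node set" where
  "boundary_layer V = {x \<in> V. \<exists>y. y \<notin> V \<and> adj x y}"

definition outer_boundary :: "node set \<Rightarrow> node set" where
  "outer_boundary V = {y. y \<notin> V \<and> (\<exists>x\<in>V. adj x y)}"

lemma finite_outer_boundary: "finite V \<Longrightarrow> finite (outer_boundary V)"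
  by (rule finite_subset[of _ "\<Union>x\<in>V. {y. adj x y}"]) (auto simp: outer_boundary_def finite_adj)

text \<open>The weight \<open>\<phi>\<close> below is a bounded superharmonic function that is strictly superharmonic on the
  two layers next to the boundary; testing the subharmonic function \<open>u\<^sup>2\<close> with it in Green's identity
  gives the estimate.\<close>

lemma dirichlet_layer_bound:
  assumes V: "finite V" and u: "\<And>x. x \<in> V \<Longrightarrow> discrete_laplacian u x = 0"
    and N: "N \<subseteq> V" "\<And>x. x \<in> N \<Longrightarrow> x \<in> boundary_layer V \<or> (\<exists>y\<in>boundary_layer V. adj x y)"
  shows "(\<Sum>x\<in>N. (u x)\<^sup>2) \<le> 20 * (\<Sum>y\<in>outer_boundary V. (u y)\<^sup>2)"
proof -
  \<comment> \<open>The value 4/5 balances the two layers: the neighbours of a boundary node sum to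
    at most 3 = 4 * 4/5 - 1/5, those of a node next to it to at most 3 + 4/5 = 4 - 1/5. The deficit
    is 1/5 in both cases.\<close>
  define \<phi> :: "node \<Rightarrow> real" where
    "\<phi> x = (if x \<notin> V then 0 else if x \<in> boundary_layer V then 4 / 5 else 1)" for x
  define w where "w x = (u x)\<^sup>2" for x
  let ?E = axis_directions
  have \<phi>: "0 \<le> \<phi> x" "\<phi> x \<le> 1" for x by (auto simp: \<phi>_def)
  have w0: "0 \<le> w x" for x by (simp add: w_def)
  have super: "(\<Sum>e\<in>?E. \<phi> (x + e)) \<le> 4 * \<phi> x - of_bool (x \<in> N) / 5" if x: "x \<in> V" for x
  proof -
    have one: "(\<Sum>e\<in>?E. \<phi> (x + e)) \<le> \<phi> (x + e0) + 3" if "e0 \<in> ?E" for e0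
    proof -
      have "(\<Sum>e\<in>?E. \<phi> (x + e)) = \<phi> (x + e0) + (\<Sum>e\<in>?E - {e0}. \<phi> (x + e))"
        using that by (simp add: sum.remove)
      also have "(\<Sum>e\<in>?E - {e0}. \<phi> (x + e)) \<le> (\<Sum>e\<in>?E - {e0}. 1)"
        by (intro sum_mono \<phi>)
      also have "\<dots> = 3" using that by (simp add: card_axis_directions)
      finally show ?thesis by simp
    qed
    consider (a) "x \<in> boundary_layer V" | (b) "x \<notin> boundary_layer V" "x \<in> N" | (c) "x \<notin> boundary_layer V" "x \<notin> N"
      by blast
    then show ?thesis
    proof cases
      case a
      then obtain y where y: "y \<notin> V" "adj x y" unfolding boundary_layer_def by auto
      have "\<phi> (x + (y - x)) = 0" using y by (simp add: \<phi>_def)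
      then show ?thesis using one[of "y - x"] y a x by (auto simp: adj_iff \<phi>_def)
    next
      case b
      then obtain y where y: "y \<in> boundary_layer V" "adj x y" using N(2) by blast
      then have "\<phi> (x + (y - x)) = 4 / 5" by (simp add: \<phi>_def boundary_layer_def)
      then show ?thesis using one[of "y - x"] y b x by (auto simp: adj_iff \<phi>_def)
    next
      case c
      have "(\<Sum>e\<in>?E. \<phi> (x + e)) \<le> (\<Sum>e\<in>?E. 1)" by (intro sum_mono \<phi>)
      then show ?thesis using c x by (simp add: card_axis_directions \<phi>_def)
    qed
  qed
  \<comment> \<open>The square of a harmonic function is subharmonic: the defect is the sum of the
    squared differences to the neighbours.\<close>
  have sub: "4 * w x \<le> (\<Sum>e\<in>?E. w (x + e))" if x: "x \<in> V" for x
  proof -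
    have "0 \<le> (\<Sum>e\<in>?E. (u (x + e) - u x)\<^sup>2)" by (simp add: sum_nonneg)
    also have "\<dots> = (\<Sum>e\<in>?E. w (x + e)) - 2 * u x * (\<Sum>e\<in>?E. u (x + e)) + 4 * w x"
      unfolding sum_axis_directions w_def by (simp add: power2_eq_square algebra_simps)
    also have "(\<Sum>e\<in>?E. u (x + e)) = 4 * u x" using u[OF x] by (simp add: discrete_laplacian_def)
    finally show ?thesis by (simp add: w_def power2_eq_square)
  qed
  define S where "S = {(x, e) \<in> V \<times> ?E. x + e \<in> V}"
  define Q where "Q = {(x, e) \<in> V \<times> ?E. x + e \<notin> V}"
  have fin: "finite S" "finite Q" "S \<inter> Q = {}" "S \<union> Q = V \<times> ?E"
    using V by (auto simp: S_def Q_def intro: finite_subset[of _ "V \<times> ?E"])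
  \<comment> \<open>Green's identity: reversing each inner edge moves the stencil from w to \<phi>.
    The edges leaving V may then be added, as \<phi> vanishes outside V.\<close>
  have "(\<Sum>(x, e)\<in>S. \<phi> x * w (x + e)) = (\<Sum>(x, e)\<in>S. \<phi> (x + e) * w x)"
    by (rule sum.reindex_bij_witness[of _ "\<lambda>(x, e). (x + e, - e)" "\<lambda>(x, e). (x + e, - e)"])
       (auto simp: S_def uminus_axis_directions[of "(_, _)", simplified])
  also have "\<dots> = (\<Sum>(x, e)\<in>S. \<phi> (x + e) * w x) + (\<Sum>(x, e)\<in>Q. \<phi> (x + e) * w x)"
    by (simp add: Q_def \<phi>_def case_prod_beta)
  also have "\<dots> = (\<Sum>(x, e)\<in>V \<times> ?E. \<phi> (x + e) * w x)"
    using fin by (metis (no_types, lifting) sum.union_disjoint)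
  also have "\<dots> = (\<Sum>x\<in>V. (\<Sum>e\<in>?E. \<phi> (x + e)) * w x)"
    by (simp add: sum.cartesian_product[symmetric] sum_distrib_right)
  also have "\<dots> \<le> (\<Sum>x\<in>V. (4 * \<phi> x - of_bool (x \<in> N) / 5) * w x)"
    by (intro sum_mono mult_right_mono super w0)
  also have "\<dots> = 4 * (\<Sum>x\<in>V. \<phi> x * w x) - (\<Sum>x\<in>V. of_bool (x \<in> N) * w x) / 5"
    by (simp add: algebra_simps sum_subtractf sum_distrib_left flip: sum_divide_distrib)
  also have "(\<Sum>x\<in>V. of_bool (x \<in> N) * w x) = (\<Sum>x\<in>N. w x)"
    using V N(1) by (intro sum.mono_neutral_cong_right) auto
  finally have A: "(\<Sum>(x, e)\<in>S. \<phi> x * w (x + e)) \<le> 4 * (\<Sum>x\<in>V. \<phi> x * w x) - (\<Sum>x\<in>N. w x) / 5" .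
  have "4 * (\<Sum>x\<in>V. \<phi> x * w x) = (\<Sum>x\<in>V. \<phi> x * (4 * w x))"
    by (simp add: sum_distrib_left algebra_simps)
  also have "\<dots> \<le> (\<Sum>x\<in>V. \<phi> x * (\<Sum>e\<in>?E. w (x + e)))"
    by (intro sum_mono mult_left_mono sub \<phi>)
  also have "\<dots> = (\<Sum>(x, e)\<in>V \<times> ?E. \<phi> x * w (x + e))"
    by (simp add: sum.cartesian_product[symmetric] sum_distrib_left)
  also have "\<dots> = (\<Sum>(x, e)\<in>S. \<phi> x * w (x + e)) + (\<Sum>(x, e)\<in>Q. \<phi> x * w (x + e))"
    using fin by (metis (no_types, lifting) sum.union_disjoint)
  also have "(\<Sum>(x, e)\<in>Q. \<phi> x * w (x + e)) \<le> (\<Sum>(x, e)\<in>Q. w (x + e))"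
    using \<phi> w0 by (intro sum_mono) (auto intro: mult_left_le_one_le)
  \<comment> \<open>An outer node is reached by at most four leaving edges, one per direction; this
    4 against the deficit 1/5 gives the factor 20.\<close>
  also have "(\<Sum>(x, e)\<in>Q. w (x + e)) = (\<Sum>(y, e)\<in>(\<lambda>(x, e). (x + e, e)) ` Q. w y)"
    by (subst sum.reindex) (auto simp: inj_on_def case_prod_beta)
  also have "\<dots> \<le> (\<Sum>(y, e)\<in>outer_boundary V \<times> ?E. w y)"
  proof (rule sum_mono2)
    have "x + e \<in> outer_boundary V" if "x \<in> V" "e \<in> ?E" "x + e \<notin> V" for x e
      using that unfolding outer_boundary_def by (auto simp: adj_iff intro!: bexI[of _ x])
    then show "(\<lambda>(x, e). (x + e, e)) ` Q \<subseteq> outer_boundary V \<times> ?E" by (auto simp: Q_def)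
  qed (use V w0 in \<open>auto simp: finite_outer_boundary\<close>)
  also have "\<dots> = 4 * (\<Sum>y\<in>outer_boundary V. w y)"
    by (simp add: sum.cartesian_product[symmetric] card_axis_directions sum_distrib_left)
  finally show ?thesis using A unfolding w_def by linarith
qed

section \<open>Bilinear elements on segments and cells\<close>

definition bilinear :: "(node \<Rightarrow> real) \<Rightarrow> node \<Rightarrow> real \<Rightarrow> real \<Rightarrow> real" where
  "bilinear u k a b = (1 - a) * (1 - b) * u k + a * (1 - b) * u (k + (1, 0))
     + (1 - a) * b * u (k + (0, 1)) + a * b * u (k + (1, 1))"

definition bilinear_deriv :: "(node \<Rightarrow> real) \<Rightarrow> node \<Rightarrow> real \<Rightarrow> real \<Rightarrow> real \<Rightarrow> real \<Rightarrow> real" where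
  "bilinear_deriv u k da db a b =
     da * ((1 - b) * (u (k + (1, 0)) - u k) + b * (u (k + (1, 1)) - u (k + (0, 1))))
     + db * ((1 - a) * (u (k + (0, 1)) - u k) + a * (u (k + (1, 1)) - u (k + (1, 0))))"

lemma bilinear_alt:
  "bilinear u k a b = (1 - b) * ((1 - a) * u k + a * u (k + (1, 0)))
     + b * ((1 - a) * u (k + (0, 1)) + a * u (k + (1, 1)))"
  by (simp add: bilinear_def algebra_simps)

lemma bilinear_line_has_deriv:
  "((\<lambda>t. bilinear u k (a + t * da) (b + t * db)) has_real_derivative
     bilinear_deriv u k da db (a + t * da) (b + t * db)) (at t within S)"
proof -
  have "((\<lambda>t. bilinear u k (a + t * da) (b + t * db)) has_real_derivative
     (- da * (1 - (b + t * db)) * u k - (1 - (a + t * da)) * db * u k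
      + (da * (1 - (b + t * db)) * u (k + (1, 0)) - (a + t * da) * db * u (k + (1, 0)))
      + (- da * (b + t * db) * u (k + (0, 1)) + (1 - (a + t * da)) * db * u (k + (0, 1)))
      + (da * (b + t * db) * u (k + (1, 1)) + (a + t * da) * db * u (k + (1, 1))))) (at t within S)"
    unfolding bilinear_def by (auto intro!: derivative_eq_intros simp: algebra_simps)
  then show ?thesis
    by (rule DERIV_cong) (simp add: bilinear_deriv_def algebra_simps)
qed

lemma bilinear_deriv_sum:
  "bilinear_deriv (\<lambda>\<xi>. \<Sum>i\<in>I. c i * w i \<xi>) k da db a b = (\<Sum>i\<in>I. c i * bilinear_deriv (w i) k da db a b)"
  unfolding bilinear_deriv_def
  by (simp add: sum_distrib_left sum_subtractf sum.distrib algebra_simps)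

lemma finite_cell_vertices [simp]: "finite (cell_vertices k)"
  by (simp add: cell_vertices_def)

lemma sum_cell_vertices:
  "(\<Sum>\<xi>\<in>cell_vertices k. f \<xi>) = f k + f (k + (1, 0)) + f (k + (0, 1)) + f (k + (1, 1))"
  for f :: "node \<Rightarrow> 'b::comm_monoid_add"
  by (cases k) (simp add: cell_vertices_def add.assoc)

lemma mem_cell_iff:
  assumes "h > 0"
  shows "x \<in> cell h k \<longleftrightarrow> 0 \<le> fst x / h - fst k \<and> fst x / h - fst k \<le> 1
     \<and> 0 \<le> snd x / h - snd k \<and> snd x / h - snd k \<le> 1"
  using assms by (cases x; cases k) (auto simp: cell_def pt_def field_simps)

lemma hat_int:
  assumes "0 \<le> a" "a \<le> 1"
  shows "hat (a - of_int n) = (if n = 0 then 1 - a else if n = 1 then a else 0)"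
proof -
  consider "n \<le> -1" | "n = 0" | "n = 1" | "n \<ge> 2" by linarith
  then show ?thesis
  proof cases
    case 1
    then have "a - of_int n \<ge> 1" using assms by linarith
    then show ?thesis using 1 by (simp add: hat_def)
  next
    case 4
    then have "a - of_int n \<le> -1" using assms by linarith
    then show ?thesis using 4 by (simp add: hat_def)
  qed (use assms in \<open>auto simp: hat_def\<close>)
qed

lemma hat_basis_cell:
  assumes h: "h > 0" and x: "x \<in> cell h k"
  shows "hat_basis h \<xi> x =
    (let a = fst x / h - fst k; b = snd x / h - snd k; n = fst \<xi> - fst k; m = snd \<xi> - snd k in
     (if n = 0 then 1 - a else if n = 1 then a else 0) * (if m = 0 then 1 - b else if m = 1 then b else 0))"
proof -
  define a b where "a = fst x / h - fst k" and "b = snd x / h - snd k"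
  have ab: "0 \<le> a" "a \<le> 1" "0 \<le> b" "b \<le> 1"
    using x unfolding mem_cell_iff[OF h] a_def b_def by auto
  have "fst x / h - fst \<xi> = a - of_int (fst \<xi> - fst k)" "snd x / h - snd \<xi> = b - of_int (snd \<xi> - snd k)"
    by (auto simp: a_def b_def)
  then show ?thesis
    unfolding hat_basis_def Let_def a_def[symmetric] b_def[symmetric]
    by (simp only: hat_int[OF ab(1,2)] hat_int[OF ab(3,4)])
qed

lemma fe_function_cell:
  assumes h: "h > 0" and x: "x \<in> cell h k" and N: "finite N" "cell_vertices k \<subseteq> N"
  shows "fe_function h N u x = bilinear u k (fst x / h - fst k) (snd x / h - snd k)"
proof -
  define a b where "a = fst x / h - fst k" and "b = snd x / h - snd k"
  have "fe_function h N u x = (\<Sum>\<xi>\<in>cell_vertices k. u \<xi> * hat_basis h \<xi> x)"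
    unfolding fe_function_def
  proof (intro sum.mono_neutral_right N ballI)
    fix \<xi> assume "\<xi> \<in> N - cell_vertices k"
    then show "u \<xi> * hat_basis h \<xi> x = 0"
      unfolding hat_basis_cell[OF h x] by (cases \<xi>; cases k) (auto simp: cell_vertices_def Let_def)
  qed
  also have "\<dots> = bilinear u k a b"
    unfolding sum_cell_vertices hat_basis_cell[OF h x] bilinear_def Let_def a_def[symmetric] b_def[symmetric]
    by (simp add: mult_ac)
  finally show ?thesis unfolding a_def b_def .
qed

lemma continuous_fe_function [continuous_intros]: "continuous_on S (fe_function h N u)"
  unfolding fe_function_def hat_basis_def hat_def divide_inverse
  by (intro continuous_intros)

text \<open>With n the length, the chain rule gives tangential derivatives F / n and G / n; together
  with the arc length element n this leaves a factor 1 / n. The set X collects kinks of the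
  functions along the segment, which do not affect the integral. For p = q both sides are 0, the
  right one by division by zero.\<close>

lemma segment_form_eq:
  assumes X: "finite X"
    and F: "\<And>t. t \<in> {0<..<1} - X \<Longrightarrow> ((\<lambda>s. f (p + s *\<^sub>R (q - p))) has_real_derivative F t) (at t)"
    and G: "\<And>t. t \<in> {0<..<1} - X \<Longrightarrow> ((\<lambda>s. g (p + s *\<^sub>R (q - p))) has_real_derivative G t) (at t)"
  shows "segment_form p q f g = (LINT t:{0..1}|lborel. F t * G t) / norm (q - p)"
proof (cases "p = q")
  case True
  then show ?thesis by (simp add: segment_form_def segment_integral_def)
next
  case False
  define n where "n = norm (q - p)"
  have n: "n > 0" using False by (simp add: n_def)
  have grad: "tangential_gradient p q f (p + t *\<^sub>R (q - p)) = (F t / n) *\<^sub>R sgn (q - p)"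
    if "((\<lambda>s. f (p + s *\<^sub>R (q - p))) has_real_derivative F t) (at t)" for f F t
  proof -
    have "f (p + t *\<^sub>R (q - p) + s *\<^sub>R sgn (q - p)) = f (p + (t + s / n) *\<^sub>R (q - p))" for s
      by (simp add: sgn_div_norm n_def algebra_simps divide_inverse)
    moreover have "((\<lambda>s. f (p + (t + s / n) *\<^sub>R (q - p))) has_real_derivative F t * (1 / n)) (at 0)"
      by (rule DERIV_chain2[where f = "\<lambda>s. f (p + s *\<^sub>R (q - p))"])
         (use that n in \<open>auto intro!: derivative_eq_intros\<close>)
    ultimately show ?thesis
      unfolding tangential_gradient_def using DERIV_imp_deriv by fastforce
  qed
  have "(LINT t:{0..1}|lborel. tangential_gradient p q f (p + t *\<^sub>R (q - p)) \<bullet>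
            tangential_gradient p q g (p + t *\<^sub>R (q - p)))
      = (LINT t:{0..1}|lborel. F t * G t / n\<^sup>2)"
    unfolding set_lebesgue_integral_def
  proof (rule integral_discrete_difference)
    show "countable (insert 0 (insert 1 X))" using X by (simp add: countable_finite)
    fix t :: real
    assume t: "t \<notin> insert 0 (insert 1 X)"
    have "sgn (q - p) \<bullet> sgn (q - p) = 1"
      using False by (simp add: power2_norm_eq_inner[symmetric] norm_sgn)
    then show "indicator {0..1} t *\<^sub>R (tangential_gradient p q f (p + t *\<^sub>R (q - p)) \<bullet>
            tangential_gradient p q g (p + t *\<^sub>R (q - p))) = indicator {0..1} t *\<^sub>R (F t * G t / n\<^sup>2)"
      using t grad[of f F t] grad[of g G t] F[of t] G[of t]
      by (auto simp: indicator_def power2_eq_square)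
  qed auto
  then show ?thesis
    using n unfolding segment_form_def segment_integral_def n_def[symmetric]
    by (simp add: power2_eq_square)
qed

section \<open>Bilinear functions along a segment inside one cell\<close>

context
  fixes h :: real and k :: node and p q :: plane
  assumes h: "h > 0" and pq: "p \<in> cell h k" "q \<in> cell h k"
begin

private abbreviation (input) "da \<equiv> (fst q - fst p) / h"
private abbreviation (input) "db \<equiv> (snd q - snd p) / h"
private abbreviation (input) "sa t \<equiv> fst p / h - fst k + t * da"
private abbreviation (input) "sb t \<equiv> snd p / h - snd k + t * db"

text \<open>The derivative in the parameter t of the segment, not in arc length: it is affine in t,
  linear in the nodal values, and makes sense for p = q as well.\<close>

definition segment_deriv :: "(node \<Rightarrow> real) \<Rightarrow> real \<Rightarrow> real" where
  "segment_deriv u t = bilinear_deriv u k da db (sa t) (sb t)"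

lemma segment_in_cell: "t \<in> {0..1} \<Longrightarrow> p + t *\<^sub>R (q - p) \<in> cell h k"
proof -
  assume t: "t \<in> {0..1}"
  have "p + t *\<^sub>R (q - p) = (1 - t) *\<^sub>R p + t *\<^sub>R q" by (simp add: algebra_simps)
  moreover have "convex (cell h k)" by (simp add: cell_def)
  ultimately show ?thesis using pq t by (simp add: convex_alt)
qed

lemma segment_coords:
  assumes t: "t \<in> {0..1}"
  shows "fst (p + t *\<^sub>R (q - p)) / h - fst k = sa t" "snd (p + t *\<^sub>R (q - p)) / h - snd k = sb t"
    "0 \<le> sa t" "sa t \<le> 1" "0 \<le> sb t" "sb t \<le> 1"
proof -
  show a: "fst (p + t *\<^sub>R (q - p)) / h - fst k = sa t" "snd (p + t *\<^sub>R (q - p)) / h - snd k = sb t"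
    by (simp_all add: add_divide_distrib)
  show "0 \<le> sa t" "sa t \<le> 1" "0 \<le> sb t" "sb t \<le> 1"
    using segment_in_cell[OF t] unfolding mem_cell_iff[OF h] a by auto
qed

lemma segment_deriv_continuous: "continuous_on S (segment_deriv u)"
  unfolding segment_deriv_def bilinear_deriv_def by (intro continuous_intros)

lemma segment_deriv_sum:
  "segment_deriv (\<lambda>\<xi>. \<Sum>i\<in>I. c i * w i \<xi>) t = (\<Sum>i\<in>I. c i * segment_deriv (w i) t)"
  unfolding segment_deriv_def by (rule bilinear_deriv_sum)

context
  fixes N :: "node set"
  assumes N: "finite N" "cell_vertices k \<subseteq> N"
begin

lemma fe_function_segment:
  "t \<in> {0..1} \<Longrightarrow> fe_function h N u (p + t *\<^sub>R (q - p)) = bilinear u k (sa t) (sb t)"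
  by (subst fe_function_cell[OF h segment_in_cell N]) (simp_all only: segment_coords)

lemma bilinear_has_deriv:
  "((\<lambda>t. bilinear u k (sa t) (sb t)) has_real_derivative segment_deriv u t) (at t within S)"
  unfolding segment_deriv_def by (rule bilinear_line_has_deriv)

text \<open>Only inner parameters are allowed, since the formula for the finite element function may
  change where the line leaves the cell.\<close>

lemma fe_function_has_deriv:
  assumes t: "t \<in> {0<..<1}"
  shows "((\<lambda>s. fe_function h N u (p + s *\<^sub>R (q - p))) has_real_derivative segment_deriv u t) (at t)"
  by (rule has_field_derivative_transform_within_open[OF bilinear_has_deriv, where S = "{0<..<1}"])
     (use t in \<open>auto simp: fe_function_segment\<close>)

lemma segment_form_fe:
  "segment_form p q (fe_function h N u) (fe_function h N v)
     = integral {0..1} (\<lambda>t. segment_deriv u t * segment_deriv v t) / norm (q - p)"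
proof -
  have "segment_form p q (fe_function h N u) (fe_function h N v)
    = (LINT t:{0..1}|lborel. segment_deriv u t * segment_deriv v t) / norm (q - p)"
    by (rule segment_form_eq[of "{}"]) (auto intro: fe_function_has_deriv)
  also have "(LINT t:{0..1}|lborel. segment_deriv u t * segment_deriv v t)
    = integral {0..1} (\<lambda>t. segment_deriv u t * segment_deriv v t)"
  proof (rule set_borel_integral_eq_integral(2))
    have "continuous_on {0..1} (\<lambda>t. segment_deriv u t * segment_deriv v t)"
      by (intro continuous_on_mult segment_deriv_continuous)
    then show "set_integrable lborel {0..1} (\<lambda>t. segment_deriv u t * segment_deriv v t)"
      unfolding set_integrable_def by (rule borel_integrable_compact[OF compact_Icc])
  qed
  finally show ?thesis .
qed

lemma segment_form_sum:
  assumes I: "finite I" "finite J"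
  shows "segment_form p q (fe_function h N (\<lambda>\<xi>. \<Sum>i\<in>I. c i * w i \<xi>)) (fe_function h N (\<lambda>\<xi>. \<Sum>j\<in>J. d j * z j \<xi>))
    = (\<Sum>i\<in>I. \<Sum>j\<in>J. c i * d j * segment_form p q (fe_function h N (w i)) (fe_function h N (z j)))"
proof -
  have int: "(\<lambda>t. c * (segment_deriv (w i) t * segment_deriv (z j) t)) integrable_on {0..1}" for i j c
    by (intro integrable_continuous_real continuous_intros segment_deriv_continuous)
  have "integral {0..1} (\<lambda>t. segment_deriv (\<lambda>\<xi>. \<Sum>i\<in>I. c i * w i \<xi>) t * segment_deriv (\<lambda>\<xi>. \<Sum>j\<in>J. d j * z j \<xi>) t)
    = integral {0..1} (\<lambda>t. \<Sum>i\<in>I. \<Sum>j\<in>J. (c i * d j) * (segment_deriv (w i) t * segment_deriv (z j) t))"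
    unfolding segment_deriv_sum by (simp add: sum_product mult_ac)
  also have "\<dots> = (\<Sum>i\<in>I. \<Sum>j\<in>J. (c i * d j) * integral {0..1} (\<lambda>t. segment_deriv (w i) t * segment_deriv (z j) t))"
    by (simp only: integral_sum[OF I(1) integrable_sum[OF I(2) int]] integral_sum[OF I(2) int] integral_mult_right)
  finally show ?thesis
    unfolding segment_form_fe by (simp add: sum_divide_distrib)
qed

lemma segment_form_nonneg: "0 \<le> segment_form p q (fe_function h N u) (fe_function h N u)"
  unfolding segment_form_fe
  by (intro divide_nonneg_nonneg integral_nonneg integrable_continuous_real continuous_intros segment_deriv_continuous) auto

lemma segment_length: "norm (q - p) \<le> 2 * h"
proof -
  have "\<bar>fst q / h - fst p / h\<bar> \<le> 1" "\<bar>snd q / h - snd p / h\<bar> \<le> 1"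
    using pq unfolding mem_cell_iff[OF h] by linarith+
  then have "\<bar>fst q - fst p\<bar> \<le> h" "\<bar>snd q - snd p\<bar> \<le> h"
    using h by (simp_all add: diff_divide_distrib[symmetric] abs_divide)
  moreover have "norm (q - p) \<le> norm (fst (q - p)) + norm (snd (q - p))"
    by (metis norm_Pair_le prod.collapse)
  ultimately show ?thesis by simp
qed

text \<open>Each difference of nodal values is at most 2 m, with m the Euclidean norm of the four
  values, and each direction component is at most the length over h. The two coordinate directions
  together make the factor 4, squared 16.\<close>

lemma segment_deriv_bound:
  assumes t: "t \<in> {0..1}"
  shows "(segment_deriv u t)\<^sup>2 \<le> 16 * (norm (q - p))\<^sup>2 / h\<^sup>2 * (\<Sum>\<xi>\<in>cell_vertices k. (u \<xi>)\<^sup>2)"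
proof -
  define m where "m = sqrt (\<Sum>\<xi>\<in>cell_vertices k. (u \<xi>)\<^sup>2)"
  have m: "m \<ge> 0" "m\<^sup>2 = (\<Sum>\<xi>\<in>cell_vertices k. (u \<xi>)\<^sup>2)" by (auto simp: m_def sum_nonneg)
  have um: "\<bar>u \<xi>\<bar> \<le> m" if "\<xi> \<in> cell_vertices k" for \<xi>
  proof -
    have "(u \<xi>)\<^sup>2 \<le> m\<^sup>2" unfolding m(2) using that by (intro member_le_sum) auto
    then show ?thesis using m(1) by (metis abs_le_square_iff abs_of_nonneg)
  qed
  have uv: "\<bar>u \<xi> - u \<eta>\<bar> \<le> 2 * m" if "\<xi> \<in> cell_vertices k" "\<eta> \<in> cell_vertices k" for \<xi> \<eta>
    using um[OF that(1)] um[OF that(2)] by linarith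
  have conv: "\<bar>(1 - r) * x + r * y\<bar> \<le> M" if "0 \<le> r" "r \<le> 1" "\<bar>x\<bar> \<le> M" "\<bar>y\<bar> \<le> M" for r x y M :: real
  proof -
    have "\<bar>(1 - r) * x + r * y\<bar> \<le> (1 - r) * \<bar>x\<bar> + r * \<bar>y\<bar>"
      using that abs_triangle_ineq[of "(1 - r) * x" "r * y"] by (simp add: abs_mult)
    also have "\<dots> \<le> (1 - r) * M + r * M" using that by (intro add_mono mult_left_mono) auto
    finally show ?thesis by (simp add: algebra_simps)
  qed
  have d: "\<bar>da\<bar> \<le> norm (q - p) / h" "\<bar>db\<bar> \<le> norm (q - p) / h"
  proof -
    have "\<bar>fst (q - p)\<bar> \<le> norm (q - p)" "\<bar>snd (q - p)\<bar> \<le> norm (q - p)"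
      using norm_fst_le[of "fst (q - p)" "snd (q - p)"] norm_snd_le[of "snd (q - p)" "fst (q - p)"]
      by (simp_all only: real_norm_def prod.collapse)
    then show "\<bar>da\<bar> \<le> norm (q - p) / h" "\<bar>db\<bar> \<le> norm (q - p) / h"
      using h by (simp_all add: abs_divide divide_right_mono)
  qed
  have v: "k \<in> cell_vertices k" "k + (1, 0) \<in> cell_vertices k" "k + (0, 1) \<in> cell_vertices k" "k + (1, 1) \<in> cell_vertices k"
    by (auto simp: cell_vertices_def)
  let ?X = "(1 - sb t) * (u (k + (1, 0)) - u k) + sb t * (u (k + (1, 1)) - u (k + (0, 1)))"
  let ?Y = "(1 - sa t) * (u (k + (0, 1)) - u k) + sa t * (u (k + (1, 1)) - u (k + (1, 0)))"
  have X: "\<bar>?X\<bar> \<le> 2 * m" "\<bar>?Y\<bar> \<le> 2 * m"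
    using segment_coords(3-6)[OF t] by (intro conv uv v; simp)+
  have "\<bar>segment_deriv u t\<bar> \<le> \<bar>da\<bar> * \<bar>?X\<bar> + \<bar>db\<bar> * \<bar>?Y\<bar>"
    unfolding segment_deriv_def bilinear_deriv_def abs_mult[symmetric] by (rule abs_triangle_ineq)
  also have "\<dots> \<le> norm (q - p) / h * (2 * m) + norm (q - p) / h * (2 * m)"
    using X d h by (intro add_mono mult_mono) auto
  finally have "\<bar>segment_deriv u t\<bar> \<le> 4 * norm (q - p) / h * m" by (simp add: mult_ac)
  then have "\<bar>segment_deriv u t\<bar>\<^sup>2 \<le> (4 * norm (q - p) / h * m)\<^sup>2" by (intro power_mono) auto
  then show ?thesis by (simp add: power_mult_distrib power_divide m(2))
qed

text \<open>An inverse estimate uniform in the cut: the squared parameter derivative scales like the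
  length squared and only one power is divided out, so the remaining length, at most 2 h, even helps
  on short segments.\<close>

lemma segment_form_upper:
  "segment_form p q (fe_function h N u) (fe_function h N u) \<le> 32 / h * (\<Sum>\<xi>\<in>cell_vertices k. (u \<xi>)\<^sup>2)"
proof (cases "p = q")
  case True
  then show ?thesis using h by (simp add: segment_form_def segment_integral_def sum_nonneg)
next
  case False
  define n where "n = norm (q - p)"
  have n: "n > 0" using False by (simp add: n_def)
  let ?s = "\<Sum>\<xi>\<in>cell_vertices k. (u \<xi>)\<^sup>2"
  have s: "?s \<ge> 0" by (simp add: sum_nonneg)
  have "integral {0..1} (\<lambda>t. segment_deriv u t * segment_deriv u t) \<le> integral {0..1} (\<lambda>t::real. 16 * n\<^sup>2 / h\<^sup>2 * ?s)"
    using segment_deriv_bound[of _ u] unfolding n_def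
    by (intro integral_le integrable_continuous_real continuous_intros segment_deriv_continuous)
       (auto simp: power2_eq_square)
  also have "\<dots> = 16 * n\<^sup>2 / h\<^sup>2 * ?s" by simp
  finally have "segment_form p q (fe_function h N u) (fe_function h N u) \<le> (16 * n\<^sup>2 / h\<^sup>2 * ?s) / n"
    unfolding segment_form_fe n_def[symmetric] using n by (intro divide_right_mono) auto
  also have "\<dots> = 16 / h\<^sup>2 * ?s * n" using n by (simp add: power2_eq_square)
  also have "\<dots> \<le> 16 / h\<^sup>2 * ?s * (2 * h)"
    unfolding n_def using segment_length s h by (intro mult_left_mono) auto
  also have "\<dots> = 32 / h * ?s" using h by (simp add: power2_eq_square)
  finally show ?thesis .
qed

lemma segment_oscillation:
  assumes st: "s \<in> {0..1}" "t \<in> {0..1}"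
  shows "(fe_function h N u (p + t *\<^sub>R (q - p)) - fe_function h N u (p + s *\<^sub>R (q - p)))\<^sup>2
    \<le> norm (q - p) * segment_form p q (fe_function h N u) (fe_function h N u)"
  using st
proof (induction s t rule: linorder_wlog)
  case (sym a b)
  then show ?case by (simp add: power2_commute)
next
  case (le s t)
  show ?case
  proof (cases "p = q")
    case True
    then show ?thesis by simp
  next
    case False
    let ?F = "segment_deriv u"
    have int: "(\<lambda>t. ?F t * ?F t) integrable_on {a..b}" "?F integrable_on {a..b}" for a b
      by (intro integrable_continuous_real continuous_intros segment_deriv_continuous)+
    define i where "i = bilinear u k (sa t) (sb t) - bilinear u k (sa s) (sb s)"
    have F: "(?F has_integral i) {s..t}"
      unfolding i_def
    proof (rule fundamental_theorem_of_calculus)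
      show "((\<lambda>t. bilinear u k (sa t) (sb t)) has_vector_derivative ?F x) (at x within {s..t})" for x
        unfolding has_real_derivative_iff_has_vector_derivative[symmetric] by (rule bilinear_has_deriv)
    qed (use le in simp)
    \<comment> \<open>Cauchy-Schwarz for the derivative against the constant i, obtained by
      expanding a square; t - s \<le> 1 absorbs the last term.\<close>
    have "0 \<le> integral {s..t} (\<lambda>r. (?F r - i)\<^sup>2)"
      by (intro integral_nonneg integrable_continuous_real continuous_intros segment_deriv_continuous) auto
    also have "(\<lambda>r. (?F r - i)\<^sup>2) = (\<lambda>r. ?F r * ?F r - 2 * i * ?F r + i\<^sup>2)"
      by (auto simp: power2_eq_square algebra_simps)
    also have "integral {s..t} \<dots> = integral {s..t} (\<lambda>r. ?F r * ?F r) - 2 * i * i + (t - s) * i\<^sup>2"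
    proof -
      have "((\<lambda>r. ?F r * ?F r - 2 * i * ?F r + i\<^sup>2) has_integral
        integral {s..t} (\<lambda>r. ?F r * ?F r) - 2 * i * i + (t - s) *\<^sub>R i\<^sup>2) {s..t}"
        using le has_integral_const_real[of "i\<^sup>2" s t]
        by (intro has_integral_add has_integral_diff has_integral_mult_right F integrable_integral int) auto
      then show ?thesis by (simp add: integral_unique)
    qed
    also have "(t - s) * i\<^sup>2 \<le> i\<^sup>2" using le by (simp add: mult_left_le_one_le)
    finally have "i\<^sup>2 \<le> integral {s..t} (\<lambda>r. ?F r * ?F r)" by (simp add: power2_eq_square)
    also have "\<dots> \<le> integral {0..1} (\<lambda>r. ?F r * ?F r)"
      using le by (intro integral_subset_le int) auto
    finally show ?thesis
      unfolding segment_form_fe using le False by (simp add: fe_function_segment i_def)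
  qed
qed

end

end

section \<open>Lower bound for the mass matrix of the cells\<close>

lemma integral_square_affine:
  fixes A B c h :: real
  assumes h: "h > 0"
  shows "integral {h * c..h * (c + 1)} (\<lambda>y. ((1 - (y / h - c)) * A + (y / h - c) * B)\<^sup>2) = h * (A\<^sup>2 + A * B + B\<^sup>2) / 3"
proof -
  let ?P = "\<lambda>y. h * (A\<^sup>2 * (y / h - c) + A * (B - A) * (y / h - c)\<^sup>2 + (B - A)\<^sup>2 * (y / h - c)^3 / 3)"
  have "((\<lambda>y. ((1 - (y / h - c)) * A + (y / h - c) * B)\<^sup>2) has_integral ?P (h * (c + 1)) - ?P (h * c)) {h * c..h * (c + 1)}"
  proof (rule fundamental_theorem_of_calculus)
    show "h * c \<le> h * (c + 1)" using h by simp
    fix y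
    have r: "((\<lambda>y. y / h - c) has_real_derivative 1 / h) (at y within {h * c..h * (c + 1)})"
      using h by (auto intro!: derivative_eq_intros)
    have "((\<lambda>r. h * (A\<^sup>2 * r + A * (B - A) * r\<^sup>2 + (B - A)\<^sup>2 * r ^ 3 / 3)) has_real_derivative
        h * ((1 - z) * A + z * B)\<^sup>2) (at z)" for z
      by (auto intro!: derivative_eq_intros simp: field_simps power2_eq_square)
    from DERIV_chain2[OF this r]
    show "(?P has_vector_derivative ((1 - (y / h - c)) * A + (y / h - c) * B)\<^sup>2) (at y within {h * c..h * (c + 1)})"
      unfolding has_real_derivative_iff_has_vector_derivative[symmetric] using h by simp
  qed
  then have "integral {h * c..h * (c + 1)} (\<lambda>y. ((1 - (y / h - c)) * A + (y / h - c) * B)\<^sup>2) = ?P (h * (c + 1)) - ?P (h * c)"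
    by (rule integral_unique)
  also have "\<dots> = h * (A\<^sup>2 + A * B + B\<^sup>2) / 3"
    using h by (simp add: field_simps power2_eq_square)
  finally show ?thesis .
qed

text \<open>The mass matrix of a cell is the tensor square of the interval mass matrix, whose
  smallest eigenvalue is h / 6; Fubini lets that one-dimensional bound be applied in each
  variable.\<close>

lemma cell_mass_lower:
  assumes h: "h > 0" and N: "finite N" "cell_vertices k \<subseteq> N"
  shows "h\<^sup>2 / 36 * (\<Sum>\<xi>\<in>cell_vertices k. (u \<xi>)\<^sup>2) \<le> integral (cell h k) (\<lambda>x. (fe_function h N u x)\<^sup>2)"
proof -
  define k1 k2 where "k1 = real_of_int (fst k)" and "k2 = real_of_int (snd k)"
  have cell: "cell h k = cbox (h * k1, h * k2) (h * (k1 + 1), h * (k2 + 1))"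
    by (simp add: cell_def pt_def k1_def k2_def)
  define A where "A x = (1 - (x / h - k1)) * u k + (x / h - k1) * u (k + (1, 0))" for x
  define B where "B x = (1 - (x / h - k1)) * u (k + (0, 1)) + (x / h - k1) * u (k + (1, 1))" for x
  have cont: "continuous_on S A" "continuous_on S B" for S
    unfolding A_def B_def using h by (intro continuous_intros; simp)+
  have quad: "x\<^sup>2 + y\<^sup>2 \<le> 2 * (x\<^sup>2 + x * y + y\<^sup>2)" for x y :: real
    using zero_le_power2[of "x + y"] by (simp add: power2_eq_square algebra_simps)
  have sq: "h * (x\<^sup>2 + y\<^sup>2) / 6 \<le> h * (x\<^sup>2 + x * y + y\<^sup>2) / 3" for x y :: real
    using mult_left_mono[OF quad[of x y], of h] h by simp
  have sq': "h / 6 * x\<^sup>2 + h / 6 * y\<^sup>2 \<le> h * (x\<^sup>2 + x * y + y\<^sup>2) / 3" for x y :: real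
    using sq[of x y] by (simp add: algebra_simps)
  have "integral (cell h k) (\<lambda>x. (fe_function h N u x)\<^sup>2)
    = integral {h * k1..h * (k1 + 1)} (\<lambda>x. integral {h * k2..h * (k2 + 1)} (\<lambda>y. (fe_function h N u (x, y))\<^sup>2))"
    unfolding cell by (subst integral_prod_continuous) (auto intro!: continuous_intros)
  also have "\<dots> = integral {h * k1..h * (k1 + 1)} (\<lambda>x. integral {h * k2..h * (k2 + 1)} (\<lambda>y. ((1 - (y / h - k2)) * A x + (y / h - k2) * B x)\<^sup>2))"
  proof (intro integral_cong)
    fix x y assume "x \<in> {h * k1..h * (k1 + 1)}" "y \<in> {h * k2..h * (k2 + 1)}"
    then have "(x, y) \<in> cell h k" unfolding cell by auto
    then show "(fe_function h N u (x, y))\<^sup>2 = ((1 - (y / h - k2)) * A x + (y / h - k2) * B x)\<^sup>2"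
      by (subst fe_function_cell[OF h _ N]) (simp_all add: bilinear_alt A_def B_def k1_def k2_def)
  qed
  also have "\<dots> = integral {h * k1..h * (k1 + 1)} (\<lambda>x. h * ((A x)\<^sup>2 + A x * B x + (B x)\<^sup>2) / 3)"
    unfolding integral_square_affine[OF h] ..
  also have "\<dots> \<ge> integral {h * k1..h * (k1 + 1)} (\<lambda>x. h / 6 * (A x)\<^sup>2 + h / 6 * (B x)\<^sup>2)"
    by (intro integral_le integrable_continuous_real continuous_intros cont sq') auto
  also have "integral {h * k1..h * (k1 + 1)} (\<lambda>x. h / 6 * (A x)\<^sup>2 + h / 6 * (B x)\<^sup>2)
    = h / 6 * integral {h * k1..h * (k1 + 1)} (\<lambda>x. (A x)\<^sup>2) + h / 6 * integral {h * k1..h * (k1 + 1)} (\<lambda>x. (B x)\<^sup>2)"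
    by (subst integral_add) (auto intro!: integrable_continuous_real continuous_intros cont)
  also have "\<dots> \<ge> h / 6 * (h * ((u k)\<^sup>2 + (u (k + (1, 0)))\<^sup>2) / 6) + h / 6 * (h * ((u (k + (0, 1)))\<^sup>2 + (u (k + (1, 1)))\<^sup>2) / 6)"
    unfolding A_def B_def integral_square_affine[OF h] using h sq by (intro add_mono mult_left_mono) auto
  finally show ?thesis
    unfolding sum_cell_vertices by (simp add: field_simps power2_eq_square)
qed

text \<open>A convex set with empty interior is negligible, so shared edges, shared vertices and
  disjoint cells need no separate treatment.\<close>

lemma negligible_cell_Int:
  assumes h: "h > 0" and "k \<noteq> l"
  shows "negligible (cell h k \<inter> cell h l)"
proof -
  have "convex (cell h k \<inter> cell h l)" by (simp add: cell_def convex_Int)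
  moreover have "interior (cell h k \<inter> cell h l) = {}"
  proof -
    have "k = l" if x: "x \<in> box (pt h k) (pt h (k + (1, 1)))" "x \<in> box (pt h l) (pt h (l + (1, 1)))" for x
    proof -
      have "of_int (fst k) < fst x / h" "fst x / h < of_int (fst k) + 1"
        "of_int (fst l) < fst x / h" "fst x / h < of_int (fst l) + 1"
        "of_int (snd k) < snd x / h" "snd x / h < of_int (snd k) + 1"
        "of_int (snd l) < snd x / h" "snd x / h < of_int (snd l) + 1"
        using x h by (auto simp: pt_def mem_box Basis_prod_def inner_prod_def field_simps)
      then have "fst k = fst l" "snd k = snd l" by linarith+
      then show ?thesis by (simp add: prod_eq_iff)
    qed
    then show ?thesis using assms(2) by (auto simp: cell_def interior_Int)
  qed
  ultimately show ?thesis by (simp add: negligible_convex_interior)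
qed

lemma sum_UN_le:
  fixes f :: "'b \<Rightarrow> real"
  assumes "finite A" "\<And>k. k \<in> A \<Longrightarrow> finite (S k)" "\<And>x. 0 \<le> f x"
  shows "(\<Sum>x\<in>(\<Union>k\<in>A. S k). f x) \<le> (\<Sum>k\<in>A. \<Sum>x\<in>S k. f x)"
  using assms(1,2)
proof (induction A rule: finite_induct)
  case (insert k A)
  have "(\<Sum>x\<in>S k \<union> (\<Union>k\<in>A. S k). f x) \<le> (\<Sum>x\<in>S k. f x) + (\<Sum>x\<in>(\<Union>k\<in>A. S k). f x)"
    using insert assms(3) by (subst sum_Un) (auto intro: sum_nonneg)
  then show ?case using insert by auto
qed simp

lemma cells_mass_lower:
  assumes h: "h > 0" and A: "finite A" and N: "N = (\<Union>k\<in>A. cell_vertices k)"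
  shows "h\<^sup>2 / 36 * (\<Sum>\<xi>\<in>N. (u \<xi>)\<^sup>2) \<le> (LINT x:(\<Union>k\<in>A. cell h k)|lborel. (fe_function h N u x)\<^sup>2)"
proof -
  let ?f = "\<lambda>x. (fe_function h N u x)\<^sup>2"
  have finN: "finite N" using A N by simp
  have comp: "compact (\<Union>k\<in>A. cell h k)" using A by (intro compact_UN) (auto simp: cell_def)
  have "(?f has_integral (\<Sum>k\<in>A. integral (cell h k) ?f)) (\<Union>k\<in>A. cell h k)"
  proof (rule has_integral_UN[OF A])
    show "(?f has_integral integral (cell h k) ?f) (cell h k)" for k
      unfolding cell_def by (intro integrable_integral integrable_continuous continuous_intros)
    show "pairwise (\<lambda>i i'. negligible (cell h i \<inter> cell h i')) A"
      using negligible_cell_Int[OF h] by (auto simp: pairwise_def)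
  qed
  then have "integral (\<Union>k\<in>A. cell h k) ?f = (\<Sum>k\<in>A. integral (cell h k) ?f)" by (rule integral_unique)
  moreover have "set_integrable lborel (\<Union>k\<in>A. cell h k) ?f"
    unfolding set_integrable_def by (intro borel_integrable_compact comp continuous_intros)
  then have "(LINT x:(\<Union>k\<in>A. cell h k)|lborel. ?f x) = integral (\<Union>k\<in>A. cell h k) ?f"
    by (rule set_borel_integral_eq_integral)
  moreover have "h\<^sup>2 / 36 * (\<Sum>\<xi>\<in>N. (u \<xi>)\<^sup>2) \<le> (\<Sum>k\<in>A. integral (cell h k) ?f)"
  proof -
    have "h\<^sup>2 / 36 * (\<Sum>\<xi>\<in>N. (u \<xi>)\<^sup>2) \<le> h\<^sup>2 / 36 * (\<Sum>k\<in>A. \<Sum>\<xi>\<in>cell_vertices k. (u \<xi>)\<^sup>2)"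
      unfolding N using A by (intro mult_left_mono sum_UN_le) auto
    also have "\<dots> = (\<Sum>k\<in>A. h\<^sup>2 / 36 * (\<Sum>\<xi>\<in>cell_vertices k. (u \<xi>)\<^sup>2))" by (rule sum_distrib_left)
    also have "\<dots> \<le> (\<Sum>k\<in>A. integral (cell h k) ?f)"
      using N by (intro sum_mono cell_mass_lower h finN) auto
    finally show ?thesis .
  qed
  ultimately show ?thesis by simp
qed

section \<open>Position of the curve relative to the mesh\<close>

lemma floor_index_range:
  fixes x y h :: real
  assumes h: "h > 0" and k: "of_int k \<le> x / h" "x / h \<le> of_int k + 1" and d: "\<bar>x - y\<bar> \<le> h"
  shows "k \<in> {\<lfloor>y / h\<rfloor> - 2..\<lfloor>y / h\<rfloor> + 1}"
proof -
  have "\<bar>x / h - y / h\<bar> \<le> 1"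
    using d h by (simp add: diff_divide_distrib[symmetric])
  then show ?thesis using k by (simp; linarith)
qed

text \<open>Closed cells within distance h of y range over four indices per axis, from two below the
  floor of y / h to one above it. This window is the source of the 16 below.\<close>

lemma cells_meeting_small_set:
  assumes h: "h > 0" and S: "\<And>x. x \<in> S \<Longrightarrow> norm (x - y) \<le> h"
  shows "{k. cell h k \<inter> S \<noteq> {}} \<subseteq>
    {\<lfloor>fst y / h\<rfloor> - 2..\<lfloor>fst y / h\<rfloor> + 1} \<times> {\<lfloor>snd y / h\<rfloor> - 2..\<lfloor>snd y / h\<rfloor> + 1}"
proof
  fix k assume "k \<in> {k. cell h k \<inter> S \<noteq> {}}"
  then obtain x where x: "x \<in> cell h k" "x \<in> S" by auto
  have "\<bar>fst (x - y)\<bar> \<le> norm (x - y)" "\<bar>snd (x - y)\<bar> \<le> norm (x - y)"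
    using norm_fst_le[of "fst (x - y)" "snd (x - y)"] norm_snd_le[of "snd (x - y)" "fst (x - y)"]
    by (simp_all only: real_norm_def prod.collapse)
  then have "\<bar>fst x - fst y\<bar> \<le> h" "\<bar>snd x - snd y\<bar> \<le> h" using S[OF x(2)] by auto
  then show "k \<in> {\<lfloor>fst y / h\<rfloor> - 2..\<lfloor>fst y / h\<rfloor> + 1} \<times> {\<lfloor>snd y / h\<rfloor> - 2..\<lfloor>snd y / h\<rfloor> + 1}"
    using x(1) floor_index_range[OF h, of "fst k" "fst x" "fst y"] floor_index_range[OF h, of "snd k" "snd x" "snd y"]
    unfolding mem_cell_iff[OF h] by (cases k) auto
qed

text \<open>Everything that is used of the moved curve and its level-set function. The only
  quantitative datum is \<Lambda>; \<open>sign_connected\<close> stands for the splitting of the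
  plane into inside and outside.\<close>

locale cut_mesh =
  fixes \<psi> :: "plane \<Rightarrow> real" and h :: real and G :: "real \<Rightarrow> plane" and \<Lambda> :: real
  assumes h: "h > 0"
    and sign_connected: "\<And>S. connected S \<Longrightarrow> S \<inter> interface \<psi> = {} \<Longrightarrow> (\<forall>x\<in>S. \<psi> x < 0) \<or> (\<forall>x\<in>S. \<psi> x > 0)"
    and interface_range: "interface \<psi> = range G"
    and periodic: "\<And>t. G (t + 1) = G t"
    and inj: "inj_on G {0..<1}"
    and lipschitz: "\<And>s t. s \<in> {0..1} \<Longrightarrow> t \<in> {0..1} \<Longrightarrow> norm (G s - G t) \<le> \<Lambda> * \<bar>s - t\<bar>"
    and differentiable: "\<And>t. (G has_vector_derivative vector_derivative G (at t)) (at t)"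
    and geometry: "active_grid_geometry \<psi> h G"
begin

lemma Lambda_nonneg: "0 \<le> \<Lambda>"
  using order_trans[OF norm_ge_zero lipschitz[of 1 0]] by simp

lemma continuous_G: "continuous_on S G"
  using differentiable by (meson continuous_at_imp_continuous_on has_vector_derivative_continuous)

lemma G_of_nat: "G (t + of_nat n) = G t"
proof (induction n)
  case (Suc n)
  have "G (t + of_nat (Suc n)) = G ((t + of_nat n) + 1)" by (simp add: algebra_simps)
  then show ?case using Suc periodic by simp
qed simp

lemma G_of_int: "G (t + of_int n) = G t"
proof (cases "n \<ge> 0")
  case True
  then show ?thesis using G_of_nat[of t "nat n"] by simp
next
  case False
  then show ?thesis using G_of_nat[of "t + of_int n" "nat (- n)"] by simp
qed

lemma G_frac: "G (frac t) = G t"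
  using G_of_int[of t "- \<lfloor>t\<rfloor>"] by (simp add: frac_def)

lemma G_eq_imp: "G a = G b \<Longrightarrow> \<bar>a - b\<bar> < 1 \<Longrightarrow> a = b"
proof -
  assume ab: "G a = G b" "\<bar>a - b\<bar> < 1"
  have "frac a = frac b"
    using inj ab(1) by (auto simp: inj_on_def G_frac frac_lt_1)
  then have "a - b = of_int (\<lfloor>a\<rfloor> - \<lfloor>b\<rfloor>)" by (simp add: frac_def)
  moreover have "\<lfloor>a\<rfloor> - \<lfloor>b\<rfloor> = 0" using ab(2) calculation by linarith
  ultimately show "a = b" by simp
qed

lemma interface_param: "x \<in> interface \<psi> \<Longrightarrow> \<exists>t\<in>{0..<1}. x = G t"
  unfolding interface_range by (auto simp: frac_lt_1 G_frac intro!: bexI[of _ "frac _"])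

lemma interface_diameter: "x \<in> interface \<psi> \<Longrightarrow> y \<in> interface \<psi> \<Longrightarrow> norm (x - y) \<le> \<Lambda>"
proof -
  assume "x \<in> interface \<psi>" "y \<in> interface \<psi>"
  then obtain s t where st: "s \<in> {0..<1}" "t \<in> {0..<1}" "x = G s" "y = G t"
    using interface_param by meson
  have "norm (x - y) \<le> \<Lambda> * \<bar>s - t\<bar>" using lipschitz st by simp
  also have "\<dots> \<le> \<Lambda> * 1" using st Lambda_nonneg by (intro mult_left_mono) auto
  finally show ?thesis by simp
qed

text \<open>Sampling the curve at n equidistant parameters leaves every curve point within \<Lambda>
  / n \<le> h of a sample, and each sample accounts for at most 16 cells.\<close>

lemma active_cells_covering:
  assumes n: "n > 0" "\<Lambda> \<le> real n * h"
  shows "finite (active_cells \<psi> h) \<and> card (active_cells \<psi> h) \<le> 16 * n"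
proof -
  define C where "C i = (let y = G (real i / real n) in
    {\<lfloor>fst y / h\<rfloor> - 2..\<lfloor>fst y / h\<rfloor> + 1} \<times> {\<lfloor>snd y / h\<rfloor> - 2..\<lfloor>snd y / h\<rfloor> + 1})" for i
  have C: "finite (C i)" "card (C i) = 16" for i by (simp_all add: C_def Let_def card_cartesian_product)
  have sub: "active_cells \<psi> h \<subseteq> (\<Union>i<n. C i)"
  proof
    fix k assume "k \<in> active_cells \<psi> h"
    then obtain x where x: "x \<in> cell h k" "x \<in> interface \<psi>" by (auto simp: active_cells_def)
    then obtain t where t: "0 \<le> t" "t < 1" "x = G t" using interface_param by fastforce
    define i where "i = nat \<lfloor>t * real n\<rfloor>"
    have fl: "0 \<le> \<lfloor>t * real n\<rfloor>" using t by simp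
    have i: "real i \<le> t * real n" "t * real n < real i + 1"
      using fl by (simp_all add: i_def)
    have "t * real n < 1 * real n" using t n by (intro mult_strict_right_mono) auto
    then have "i < n" using i(1) by simp
    have "t - real i / real n = (t * real n - real i) / real n" using n by (simp add: diff_divide_distrib)
    moreover have "\<bar>t * real n - real i\<bar> \<le> 1" using i by simp
    ultimately have "\<bar>t - real i / real n\<bar> \<le> 1 / real n"
      by (simp only: abs_divide abs_of_nat) (rule divide_right_mono, simp_all)
    then have "\<Lambda> * \<bar>t - real i / real n\<bar> \<le> \<Lambda> * (1 / real n)"
      using Lambda_nonneg by (rule mult_left_mono)
    also have "\<dots> \<le> h" using n by (simp add: divide_le_eq mult.commute)
    finally have le: "\<Lambda> * \<bar>t - real i / real n\<bar> \<le> h" .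
    have "t \<in> {0..1}" "real i / real n \<in> {0..1}" using t n \<open>i < n\<close> by (simp_all add: divide_le_eq)
    then have "norm (x - G (real i / real n)) \<le> h" using le lipschitz[of t "real i / real n"] unfolding t(3) by linarith
    then have "k \<in> C i"
      using cells_meeting_small_set[OF h, of "{x}" "G (real i / real n)"] x unfolding C_def Let_def by auto
    then show "k \<in> (\<Union>i<n. C i)" using \<open>i < n\<close> by blast
  qed
  have "card (\<Union>i<n. C i) \<le> (\<Sum>i<n. card (C i))" by (rule card_UN_le) simp
  also have "\<dots> = 16 * n" by (simp add: C)
  finally have "card (active_cells \<psi> h) \<le> 16 * n"
    using card_mono[OF _ sub] C(1) by fastforce
  moreover have "finite (active_cells \<psi> h)" using sub C(1) by (rule_tac finite_subset) auto
  ultimately show ?thesis by simp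
qed

lemma finite_active_cells: "finite (active_cells \<psi> h)"
  and card_active_cells: "real (card (active_cells \<psi> h)) \<le> 16 * (\<Lambda> / h + 1)"
proof -
  define n where "n = nat \<lfloor>\<Lambda> / h\<rfloor> + 1"
  have "0 \<le> \<lfloor>\<Lambda> / h\<rfloor>" using Lambda_nonneg h by simp
  then have n: "real n \<le> \<Lambda> / h + 1" "\<Lambda> / h \<le> real n" unfolding n_def by linarith+
  have "n > 0" "\<Lambda> \<le> real n * h" using n h by (auto simp: n_def field_simps)
  from active_cells_covering[OF this]
  show "finite (active_cells \<psi> h)" "real (card (active_cells \<psi> h)) \<le> 16 * (\<Lambda> / h + 1)"
    using n(1) by auto
qed

section \<open>Vertex signs, active cells and the two crossings of a cell\<close>

lemma finite_active_nodes: "finite (active_nodes \<psi> h)"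
  by (simp add: active_nodes_def finite_active_cells)

lemma node_nonzero: "\<psi> (pt h \<xi>) \<noteq> 0"
proof -
  have "pt h \<xi> \<notin> interface \<psi>" using geometry unfolding active_grid_geometry_def by blast
  then show ?thesis by (simp add: interface_def)
qed

lemma cell_vertex_in_cell: "\<xi> \<in> cell_vertices k \<Longrightarrow> pt h \<xi> \<in> cell h k"
  using h by (cases k) (auto simp: mem_cell_iff cell_vertices_def pt_def)

lemma opposite_signs_active:
  assumes "\<xi> \<in> cell_vertices k" "\<eta> \<in> cell_vertices k" "\<psi> (pt h \<xi>) < 0" "\<psi> (pt h \<eta>) > 0"
  shows "k \<in> active_cells \<psi> h"
proof (rule ccontr)
  assume "k \<notin> active_cells \<psi> h"
  then have "cell h k \<inter> interface \<psi> = {}" by (simp add: active_cells_def)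
  moreover have "connected (cell h k)" unfolding cell_def by (rule convex_connected) simp
  ultimately show False using sign_connected[of "cell h k"] assms cell_vertex_in_cell by fastforce
qed

lemma adj_common_cell: "adj x y \<Longrightarrow> \<exists>k. x \<in> cell_vertices k \<and> y \<in> cell_vertices k"
proof -
  assume "adj x y"
  then have "y - x \<in> axis_directions" by (simp add: adj_iff)
  then consider "y = x + (1, 0)" | "x = y + (1, 0)" | "y = x + (0, 1)" | "x = y + (0, 1)"
    unfolding axis_directions_def by (cases x; cases y) (auto simp: algebra_simps)
  then show ?thesis
  proof cases
    case 1
    then show ?thesis by (intro exI[of _ x]) (simp add: cell_vertices_def)
  next
    case 2
    then show ?thesis by (intro exI[of _ y]) (simp add: cell_vertices_def)
  next
    case 3
    then show ?thesis by (intro exI[of _ x]) (simp add: cell_vertices_def)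
  next
    case 4
    then show ?thesis by (intro exI[of _ y]) (simp add: cell_vertices_def)
  qed
qed

lemma adj_opposite_active:
  assumes "adj x y" "\<psi> (pt h x) < 0" "\<psi> (pt h y) > 0"
  shows "x \<in> gamma1 \<psi> h" "y \<in> gamma2 \<psi> h"
proof -
  obtain k where k: "x \<in> cell_vertices k" "y \<in> cell_vertices k" using adj_common_cell assms(1) by blast
  then have "k \<in> active_cells \<psi> h" using opposite_signs_active assms by blast
  then have "x \<in> active_nodes \<psi> h" "y \<in> active_nodes \<psi> h" using k by (auto simp: active_nodes_def)
  then show "x \<in> gamma1 \<psi> h" "y \<in> gamma2 \<psi> h"
    using assms adj_sym unfolding gamma1_def gamma2_def by blast+
qed

text \<open>Transversality in the form used for crossings: on a mesh line the corresponding
  coordinate of the curve has nonzero derivative, whereas a local extremum would make it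
  zero.\<close>

lemma not_extremal_coordinate:
  assumes "s < r" "r < t" and c: "c = fst \<or> c = snd" and j: "c (G r) = h * of_int j"
    and ext: "(\<forall>y\<in>{s<..<t}. c (G r) \<le> c (G y)) \<or> (\<forall>y\<in>{s<..<t}. c (G y) \<le> c (G r))"
  shows False
proof -
  have nz: "c (vector_derivative G (at r)) \<noteq> 0"
    using c
  proof
    assume "c = fst"
    with j show ?thesis using geometry unfolding active_grid_geometry_def by simp
  next
    assume "c = snd"
    with j show ?thesis using geometry unfolding active_grid_geometry_def by simp
  qed
  have "bounded_linear c" using c bounded_linear_fst bounded_linear_snd by (elim disjE) simp_all
  then have D: "((\<lambda>y. c (G y)) has_real_derivative c (vector_derivative G (at r))) (at r)"
    unfolding has_real_derivative_iff_has_vector_derivative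
    by (rule bounded_linear.has_vector_derivative) (rule differentiable)
  define d where "d = min (r - s) (t - r)"
  have d: "0 < d" "y \<in> {s<..<t}" if "\<bar>r - y\<bar> < d" for y using assms(1,2) that by (auto simp: d_def)
  have d0: "0 < d" using assms(1,2) by (simp add: d_def)
  from ext show False
  proof
    assume "\<forall>y\<in>{s<..<t}. c (G r) \<le> c (G y)"
    then have "\<forall>y. \<bar>r - y\<bar> < d \<longrightarrow> c (G r) \<le> c (G y)" using d(2) by simp
    with DERIV_local_min[OF D d0] nz show False by simp
  next
    assume "\<forall>y\<in>{s<..<t}. c (G y) \<le> c (G r)"
    then have "\<forall>y. \<bar>r - y\<bar> < d \<longrightarrow> c (G y) \<le> c (G r)" using d(2) by simp
    with DERIV_local_max[OF D d0] nz show False by simp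
  qed
qed

text \<open>Counterpart of the previous lemma: at a boundary point of a square some coordinate is
  extremal over the whole square, hence along any arc of the curve inside it.\<close>

lemma frontier_cell_cases:
  assumes "x \<in> frontier (cell h k)"
  obtains c j where "c = fst \<or> c = snd" "c x = h * of_int j"
    "(\<forall>y\<in>cell h k. c x \<le> c y) \<or> (\<forall>y\<in>cell h k. c y \<le> c x)"
proof -
  have x: "x \<in> cell h k" "x \<notin> box (pt h k) (pt h (k + (1, 1)))"
    using assms by (auto simp: cell_def frontier_cbox)
  obtain k1 k2 where k: "k = (k1, k2)" by (cases k)
  have cell: "y \<in> cell h k \<longleftrightarrow> h * of_int k1 \<le> fst y \<and> fst y \<le> h * of_int (k1 + 1)
      \<and> h * of_int k2 \<le> snd y \<and> snd y \<le> h * of_int (k2 + 1)" for y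
    by (cases y) (auto simp: k cell_def pt_def)
  have "fst x = h * of_int k1 \<or> fst x = h * of_int (k1 + 1) \<or> snd x = h * of_int k2 \<or> snd x = h * of_int (k2 + 1)"
    using x unfolding cell by (auto simp: k pt_def mem_box Basis_prod_def inner_prod_def)
  then consider (a) "fst x = h * of_int k1" | (b) "fst x = h * of_int (k1 + 1)"
    | (c) "snd x = h * of_int k2" | (d) "snd x = h * of_int (k2 + 1)" by blast
  then show thesis
  proof cases
    case a
    then show thesis using that[of fst k1] cell by simp
  next
    case b
    then show thesis using that[of fst "k1 + 1"] cell by simp
  next
    case c
    then show thesis using that[of snd k2] cell by simp
  next
    case d
    then show thesis using that[of snd "k2 + 1"] cell by simp
  qed
qed

text \<open>Transversality makes an interior time of the arc in the cell at which the curve meets the cell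
  boundary impossible (a coordinate would have a local extremum there), while injectivity puts both
  ends of the arc on the boundary. The vertex signs rule out that the whole curve lies in the cell.\<close>

lemma crossing_pair_exists:
  assumes k: "k \<in> active_cells \<psi> h"
  shows "\<exists>p q. interface \<psi> \<inter> frontier (cell h k) = {p, q}"
proof -
  obtain s t where st: "s \<le> t" "cell h k \<inter> interface \<psi> = G ` {s..t}"
    using geometry k unfolding active_grid_geometry_def by meson
  have cl: "frontier (cell h k) \<subseteq> cell h k" by (simp add: cell_def frontier_cbox)
  have no: "False" if r: "a < r" "r < b" "G ` {a..b} \<subseteq> cell h k" "G r \<in> frontier (cell h k)" for a b r
  proof -
    obtain c j where c: "c = fst \<or> c = snd" "c (G r) = h * of_int j"
      "(\<forall>y\<in>cell h k. c (G r) \<le> c y) \<or> (\<forall>y\<in>cell h k. c y \<le> c (G r))"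
      using frontier_cell_cases[OF r(4)] by metis
    have "y \<in> {a<..<b} \<Longrightarrow> G y \<in> cell h k" for y using r(3) by auto
    then show False using not_extremal_coordinate[OF r(1,2) c(1,2)] c(3) by blast
  qed
  \<comment> \<open>An arc of at least one period would be the entire curve. Every time would then
    be interior to an arc in the cell, so the curve would miss the cell boundary, and all four
    vertices, joined by cell edges, would have the same sign.\<close>
  have short: "t - s < 1"
  proof (rule ccontr)
    assume long: "\<not> t - s < 1"
    have all: "G r \<in> cell h k" for r
    proof -
      define r' where "r' = s + frac (r - s)"
      have "r' \<in> {s..t}" using long frac_lt_1[of "r - s"] frac_ge_0[of "r - s"] unfolding r'_def by auto
      moreover have "r' = r + of_int (- \<lfloor>r - s\<rfloor>)" by (simp add: r'_def frac_def)
      then have "G r' = G r" by (metis G_of_int)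
      ultimately show ?thesis using st(2) by (metis IntD1 imageI)
    qed
    have "G r \<notin> frontier (cell h k)" for r using no[of "r - 1" r "r + 1"] all by auto
    then have fr: "frontier (cell h k) \<inter> interface \<psi> = {}" unfolding interface_range by auto
    have edge: "\<psi> (pt h x) < 0 \<longleftrightarrow> \<psi> (pt h y) < 0"
      if "closed_segment (pt h x) (pt h y) \<subseteq> frontier (cell h k)" for x y
    proof -
      let ?S = "closed_segment (pt h x) (pt h y)"
      have xy: "pt h x \<in> ?S" "pt h y \<in> ?S" by simp_all
      have "?S \<inter> interface \<psi> = {}" using fr that by blast
      then have "(\<forall>z\<in>?S. \<psi> z < 0) \<or> (\<forall>z\<in>?S. \<psi> z > 0)"
        by (intro sign_connected connected_segment)
      then show ?thesis
      proof
        assume "\<forall>z\<in>?S. \<psi> z < 0"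
        from bspec[OF this xy(1)] bspec[OF this xy(2)] show ?thesis by simp
      next
        assume "\<forall>z\<in>?S. \<psi> z > 0"
        from bspec[OF this xy(1)] bspec[OF this xy(2)] show ?thesis by simp
      qed
    qed
    obtain k1 k2 where k12: "k = (k1, k2)" by (cases k)
    have frI: "z \<in> frontier (cell h k)"
      if "z \<in> cell h k" "fst z = h * of_int k1 \<or> fst z = h * of_int (k1 + 1) \<or> snd z = h * of_int k2 \<or> snd z = h * of_int (k2 + 1)" for z
      using that by (auto simp: cell_def frontier_cbox k12 pt_def mem_box Basis_prod_def inner_prod_def)
    have seg: "closed_segment (pt h x) (pt h y) \<subseteq> frontier (cell h k)"
      if xy: "x \<in> cell_vertices k" "y \<in> cell_vertices k" "fst x = fst y \<or> snd x = snd y" for x y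
    proof
      fix z assume z: "z \<in> closed_segment (pt h x) (pt h y)"
      have "closed_segment (pt h x) (pt h y) \<subseteq> cell h k"
        using xy cell_vertex_in_cell by (intro closed_segment_subset) (auto simp: cell_def)
      moreover have "fst z = fst (pt h x)" if "fst x = fst y"
        using z that by (auto simp: closed_segment_def pt_def algebra_simps)
      moreover have "snd z = snd (pt h x)" if "snd x = snd y"
        using z that by (auto simp: closed_segment_def pt_def algebra_simps)
      moreover have "fst x \<in> {k1, k1 + 1}" "snd x \<in> {k2, k2 + 1}"
        using xy(1) by (auto simp: cell_vertices_def k12)
      ultimately show "z \<in> frontier (cell h k)"
        using z xy(3) by (intro frI) (auto simp: pt_def)
    qed
    have same: "\<psi> (pt h k) < 0 \<longleftrightarrow> \<psi> (pt h x) < 0" if x: "x \<in> cell_vertices k" for x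
    proof -
      let ?y = "(fst x, snd k)"
      have y: "?y \<in> cell_vertices k" "k \<in> cell_vertices k" using x by (auto simp: cell_vertices_def k12)
      have "\<psi> (pt h k) < 0 \<longleftrightarrow> \<psi> (pt h ?y) < 0" using y by (intro edge seg) auto
      also have "\<dots> \<longleftrightarrow> \<psi> (pt h x) < 0" using y x by (intro edge seg) auto
      finally show ?thesis .
    qed
    obtain x y where "x \<in> cell_vertices k" "\<psi> (pt h x) < 0" "y \<in> cell_vertices k" "\<psi> (pt h y) > 0"
      using geometry k unfolding active_grid_geometry_def by meson
    then show False using same[of x] same[of y] by simp
  qed
  have sub: "interface \<psi> \<inter> frontier (cell h k) \<subseteq> {G s, G t}"
  proof
    fix x assume x: "x \<in> interface \<psi> \<inter> frontier (cell h k)"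
    then obtain r where r: "r \<in> {s..t}" "x = G r" using cl st(2) by blast
    show "x \<in> {G s, G t}"
    proof (rule ccontr)
      assume "x \<notin> {G s, G t}"
      then have "s < r" "r < t" using r by (auto simp: less_le)
      then show False using no[of s r t] st(2) x r by auto
    qed
  qed
  have endp: "G r \<in> frontier (cell h k)" if r: "r = s \<or> r = t" for r
  proof (rule ccontr)
    assume nf: "G r \<notin> frontier (cell h k)"
    have "G r \<in> cell h k" using st r by auto
    then have "G r \<in> interior (cell h k)" using nf by (simp add: frontier_def cell_def)
    moreover have "isCont G r" using continuous_G[of UNIV] by (simp add: continuous_on_eq_continuous_at)
    ultimately have "eventually (\<lambda>y. G y \<in> interior (cell h k)) (at r)"
      unfolding isCont_def by (metis open_interior topological_tendstoD)
    then obtain d where d: "d > 0" "\<And>y. y \<noteq> r \<Longrightarrow> dist y r < d \<Longrightarrow> G y \<in> interior (cell h k)"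
      unfolding eventually_at by blast
    \<comment> \<open>The first bound keeps G y in the cell. The second keeps the new time y less
      than one period away from all of [s, t], so that injectivity can compare it with any z
      there.\<close>
    define e where "e = min (d / 2) ((1 - (t - s)) / 2)"
    have e0: "0 < e" using d(1) short by (simp add: e_def)
    have e1: "e \<le> d / 2" unfolding e_def by (rule min.cobounded1)
    have e2: "e \<le> (1 - (t - s)) / 2" unfolding e_def by (rule min.cobounded2)
    from e1 have e: "0 < e" "e < d" using d(1) e0 by linarith+
    have "(1 - (t - s)) / 2 < 1 - (t - s)" using short by simp
    with e2 have e3: "e < 1 - (t - s)" by (rule le_less_trans)
    define y where "y = (if r = s then s - e else t + e)"
    have "G y \<in> interior (cell h k)" using d(2)[of y] e r by (auto simp: y_def dist_real_def split: if_splits)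
    then have "G y \<in> cell h k" using interior_subset by blast
    then obtain z where z: "z \<in> {s..t}" "G y = G z" using st(2) unfolding interface_range by (metis IntI imageE rangeI)
    have "\<bar>y - z\<bar> < 1" using z(1) e e3 r by (auto simp: y_def)
    then have "y = z" using z(2) G_eq_imp by blast
    then show False using z(1) e r by (auto simp: y_def split: if_splits)
  qed
  have "G s \<in> interface \<psi>" "G t \<in> interface \<psi>" by (auto simp: interface_range)
  then have "interface \<psi> \<inter> frontier (cell h k) = {G s, G t}" using sub endp by auto
  then show ?thesis by blast
qed

definition P :: "node \<Rightarrow> plane" where "P k = fst (crossings \<psi> h k)"
definition Q :: "node \<Rightarrow> plane" where "Q k = snd (crossings \<psi> h k)"

lemma crossings_in_cell:
  assumes k: "k \<in> active_cells \<psi> h"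
  shows "P k \<in> cell h k" "Q k \<in> cell h k" "P k \<in> interface \<psi>" "Q k \<in> interface \<psi>"
proof -
  define X where "X = (\<lambda>(p, q). interface \<psi> \<inter> frontier (cell h k) = {p, q})"
  obtain p q where "X (p, q)" using crossing_pair_exists[OF k] by (auto simp: X_def)
  then have "X (Eps X)" by (rule someI)
  moreover have "crossings \<psi> h k = Eps X" by (simp add: crossings_def X_def)
  ultimately have "interface \<psi> \<inter> frontier (cell h k) = {P k, Q k}"
    by (simp add: X_def P_def Q_def case_prod_beta)
  moreover have "frontier (cell h k) \<subseteq> cell h k" by (simp add: cell_def frontier_cbox)
  ultimately show "P k \<in> cell h k" "Q k \<in> cell h k" "P k \<in> interface \<psi>" "Q k \<in> interface \<psi>" by auto
qed

lemma discrete_interface_length: "(\<Sum>k\<in>active_cells \<psi> h. norm (Q k - P k)) \<le> 48 * \<Lambda>"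
proof -
  \<comment> \<open>A segment is bounded by 2 h and by the diameter bound \<Lambda> of the curve. In
    the cell count 16 (\<Lambda> / h + 1) the first is paired with \<Lambda> / h and the second with
    1, so 16 * 2 + 16 = 48 for fine and coarse meshes alike.\<close>
  define m where "m = min (2 * h) \<Lambda>"
  have m: "0 \<le> m" "m \<le> 2 * h" "m \<le> \<Lambda>" using h Lambda_nonneg by (auto simp: m_def)
  have "norm (Q k - P k) \<le> m" if k: "k \<in> active_cells \<psi> h" for k
    unfolding m_def
  proof (rule min.boundedI)
    note c = crossings_in_cell[OF k]
    show "norm (Q k - P k) \<le> 2 * h" by (rule segment_length[OF h c(1,2) finite_cell_vertices order_refl])
    show "norm (Q k - P k) \<le> \<Lambda>" by (rule interface_diameter[OF c(4,3)])
  qed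
  then have "(\<Sum>k\<in>active_cells \<psi> h. norm (Q k - P k)) \<le> (\<Sum>k\<in>active_cells \<psi> h. m)"
    by (rule sum_mono)
  also have "\<dots> = real (card (active_cells \<psi> h)) * m" by simp
  also have "\<dots> \<le> 16 * (\<Lambda> / h + 1) * m"
    by (rule mult_right_mono[OF card_active_cells m(1)])
  also have "\<dots> = 16 * (\<Lambda> / h) * m + 16 * m" by (simp add: algebra_simps)
  also have "\<dots> \<le> 16 * (\<Lambda> / h) * (2 * h) + 16 * \<Lambda>"
    using m Lambda_nonneg h by (intro add_mono mult_left_mono) simp_all
  also have "\<dots> = 48 * \<Lambda>" using h by simp
  finally show ?thesis .
qed

end

section \<open>Harmonic map and extrapolation\<close>

lemma discrete_laplacian_sum:
  "discrete_laplacian (\<lambda>x. \<Sum>k\<in>K. f k x * c k) y = (\<Sum>k\<in>K. discrete_laplacian (f k) y * c k)"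
  unfolding discrete_laplacian_def sum_axis_directions
  by (simp add: sum.distrib sum_subtractf sum_distrib_left algebra_simps)

lemma discrete_laplacian_diff:
  "discrete_laplacian (\<lambda>x. f x - g x) y = discrete_laplacian f y - discrete_laplacian g y"
  unfolding discrete_laplacian_def sum_axis_directions by simp

lemma discrete_laplacian_shift_green:
  "discrete_laplacian (\<lambda>x. lattice_green (x - j)) y = - of_bool (y = j)"
proof -
  have "discrete_laplacian (\<lambda>x. lattice_green (x - j)) y = discrete_laplacian lattice_green (y - j)"
    by (simp add: discrete_laplacian_def algebra_simps)
  also have "\<dots> = - of_bool (y = j)"
    unfolding discrete_laplacian_lattice_green by (cases y; cases j) auto
  finally show ?thesis .
qed

context cut_mesh
begin

lemma finite_gammas: "finite (gamma1 \<psi> h)" "finite (gamma2 \<psi> h)" "finite (gamma3 \<psi> h)"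
  by (rule finite_subset[OF _ finite_active_nodes]; auto simp: gamma1_def gamma2_def gamma3_def)+

lemma active_nodes_partition: "active_nodes \<psi> h = gamma1 \<psi> h \<union> gamma2 \<psi> h \<union> gamma3 \<psi> h"
proof -
  have "x \<in> gamma1 \<psi> h \<or> x \<in> gamma2 \<psi> h \<or> x \<in> gamma3 \<psi> h" if "x \<in> active_nodes \<psi> h" for x
    using that node_nonzero[of x] unfolding gamma1_def gamma3_def by (cases "\<psi> (pt h x) < 0") auto
  then show ?thesis by (auto simp: gamma1_def gamma2_def gamma3_def)
qed

lemma gammas_disjoint:
  "gamma1 \<psi> h \<inter> gamma2 \<psi> h = {}" "gamma1 \<psi> h \<inter> gamma3 \<psi> h = {}" "gamma2 \<psi> h \<inter> gamma3 \<psi> h = {}"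
  by (auto simp: gamma1_def gamma2_def gamma3_def)

lemma positive_node: "x \<notin> interior_nodes \<psi> h \<Longrightarrow> \<psi> (pt h x) > 0"
  using node_nonzero[of x] by (simp add: interior_nodes_def)

lemma finite_interior_nodes: "finite (interior_nodes \<psi> h)"
  using geometry unfolding active_grid_geometry_def by blast

lemma outer_boundary_gamma2: "outer_boundary (interior_nodes \<psi> h) \<subseteq> gamma2 \<psi> h"
proof
  fix y assume "y \<in> outer_boundary (interior_nodes \<psi> h)"
  then obtain x where "x \<in> interior_nodes \<psi> h" "adj x y" "\<psi> (pt h y) > 0"
    using positive_node unfolding outer_boundary_def by blast
  then show "y \<in> gamma2 \<psi> h" using adj_opposite_active(2) by (simp add: interior_nodes_def)
qed

lemma gamma1_interior: "gamma1 \<psi> h \<subseteq> interior_nodes \<psi> h"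
  by (auto simp: gamma1_def interior_nodes_def)

text \<open>This is why \<open>dirichlet_layer_bound\<close> admits two layers: from x to a positive
  vertex of the same cell takes up to two lattice steps, and the sign at the corner y between them
  decides which case occurs.\<close>

lemma gamma1_near_boundary:
  assumes x: "x \<in> gamma1 \<psi> h"
  shows "x \<in> boundary_layer (interior_nodes \<psi> h) \<or> (\<exists>y\<in>boundary_layer (interior_nodes \<psi> h). adj x y)"
proof -
  let ?V = "interior_nodes \<psi> h"
  obtain k where k: "k \<in> active_cells \<psi> h" "x \<in> cell_vertices k"
    using x by (auto simp: gamma1_def active_nodes_def)
  obtain z where z: "z \<in> cell_vertices k" "\<psi> (pt h z) > 0"
    using geometry k(1) unfolding active_grid_geometry_def by meson
  have xV: "x \<in> ?V" and zV: "z \<notin> ?V" using x z gamma1_interior by (auto simp: interior_nodes_def)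
  define y where "y = (fst z, snd x)"
  have xy: "x = y \<or> adj x y" and yz: "y = z \<or> adj y z"
    using k(2) z(1) by (cases k; auto simp: y_def cell_vertices_def adj_def)+
  show ?thesis
  proof (cases "y \<in> ?V")
    case True
    then have "y \<in> boundary_layer ?V" using True yz zV unfolding boundary_layer_def by blast
    then show ?thesis using xy by auto
  next
    case False
    then have "x \<in> boundary_layer ?V" using False xy xV unfolding boundary_layer_def by blast
    then show ?thesis by simp
  qed
qed

text \<open>Besides boundedness it yields uniqueness on \<open>gamma1\<close>, when applied to a
  harmonic function that vanishes on \<open>gamma2\<close>.\<close>

lemma interior_harmonic_bound:
  assumes "\<And>x. x \<in> interior_nodes \<psi> h \<Longrightarrow> discrete_laplacian u x = 0"
  shows "(\<Sum>x\<in>gamma1 \<psi> h. (u x)\<^sup>2) \<le> 20 * (\<Sum>x\<in>gamma2 \<psi> h. (u x)\<^sup>2)"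
proof -
  have "(\<Sum>x\<in>gamma1 \<psi> h. (u x)\<^sup>2) \<le> 20 * (\<Sum>y\<in>outer_boundary (interior_nodes \<psi> h). (u y)\<^sup>2)"
    by (rule dirichlet_layer_bound[OF finite_interior_nodes assms gamma1_interior gamma1_near_boundary])
  also have "\<dots> \<le> 20 * (\<Sum>x\<in>gamma2 \<psi> h. (u x)\<^sup>2)"
    using outer_boundary_gamma2 finite_gammas(2) by (intro mult_left_mono sum_mono2) auto
  finally show ?thesis .
qed

text \<open>All poles lie outside the interior. For the double layer this concerns also the inactive
  neighbours k of j: an interior one would see a sign change across the edge to j and would
  therefore be active.\<close>

lemma laplacian_layer_kernel:
  assumes y: "y \<in> interior_nodes \<psi> h" and j: "j \<in> gamma2 \<psi> h"
  shows "discrete_laplacian (\<lambda>x. layer_kernel \<psi> h lay x j) y = 0"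
proof -
  have yj: "y \<noteq> j" using y j by (auto simp: interior_nodes_def gamma2_def)
  show ?thesis
  proof (cases lay)
    case Single_Layer
    then show ?thesis using yj by (simp add: layer_kernel_def discrete_laplacian_shift_green)
  next
    case Double_Layer
    let ?K = "{k. adj k j \<and> k \<notin> active_nodes \<psi> h}"
    have "y \<noteq> k" if "k \<in> ?K" for k
      using that y j adj_opposite_active(1)[of k j] by (auto simp: interior_nodes_def gamma2_def gamma1_def)
    moreover have "discrete_laplacian (\<lambda>x. layer_kernel \<psi> h lay x j) y
      = discrete_laplacian (\<lambda>x. \<Sum>k\<in>?K. (lattice_green (x - k) - lattice_green (x - j)) * 1) y"
      using Double_Layer by (simp add: layer_kernel_def)
    ultimately show ?thesis
      unfolding discrete_laplacian_sum discrete_laplacian_diff discrete_laplacian_shift_green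
      using yj by simp
  qed
qed

text \<open>The potential whose density is the inverse block applied to v is a single function with
  all three properties. The size of the inverse never enters.\<close>

lemma harmonic_map_extension:
  assumes inv: "invertible_on (gamma2 \<psi> h) (layer_kernel \<psi> h lay)"
  obtains U where "\<And>x. x \<in> interior_nodes \<psi> h \<Longrightarrow> discrete_laplacian U x = 0"
    "\<And>i. i \<in> gamma2 \<psi> h \<Longrightarrow> U i = v i"
    "\<And>i. U i = (\<Sum>j\<in>gamma2 \<psi> h. harmonic_map \<psi> h lay i j * v j)"
proof -
  let ?I = "gamma2 \<psi> h"
  define B where "B = inverse_on ?I (layer_kernel \<psi> h lay)"
  have B: "is_inverse_on ?I (layer_kernel \<psi> h lay) B"
    unfolding B_def inverse_on_def using inv unfolding invertible_on_def by (rule someI_ex)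
  define c where "c k = (\<Sum>j\<in>?I. B k j * v j)" for k
  define U where "U x = (\<Sum>k\<in>?I. layer_kernel \<psi> h lay x k * c k)" for x
  have U: "U i = (\<Sum>j\<in>?I. (\<Sum>k\<in>?I. layer_kernel \<psi> h lay i k * B k j) * v j)" for i
  proof -
    have "U i = (\<Sum>k\<in>?I. \<Sum>j\<in>?I. layer_kernel \<psi> h lay i k * B k j * v j)"
      unfolding U_def c_def by (simp add: sum_distrib_left mult.assoc)
    also have "\<dots> = (\<Sum>j\<in>?I. \<Sum>k\<in>?I. layer_kernel \<psi> h lay i k * B k j * v j)" by (rule sum.swap)
    finally show ?thesis by (simp add: sum_distrib_right)
  qed
  show thesis
  proof (rule that)
    show "discrete_laplacian U x = 0" if "x \<in> interior_nodes \<psi> h" for x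
      unfolding U_def discrete_laplacian_sum using laplacian_layer_kernel[OF that] by simp
    show "U i = (\<Sum>j\<in>?I. harmonic_map \<psi> h lay i j * v j)" for i
      unfolding U harmonic_map_def B_def ..
    show "U i = v i" if i: "i \<in> ?I" for i
    proof -
      have "U i = (\<Sum>j\<in>?I. of_bool (i = j) * v j)"
        unfolding U using B i by (intro sum.cong refl) (simp add: is_inverse_on_def)
      also have "\<dots> = (\<Sum>j\<in>?I. if i = j then v j else 0)" by (intro sum.cong) auto
      finally show ?thesis using i finite_gammas(2) by simp
    qed
  qed
qed

text \<open>In each direction the weights 2 and -1 add up to 1, and averaging preserves this; with
  the sign convention of R the row sum is -1. Two directions involve at most four nodes.\<close>

lemma axis_rule_row:
  assumes "axis_rule \<psi> h \<eta> r"
  shows "\<exists>S. S \<subseteq> gamma1 \<psi> h \<union> gamma2 \<psi> h \<and> finite S \<and> card S \<le> 4 \<and>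
    (\<forall>\<xi>\<in>gamma1 \<psi> h \<union> gamma2 \<psi> h - S. r \<xi> = 0) \<and> (\<forall>\<xi>\<in>S. \<bar>r \<xi>\<bar> \<le> 2) \<and>
    (\<Sum>\<xi>\<in>gamma1 \<psi> h \<union> gamma2 \<psi> h. r \<xi>) = -1"
proof -
  let ?\<Gamma> = "gamma1 \<psi> h \<union> gamma2 \<psi> h"
  obtain A where adm: "\<And>e. e \<in> A \<Longrightarrow> admissible \<psi> h \<eta> e"
    and A: "(\<exists>e f. A = {e, f}) \<or> (\<exists>e. A = {e})"
    and r: "\<And>\<xi>. \<xi> \<in> ?\<Gamma> \<Longrightarrow> r \<xi> = - (\<Sum>e\<in>A. 2 * of_bool (\<xi> = \<eta> - e) - of_bool (\<xi> = \<eta> - e - e)) / real (card A)"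
  proof -
    let ?P = "\<exists>e f. admissible \<psi> h \<eta> e \<and> admissible \<psi> h \<eta> f \<and> fst e * fst f + snd e * snd f = 0"
    obtain A where A: "\<forall>e\<in>A. admissible \<psi> h \<eta> e"
      "if ?P then \<exists>e f. A = {e, f} \<and> fst e * fst f + snd e * snd f = 0 else \<exists>e. A = {e}"
      "\<forall>\<xi>\<in>?\<Gamma>. r \<xi> = - (\<Sum>e\<in>A. 2 * of_bool (\<xi> = \<eta> - e) - of_bool (\<xi> = \<eta> - e - e)) / real (card A)"
      using assms unfolding axis_rule_def by blast
    have "(\<exists>e f. A = {e, f}) \<or> (\<exists>e. A = {e})" using A(2) by (cases ?P) (simp only: if_True if_False, blast)+
    then show thesis using A(1,3) by (intro that[of A]) blast+
  qed
  have fin: "finite A" "card A \<le> 2" "card A > 0"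
    using A by (auto simp: card_insert_if)
  define S where "S = (\<lambda>e. \<eta> - e) ` A \<union> (\<lambda>e. \<eta> - e - e) ` A"
  have "S \<subseteq> ?\<Gamma>" using adm unfolding S_def admissible_def by blast
  moreover have "finite S" using fin by (simp add: S_def)
  moreover have "card S \<le> 4"
  proof -
    have "card S \<le> card ((\<lambda>e. \<eta> - e) ` A) + card ((\<lambda>e. \<eta> - e - e) ` A)" unfolding S_def by (rule card_Un_le)
    also have "\<dots> \<le> card A + card A" using fin by (intro add_mono card_image_le) auto
    finally show ?thesis using fin by simp
  qed
  moreover have "\<forall>\<xi>\<in>?\<Gamma> - S. r \<xi> = 0"
  proof
    fix \<xi> assume \<xi>: "\<xi> \<in> ?\<Gamma> - S"
    then have "(\<Sum>e\<in>A. 2 * of_bool (\<xi> = \<eta> - e) - of_bool (\<xi> = \<eta> - e - e)) = (0::real)"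
      by (intro sum.neutral) (auto simp: S_def)
    then show "r \<xi> = 0" using r[of \<xi>] \<xi> by simp
  qed
  moreover have "\<forall>\<xi>\<in>S. \<bar>r \<xi>\<bar> \<le> 2"
  proof
    fix \<xi> assume "\<xi> \<in> S"
    then have \<xi>: "\<xi> \<in> ?\<Gamma>" using \<open>S \<subseteq> ?\<Gamma>\<close> by blast
    have "\<bar>\<Sum>e\<in>A. 2 * of_bool (\<xi> = \<eta> - e) - of_bool (\<xi> = \<eta> - e - e)\<bar>
        \<le> (\<Sum>e\<in>A. \<bar>2 * of_bool (\<xi> = \<eta> - e) - of_bool (\<xi> = \<eta> - e - e) :: real\<bar>)" by (rule sum_abs)
    also have "\<dots> \<le> (\<Sum>e\<in>A. 2)" by (intro sum_mono) auto
    also have "\<dots> = 2 * real (card A)" by simp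
    finally show "\<bar>r \<xi>\<bar> \<le> 2" unfolding r[OF \<xi>] using fin by (simp add: divide_le_eq)
  qed
  moreover have "(\<Sum>\<xi>\<in>?\<Gamma>. r \<xi>) = -1"
  proof -
    have one: "(\<Sum>\<xi>\<in>?\<Gamma>. of_bool (\<xi> = z)) = (1::real)" if "z \<in> ?\<Gamma>" for z
      using that finite_gammas by simp
    have "(\<Sum>\<xi>\<in>?\<Gamma>. \<Sum>e\<in>A. 2 * of_bool (\<xi> = \<eta> - e) - of_bool (\<xi> = \<eta> - e - e) :: real)
      = (\<Sum>e\<in>A. \<Sum>\<xi>\<in>?\<Gamma>. 2 * of_bool (\<xi> = \<eta> - e) - of_bool (\<xi> = \<eta> - e - e))" by (rule sum.swap)
    also have "\<dots> = (\<Sum>e\<in>A. 1)"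
    proof (rule sum.cong[OF refl])
      fix e assume "e \<in> A"
      then have z: "\<eta> - e \<in> ?\<Gamma>" "\<eta> - e - e \<in> ?\<Gamma>" using adm by (auto simp: admissible_def)
      show "(\<Sum>\<xi>\<in>?\<Gamma>. 2 * of_bool (\<xi> = \<eta> - e) - of_bool (\<xi> = \<eta> - e - e)) = (1::real)"
        unfolding sum_subtractf sum_distrib_left[symmetric] one[OF z(1)] one[OF z(2)] by simp
    qed
    finally have "(\<Sum>\<xi>\<in>?\<Gamma>. \<Sum>e\<in>A. 2 * of_bool (\<xi> = \<eta> - e) - of_bool (\<xi> = \<eta> - e - e) :: real) = card A" by simp
    moreover have "(\<Sum>\<xi>\<in>?\<Gamma>. r \<xi>) = (\<Sum>\<xi>\<in>?\<Gamma>. - (\<Sum>e\<in>A. 2 * of_bool (\<xi> = \<eta> - e) - of_bool (\<xi> = \<eta> - e - e)) / real (card A))"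
      by (rule sum.cong[OF refl r])
    ultimately have "(\<Sum>\<xi>\<in>?\<Gamma>. r \<xi>) = - real (card A) / real (card A)"
      by (simp only: sum_divide_distrib[symmetric] sum_negf)
    moreover have "real (card A) \<noteq> 0" using fin(3) by simp
    ultimately show ?thesis by (simp only: divide_minus_left divide_self_if if_False)
  qed
  ultimately show ?thesis by blast
qed

text \<open>The row sum is exactness of the rule for the constant function 1.\<close>

lemma least_squares_rule_row:
  assumes "least_squares_rule \<psi> h B \<eta> r"
  shows "\<exists>S. S \<subseteq> gamma1 \<psi> h \<union> gamma2 \<psi> h \<and> finite S \<and> card S \<le> B \<and>
    (\<forall>\<xi>\<in>gamma1 \<psi> h \<union> gamma2 \<psi> h - S. r \<xi> = 0) \<and> (\<forall>\<xi>\<in>S. \<bar>r \<xi>\<bar> \<le> real B) \<and>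
    (\<Sum>\<xi>\<in>gamma1 \<psi> h \<union> gamma2 \<psi> h. r \<xi>) = -1"
proof -
  obtain S where S: "S \<subseteq> gamma1 \<psi> h \<union> gamma2 \<psi> h" "finite S" "card S \<le> B"
    "\<forall>\<xi>\<in>gamma1 \<psi> h \<union> gamma2 \<psi> h - S. r \<xi> = 0" "\<forall>\<xi>\<in>S. \<bar>r \<xi>\<bar> \<le> real B"
    "\<And>p. lattice_affine p \<Longrightarrow> p \<eta> = - (\<Sum>\<xi>\<in>S. r \<xi> * p \<xi>)"
    using assms unfolding least_squares_rule_def by blast
  have "lattice_affine (\<lambda>_. 1)"
    unfolding lattice_affine_def by (intro exI[of _ 1] exI[of _ 0]) simp
  from S(6)[OF this] have "(\<Sum>\<xi>\<in>S. r \<xi>) = -1" by simp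
  moreover have "(\<Sum>\<xi>\<in>gamma1 \<psi> h \<union> gamma2 \<psi> h. r \<xi>) = (\<Sum>\<xi>\<in>S. r \<xi>)"
    using finite_gammas S by (intro sum.mono_neutral_right) auto
  ultimately show ?thesis using S by auto
qed

text \<open>B + 4 is a common bound for both rules: the axis rule uses up to 4 nodes with weights up
  to 2, the least-squares rule up to B nodes with weights up to B.\<close>

lemma local_extrapolation_row:
  assumes R: "local_extrapolation \<psi> h B R" and \<eta>: "\<eta> \<in> gamma3 \<psi> h"
  shows "\<exists>S. S \<subseteq> gamma1 \<psi> h \<union> gamma2 \<psi> h \<and> finite S \<and> card S \<le> B + 4 \<and>
    (\<forall>\<xi>\<in>gamma1 \<psi> h \<union> gamma2 \<psi> h - S. R \<eta> \<xi> = 0) \<and> (\<forall>\<xi>\<in>S. \<bar>R \<eta> \<xi>\<bar> \<le> real (B + 4)) \<and>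
    (\<Sum>\<xi>\<in>gamma1 \<psi> h \<union> gamma2 \<psi> h. R \<eta> \<xi>) = -1"
proof -
  from R \<eta> consider "axis_rule \<psi> h \<eta> (R \<eta>)" | "least_squares_rule \<psi> h B \<eta> (R \<eta>)"
    unfolding local_extrapolation_def by blast
  then show ?thesis
  proof cases
    case 1
    obtain S where S: "S \<subseteq> gamma1 \<psi> h \<union> gamma2 \<psi> h" "finite S" "card S \<le> 4"
      "\<forall>\<xi>\<in>gamma1 \<psi> h \<union> gamma2 \<psi> h - S. R \<eta> \<xi> = 0" "\<forall>\<xi>\<in>S. \<bar>R \<eta> \<xi>\<bar> \<le> 2"
      "(\<Sum>\<xi>\<in>gamma1 \<psi> h \<union> gamma2 \<psi> h. R \<eta> \<xi>) = -1"
      using axis_rule_row[OF 1] by blast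
    show ?thesis by (rule exI[of _ S]) (use S in force)
  next
    case 2
    obtain S where S: "S \<subseteq> gamma1 \<psi> h \<union> gamma2 \<psi> h" "finite S" "card S \<le> B"
      "\<forall>\<xi>\<in>gamma1 \<psi> h \<union> gamma2 \<psi> h - S. R \<eta> \<xi> = 0" "\<forall>\<xi>\<in>S. \<bar>R \<eta> \<xi>\<bar> \<le> real B"
      "(\<Sum>\<xi>\<in>gamma1 \<psi> h \<union> gamma2 \<psi> h. R \<eta> \<xi>) = -1"
      using least_squares_rule_row[OF 2] by blast
    show ?thesis by (rule exI[of _ S]) (use S in force)
  qed
qed

text \<open>With b = B + 4, Cauchy-Schwarz along a row costs b for the number of nodes and b^2 for
  the weights; interchanging the sums costs another b, since a node lies in at most B
  patches.\<close>

lemma extrapolation_bound: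
  assumes R: "local_extrapolation \<psi> h B R"
  shows "(\<Sum>\<eta>\<in>gamma3 \<psi> h. (\<Sum>\<xi>\<in>gamma1 \<psi> h \<union> gamma2 \<psi> h. R \<eta> \<xi> * u \<xi>)\<^sup>2)
    \<le> real (B + 4) ^ 4 * (\<Sum>\<xi>\<in>gamma1 \<psi> h \<union> gamma2 \<psi> h. (u \<xi>)\<^sup>2)"
proof -
  let ?\<Gamma> = "gamma1 \<psi> h \<union> gamma2 \<psi> h"
  define b where "b = real (B + 4)"
  have b: "b \<ge> 0" by (simp add: b_def)
  have row: "(\<Sum>\<xi>\<in>?\<Gamma>. R \<eta> \<xi> * u \<xi>)\<^sup>2 \<le> b ^ 3 * (\<Sum>\<xi>\<in>{\<xi> \<in> ?\<Gamma>. R \<eta> \<xi> \<noteq> 0}. (u \<xi>)\<^sup>2)"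
    if \<eta>: "\<eta> \<in> gamma3 \<psi> h" for \<eta>
  proof -
    obtain S where S: "S \<subseteq> ?\<Gamma>" "finite S" "card S \<le> B + 4"
      "\<forall>\<xi>\<in>?\<Gamma> - S. R \<eta> \<xi> = 0" "\<forall>\<xi>\<in>S. \<bar>R \<eta> \<xi>\<bar> \<le> b"
      using local_extrapolation_row[OF R \<eta>] unfolding b_def by blast
    define T where "T = {\<xi> \<in> ?\<Gamma>. R \<eta> \<xi> \<noteq> 0}"
    have T: "T \<subseteq> S" "finite T" using S by (auto simp: T_def intro: finite_subset)
    have cT: "real (card T) \<le> b"
      using card_mono[OF S(2) T(1)] S(3) unfolding b_def by linarith
    have "(\<Sum>\<xi>\<in>?\<Gamma>. R \<eta> \<xi> * u \<xi>) = (\<Sum>\<xi>\<in>T. R \<eta> \<xi> * u \<xi>)"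
      using finite_gammas by (intro sum.mono_neutral_right) (auto simp: T_def)
    also have "(\<dots>)\<^sup>2 \<le> (\<Sum>\<xi>\<in>T. (R \<eta> \<xi> * u \<xi>)\<^sup>2) * card T" by (rule sum_squared_le_sum_of_squares)
    also have "\<dots> \<le> (\<Sum>\<xi>\<in>T. b\<^sup>2 * (u \<xi>)\<^sup>2) * b"
    proof (intro mult_mono sum_mono cT sum_nonneg)
      fix \<xi> assume "\<xi> \<in> T"
      then have "\<bar>R \<eta> \<xi>\<bar>\<^sup>2 \<le> b\<^sup>2" using S(5) T(1) by (intro power_mono) auto
      then show "(R \<eta> \<xi> * u \<xi>)\<^sup>2 \<le> b\<^sup>2 * (u \<xi>)\<^sup>2"
        by (simp add: power_mult_distrib mult_right_mono)
    qed auto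
    also have "\<dots> = b ^ 3 * (\<Sum>\<xi>\<in>T. (u \<xi>)\<^sup>2)"
      by (simp add: sum_distrib_left[symmetric] power3_eq_cube power2_eq_square)
    finally show ?thesis by (simp add: T_def)
  qed
  have "(\<Sum>\<eta>\<in>gamma3 \<psi> h. (\<Sum>\<xi>\<in>?\<Gamma>. R \<eta> \<xi> * u \<xi>)\<^sup>2)
    \<le> (\<Sum>\<eta>\<in>gamma3 \<psi> h. b ^ 3 * (\<Sum>\<xi>\<in>{\<xi> \<in> ?\<Gamma>. R \<eta> \<xi> \<noteq> 0}. (u \<xi>)\<^sup>2))"
    by (rule sum_mono[OF row])
  also have "\<dots> = b ^ 3 * (\<Sum>\<eta>\<in>gamma3 \<psi> h. \<Sum>\<xi>\<in>{\<xi> \<in> ?\<Gamma>. R \<eta> \<xi> \<noteq> 0}. (u \<xi>)\<^sup>2)" by (simp add: sum_distrib_left)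
  also have "(\<Sum>\<eta>\<in>gamma3 \<psi> h. \<Sum>\<xi>\<in>{\<xi> \<in> ?\<Gamma>. R \<eta> \<xi> \<noteq> 0}. (u \<xi>)\<^sup>2)
    = (\<Sum>\<xi>\<in>?\<Gamma>. \<Sum>\<eta>\<in>{\<eta> \<in> gamma3 \<psi> h. R \<eta> \<xi> \<noteq> 0}. (u \<xi>)\<^sup>2)"
    using finite_gammas by (intro sum.swap_restrict) auto
  also have "\<dots> \<le> (\<Sum>\<xi>\<in>?\<Gamma>. b * (u \<xi>)\<^sup>2)"
  proof (rule sum_mono)
    fix \<xi> assume \<xi>: "\<xi> \<in> ?\<Gamma>"
    have "card {\<eta> \<in> gamma3 \<psi> h. R \<eta> \<xi> \<noteq> 0} \<le> card {\<eta> \<in> gamma3 \<psi> h. \<xi> \<in> patch \<psi> h R \<eta>}"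
      using finite_gammas \<xi> by (intro card_mono) (auto simp: patch_def)
    also have "\<dots> \<le> B" using R unfolding local_extrapolation_def by blast
    finally have "real (card {\<eta> \<in> gamma3 \<psi> h. R \<eta> \<xi> \<noteq> 0}) \<le> b" unfolding b_def by linarith
    then show "(\<Sum>\<eta>\<in>{\<eta> \<in> gamma3 \<psi> h. R \<eta> \<xi> \<noteq> 0}. (u \<xi>)\<^sup>2) \<le> b * (u \<xi>)\<^sup>2"
      by (simp add: mult_right_mono)
  qed
  finally show ?thesis
    using b unfolding b_def[symmetric]
    by (simp add: mult_left_mono sum_distrib_left[symmetric] power_numeral_reduce mult.assoc)
qed

end

section \<open>Poincare inequality on the discrete interface\<close>

text \<open>The image of the union is an interval, covered by the images of the pieces; comparing Lebesgue
  measures avoids choosing a chain of overlapping pieces.\<close>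

lemma oscillation_connected_Union_le:
  fixes f :: "'a::topological_space \<Rightarrow> real" and o' :: "'b \<Rightarrow> real"
  assumes K: "finite K" and conn: "connected (\<Union>k\<in>K. S k)" and cont: "continuous_on (\<Union>k\<in>K. S k) f"
    and osc: "\<And>k x y. k \<in> K \<Longrightarrow> x \<in> S k \<Longrightarrow> y \<in> S k \<Longrightarrow> \<bar>f x - f y\<bar> \<le> o' k"
    and o0: "\<And>k. k \<in> K \<Longrightarrow> 0 \<le> o' k"
    and comp: "\<And>k. k \<in> K \<Longrightarrow> compact (S k)"
    and xy: "x \<in> (\<Union>k\<in>K. S k)" "y \<in> (\<Union>k\<in>K. S k)"
  shows "\<bar>f x - f y\<bar> \<le> (\<Sum>k\<in>K. o' k)"
proof -
  have main: "f y - f x \<le> (\<Sum>k\<in>K. o' k)" if xy: "x \<in> (\<Union>k\<in>K. S k)" "y \<in> (\<Union>k\<in>K. S k)" for x y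
  proof (cases "f x \<le> f y")
    case False
    then show ?thesis using o0 by (meson sum_nonneg diff_le_0_iff_le linear order_trans)
  next
    case True
    have "\<exists>m. \<forall>z\<in>S k. f z \<in> {m..m + o' k}" if k: "k \<in> K" for k
    proof (cases "S k = {}")
      case False
      have "continuous_on (S k) f" using cont k by (rule_tac continuous_on_subset) auto
      then obtain z0 where z0: "z0 \<in> S k" "\<And>z. z \<in> S k \<Longrightarrow> f z0 \<le> f z"
        using continuous_attains_inf[OF comp[OF k] False] by blast
      have "f z \<in> {f z0..f z0 + o' k}" if z: "z \<in> S k" for z
        using z0(2)[OF z] osc[OF k z z0(1)] by simp
      then show ?thesis by blast
    qed simp
    then obtain m where m: "\<And>k z. k \<in> K \<Longrightarrow> z \<in> S k \<Longrightarrow> f z \<in> {m k..m k + o' k}" by metis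
    have "connected (f ` (\<Union>k\<in>K. S k))" by (rule connected_continuous_image[OF cont conn])
    then have "{f x..f y} \<subseteq> f ` (\<Union>k\<in>K. S k)"
      using xy by (intro connected_contains_Icc) auto
    also have "\<dots> \<subseteq> (\<Union>k\<in>K. {m k..m k + o' k})" using m by blast
    finally have "emeasure lborel {f x..f y} \<le> emeasure lborel (\<Union>k\<in>K. {m k..m k + o' k})"
      using K by (intro emeasure_mono) auto
    also have "\<dots> \<le> (\<Sum>k\<in>K. emeasure lborel {m k..m k + o' k})"
      using K by (intro emeasure_subadditive_finite) auto
    also have "\<dots> = (\<Sum>k\<in>K. ennreal (o' k))" using o0 by (intro sum.cong) auto
    also have "\<dots> = ennreal (\<Sum>k\<in>K. o' k)" using o0 by (rule sum_ennreal)
    finally show ?thesis using True o0 by (simp add: ennreal_le_iff sum_nonneg)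
  qed
  show ?thesis using main[OF xy] main[OF xy(2,1)] by linarith
qed

lemma segment_integral_le:
  assumes "continuous_on UNIV f" and "\<And>t. t \<in> {0..1} \<Longrightarrow> 0 \<le> f (p + t *\<^sub>R (q - p)) \<and> f (p + t *\<^sub>R (q - p)) \<le> m"
  shows "0 \<le> segment_integral p q f \<and> segment_integral p q f \<le> norm (q - p) * m"
proof -
  have cont: "continuous_on {0..1} (\<lambda>t. f (p + t *\<^sub>R (q - p)))"
    by (rule continuous_on_compose2[OF assms(1)]) (auto intro!: continuous_intros)
  then have "set_integrable lborel {0..1} (\<lambda>t. f (p + t *\<^sub>R (q - p)))"
    unfolding set_integrable_def by (rule borel_integrable_compact[OF compact_Icc])
  then have eq: "(LINT t:{0..1}|lborel. f (p + t *\<^sub>R (q - p))) = integral {0..1} (\<lambda>t. f (p + t *\<^sub>R (q - p)))"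
    by (rule set_borel_integral_eq_integral)
  have "integral {0..1} (\<lambda>t. f (p + t *\<^sub>R (q - p))) \<le> integral {0..1} (\<lambda>t::real. m)"
    using assms(2) by (intro integral_le integrable_continuous_real cont) auto
  moreover have "0 \<le> integral {0..1} (\<lambda>t. f (p + t *\<^sub>R (q - p)))"
    using assms(2) by (intro integral_nonneg integrable_continuous_real cont) auto
  ultimately show ?thesis unfolding segment_integral_def eq by (simp add: mult_left_mono)
qed

context cut_mesh
begin

text \<open>Two nodes are needed for a nonconstant vector. They are found to the right of a
  rightmost and to the left of a leftmost interior node; an interior node exists because the cell
  containing G 0 is active.\<close>

lemma gamma2_ge_2: "2 \<le> card (gamma2 \<psi> h)"
proof -
  let ?V = "interior_nodes \<psi> h"
  define k :: node where "k = (\<lfloor>fst (G 0) / h\<rfloor>, \<lfloor>snd (G 0) / h\<rfloor>)"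
  have "G 0 \<in> cell h k"
    unfolding mem_cell_iff[OF h] k_def fst_conv snd_conv by linarith
  then have "k \<in> active_cells \<psi> h" by (auto simp: active_cells_def interface_range)
  then obtain x0 where "\<psi> (pt h x0) < 0"
    using geometry unfolding active_grid_geometry_def by meson
  then have "x0 \<in> ?V" by (simp add: interior_nodes_def)
  then have ne: "fst ` ?V \<noteq> {}" by blast
  have fin: "finite (fst ` ?V)" using finite_interior_nodes by simp
  obtain a where a: "a \<in> ?V" "fst a = Max (fst ` ?V)" using Max_in[OF fin ne] by (metis imageE)
  obtain b where b: "b \<in> ?V" "fst b = Min (fst ` ?V)" using Min_in[OF fin ne] by (metis imageE)
  have "a + (1, 0) \<notin> ?V" using Max_ge[OF fin] a(2) by (force simp: image_iff)
  moreover have "b - (1, 0) \<notin> ?V" using Min_le[OF fin] b(2) by (force simp: image_iff)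
  moreover have "adj a (a + (1, 0))" "adj b (b - (1, 0))" by (auto simp: adj_def)
  ultimately have g: "a + (1, 0) \<in> gamma2 \<psi> h" "b - (1, 0) \<in> gamma2 \<psi> h"
    using a(1) b(1) positive_node adj_opposite_active(2) by (auto simp: interior_nodes_def)
  have "fst b \<le> fst a" unfolding a(2) by (rule Max_ge[OF fin imageI[OF b(1)]])
  then have ne: "a + (1, 0) \<noteq> b - (1, 0)" by (auto simp: prod_eq_iff)
  have "card {a + (1, 0), b - (1, 0)} \<le> card (gamma2 \<psi> h)"
    using g finite_gammas(2) by (intro card_mono) auto
  then show ?thesis using ne by simp
qed

section \<open>The tangential form on the discrete interface\<close>

lemma surface_integral_eq: "surface_integral \<psi> h f = (\<Sum>k\<in>active_cells \<psi> h. segment_integral (P k) (Q k) f)"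
  by (simp add: surface_integral_def P_def Q_def case_prod_beta)

lemma surface_form_eq: "surface_form \<psi> h f g = (\<Sum>k\<in>active_cells \<psi> h. segment_form (P k) (Q k) f g)"
  by (simp add: surface_form_def P_def Q_def case_prod_beta)

abbreviation fe :: "(node \<Rightarrow> real) \<Rightarrow> plane \<Rightarrow> real" where
  "fe \<equiv> fe_function h (active_nodes \<psi> h)"

lemma cell_vertices_active: "k \<in> active_cells \<psi> h \<Longrightarrow> cell_vertices k \<subseteq> active_nodes \<psi> h"
  by (auto simp: active_nodes_def)

lemma surface_form_commute: "surface_form \<psi> h (fe u) (fe w) = surface_form \<psi> h (fe w) (fe u)"
  unfolding surface_form_eq
  by (intro sum.cong refl)
     (simp add: segment_form_fe[OF h crossings_in_cell(1,2) finite_active_nodes cell_vertices_active] mult.commute)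

lemma surface_form_sum:
  assumes "finite I" "finite J"
  shows "surface_form \<psi> h (fe (\<lambda>\<xi>. \<Sum>i\<in>I. c i * w i \<xi>)) (fe (\<lambda>\<xi>. \<Sum>j\<in>J. d j * z j \<xi>))
    = (\<Sum>i\<in>I. \<Sum>j\<in>J. c i * d j * surface_form \<psi> h (fe (w i)) (fe (z j)))"
proof -
  have "surface_form \<psi> h (fe (\<lambda>\<xi>. \<Sum>i\<in>I. c i * w i \<xi>)) (fe (\<lambda>\<xi>. \<Sum>j\<in>J. d j * z j \<xi>))
    = (\<Sum>k\<in>active_cells \<psi> h. \<Sum>i\<in>I. \<Sum>j\<in>J. c i * d j * segment_form (P k) (Q k) (fe (w i)) (fe (z j)))"
    unfolding surface_form_eq
    by (intro sum.cong refl
        segment_form_sum[OF h crossings_in_cell(1,2) finite_active_nodes cell_vertices_active assms])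
  also have "\<dots> = (\<Sum>i\<in>I. \<Sum>k\<in>active_cells \<psi> h. \<Sum>j\<in>J. c i * d j * segment_form (P k) (Q k) (fe (w i)) (fe (z j)))"
    by (rule sum.swap)
  also have "\<dots> = (\<Sum>i\<in>I. \<Sum>j\<in>J. \<Sum>k\<in>active_cells \<psi> h. c i * d j * segment_form (P k) (Q k) (fe (w i)) (fe (z j)))"
    by (intro sum.cong refl sum.swap)
  also have "\<dots> = (\<Sum>i\<in>I. \<Sum>j\<in>J. c i * d j * surface_form \<psi> h (fe (w i)) (fe (z j)))"
    unfolding surface_form_eq by (simp add: sum_distrib_left)
  finally show ?thesis .
qed

text \<open>A node belongs to at most four cells, which turns the 32 of a single segment into
  128.\<close>

lemma surface_form_upper:
  "surface_form \<psi> h (fe u) (fe u) \<le> 128 / h * (\<Sum>\<xi>\<in>active_nodes \<psi> h. (u \<xi>)\<^sup>2)"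
proof -
  have "surface_form \<psi> h (fe u) (fe u) \<le> (\<Sum>k\<in>active_cells \<psi> h. 32 / h * (\<Sum>\<xi>\<in>cell_vertices k. (u \<xi>)\<^sup>2))"
    unfolding surface_form_eq
    by (intro sum_mono segment_form_upper[OF h crossings_in_cell(1,2) finite_active_nodes cell_vertices_active])
  also have "\<dots> = 32 / h * (\<Sum>k\<in>active_cells \<psi> h. \<Sum>\<xi>\<in>{\<xi> \<in> active_nodes \<psi> h. \<xi> \<in> cell_vertices k}. (u \<xi>)\<^sup>2)"
    unfolding sum_distrib_left
    by (intro sum.cong refl) (use cell_vertices_active in auto)
  also have "(\<Sum>k\<in>active_cells \<psi> h. \<Sum>\<xi>\<in>{\<xi> \<in> active_nodes \<psi> h. \<xi> \<in> cell_vertices k}. (u \<xi>)\<^sup>2)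
    = (\<Sum>\<xi>\<in>active_nodes \<psi> h. \<Sum>k\<in>{k \<in> active_cells \<psi> h. \<xi> \<in> cell_vertices k}. (u \<xi>)\<^sup>2)"
    by (rule sum.swap_restrict[OF finite_active_cells finite_active_nodes])
  also have "\<dots> \<le> (\<Sum>\<xi>\<in>active_nodes \<psi> h. 4 * (u \<xi>)\<^sup>2)"
  proof (rule sum_mono)
    fix \<xi>
    have "{k \<in> active_cells \<psi> h. \<xi> \<in> cell_vertices k} \<subseteq> {\<xi>, \<xi> - (1, 0), \<xi> - (0, 1), \<xi> - (1, 1)}"
      by (auto simp: cell_vertices_def)
    then have "card {k \<in> active_cells \<psi> h. \<xi> \<in> cell_vertices k} \<le> card {\<xi>, \<xi> - (1, 0), \<xi> - (0, 1), \<xi> - (1, 1)}"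
      by (intro card_mono) auto
    also have "\<dots> \<le> 4" by (simp add: card_insert_if)
    finally have "real (card {k \<in> active_cells \<psi> h. \<xi> \<in> cell_vertices k}) \<le> 4" by simp
    then show "(\<Sum>k\<in>{k \<in> active_cells \<psi> h. \<xi> \<in> cell_vertices k}. (u \<xi>)\<^sup>2) \<le> 4 * (u \<xi>)\<^sup>2"
      by (simp add: mult_right_mono)
  qed
  finally show ?thesis using h by (simp add: divide_right_mono sum_distrib_left[symmetric])
qed

text \<open>The form sees only differences of nodal values within cells. The hypothesis is
  restricted to active nodes because only there does a shift of v shift the nodal values.\<close>

lemma surface_form_add_const:
  assumes "\<And>\<xi>. \<xi> \<in> active_nodes \<psi> h \<Longrightarrow> u' \<xi> = u \<xi> - a"
  shows "surface_form \<psi> h (fe u') (fe u') = surface_form \<psi> h (fe u) (fe u)"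
  unfolding surface_form_eq
proof (rule sum.cong[OF refl])
  fix k assume k: "k \<in> active_cells \<psi> h"
  have "u' \<xi> = u \<xi> - a" if "\<xi> \<in> cell_vertices k" for \<xi>
    using that cell_vertices_active[OF k] assms by blast
  then have "u' k = u k - a" "u' (k + (1, 0)) = u (k + (1, 0)) - a" "u' (k + (0, 1)) = u (k + (0, 1)) - a"
    "u' (k + (1, 1)) = u (k + (1, 1)) - a"
    by (simp_all add: cell_vertices_def)
  then have "segment_deriv h k (P k) (Q k) u' t = segment_deriv h k (P k) (Q k) u t" for t
    unfolding segment_deriv_def[OF h crossings_in_cell(1,2)[OF k]] bilinear_deriv_def by simp
  then show "segment_form (P k) (Q k) (fe u') (fe u') = segment_form (P k) (Q k) (fe u) (fe u)"
    unfolding segment_form_fe[OF h crossings_in_cell(1,2)[OF k] finite_active_nodes cell_vertices_active[OF k]]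
    by simp
qed

lemma surface_form_nonneg: "0 \<le> surface_form \<psi> h (fe u) (fe u)"
  unfolding surface_form_eq
  by (intro sum_nonneg segment_form_nonneg[OF h crossings_in_cell(1,2) finite_active_nodes cell_vertices_active])

lemma surface_form_const:
  assumes "\<And>\<xi>. \<xi> \<in> active_nodes \<psi> h \<Longrightarrow> u \<xi> = a"
  shows "surface_form \<psi> h (fe u) (fe u) = 0"
proof -
  have "surface_form \<psi> h (fe (\<lambda>_. 0)) (fe (\<lambda>_. 0)) = surface_form \<psi> h (fe u) (fe u)"
    by (rule surface_form_add_const[of _ _ a]) (simp add: assms)
  moreover have "surface_form \<psi> h (fe (\<lambda>_. 0)) (fe (\<lambda>_. 0)) \<le> 0"
    using surface_form_upper[of "\<lambda>_. 0"] by simp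
  ultimately show ?thesis using surface_form_nonneg[of u] by simp
qed

text \<open>Since u vanishes at x0, its maximum on the polygon is at most the total oscillation, a
  sum over the segments of the root of length times energy. Cauchy-Schwarz bounds the square by
  total length times the form, and integration over the polygon brings in the length once
  more.\<close>

lemma discrete_interface_poincare:
  assumes conn: "connected (discrete_interface \<psi> h)"
    and x0: "x0 \<in> discrete_interface \<psi> h" "fe u x0 = 0"
  shows "surface_integral \<psi> h (\<lambda>x. (fe u x)\<^sup>2) \<le> (48 * \<Lambda>)\<^sup>2 * surface_form \<psi> h (fe u) (fe u)"
    "0 \<le> surface_integral \<psi> h (\<lambda>x. (fe u x)\<^sup>2)"
proof -
  let ?A = "active_cells \<psi> h"
  define len where "len k = norm (Q k - P k)" for k
  define q where "q k = segment_form (P k) (Q k) (fe u) (fe u)" for k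
  have q0: "0 \<le> q k" if "k \<in> ?A" for k
    unfolding q_def using segment_form_nonneg[OF h crossings_in_cell(1,2)[OF that] finite_active_nodes cell_vertices_active[OF that]] .
  have len0: "0 \<le> len k" for k by (simp add: len_def)
  have di: "discrete_interface \<psi> h = (\<Union>k\<in>?A. closed_segment (P k) (Q k))"
    by (simp add: discrete_interface_def P_def Q_def case_prod_beta)
  have seg: "closed_segment p q = (\<lambda>t. p + t *\<^sub>R (q - p)) ` {0..1}" for p q :: plane
    by (auto simp: closed_segment_image_interval algebra_simps)
  have osc: "\<bar>fe u x - fe u y\<bar> \<le> sqrt (len k) * sqrt (q k)"
    if k: "k \<in> ?A" and xy: "x \<in> closed_segment (P k) (Q k)" "y \<in> closed_segment (P k) (Q k)" for k x y
  proof -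
    obtain s t where st: "s \<in> {0..1}" "t \<in> {0..1}" "x = P k + t *\<^sub>R (Q k - P k)" "y = P k + s *\<^sub>R (Q k - P k)"
      using xy unfolding seg by blast
    have "(fe u x - fe u y)\<^sup>2 \<le> len k * q k"
      unfolding st(3,4) len_def q_def
      by (rule segment_oscillation[OF h crossings_in_cell(1,2)[OF k] finite_active_nodes cell_vertices_active[OF k] st(1,2)])
    then show ?thesis by (metis real_sqrt_abs real_sqrt_le_mono real_sqrt_mult)
  qed
  have total: "(\<Sum>k\<in>?A. sqrt (len k) * sqrt (q k))\<^sup>2 \<le> (48 * \<Lambda>) * surface_form \<psi> h (fe u) (fe u)"
  proof -
    have "(\<Sum>k\<in>?A. sqrt (len k) * sqrt (q k))\<^sup>2 \<le> (\<Sum>k\<in>?A. (sqrt (len k))\<^sup>2) * (\<Sum>k\<in>?A. (sqrt (q k))\<^sup>2)"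
      by (rule Cauchy_Schwarz_ineq_sum)
    also have "\<dots> = (\<Sum>k\<in>?A. len k) * (\<Sum>k\<in>?A. q k)" using len0 q0 by simp
    also have "\<dots> \<le> (48 * \<Lambda>) * (\<Sum>k\<in>?A. q k)"
      using discrete_interface_length q0 unfolding len_def by (intro mult_right_mono sum_nonneg) auto
    finally show ?thesis by (simp add: surface_form_eq q_def)
  qed
  define M where "M = (\<Sum>k\<in>?A. sqrt (len k) * sqrt (q k))\<^sup>2"
  have bound: "(fe u x)\<^sup>2 \<le> M" if x: "x \<in> discrete_interface \<psi> h" for x
  proof -
    have "\<bar>fe u x - fe u x0\<bar> \<le> (\<Sum>k\<in>?A. sqrt (len k) * sqrt (q k))"
      by (rule oscillation_connected_Union_le[OF finite_active_cells conn[unfolded di] continuous_fe_function osc])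
         (use len0 q0 x x0 in \<open>auto simp: di\<close>)
    then have "\<bar>fe u x\<bar>\<^sup>2 \<le> M" unfolding M_def using x0(2) by (intro power_mono) auto
    then show ?thesis by simp
  qed
  have si: "0 \<le> segment_integral (P k) (Q k) (\<lambda>x. (fe u x)\<^sup>2) \<and> segment_integral (P k) (Q k) (\<lambda>x. (fe u x)\<^sup>2) \<le> len k * M"
    if k: "k \<in> ?A" for k
    unfolding len_def
  proof (rule segment_integral_le)
    show "continuous_on UNIV (\<lambda>x. (fe u x)\<^sup>2)" by (intro continuous_intros)
    fix t :: real assume "t \<in> {0..1}"
    then have "P k + t *\<^sub>R (Q k - P k) \<in> discrete_interface \<psi> h" unfolding di seg using k by blast
    then show "0 \<le> (fe u (P k + t *\<^sub>R (Q k - P k)))\<^sup>2 \<and> (fe u (P k + t *\<^sub>R (Q k - P k)))\<^sup>2 \<le> M"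
      using bound by simp
  qed
  show "0 \<le> surface_integral \<psi> h (\<lambda>x. (fe u x)\<^sup>2)"
    unfolding surface_integral_eq using si by (intro sum_nonneg) blast
  have "surface_integral \<psi> h (\<lambda>x. (fe u x)\<^sup>2) \<le> (\<Sum>k\<in>?A. len k * M)"
    unfolding surface_integral_eq using si by (intro sum_mono) blast
  also have "\<dots> = (\<Sum>k\<in>?A. len k) * M" by (simp add: sum_distrib_right)
  also have "\<dots> \<le> (48 * \<Lambda>) * ((48 * \<Lambda>) * surface_form \<psi> h (fe u) (fe u))"
    using discrete_interface_length total Lambda_nonneg unfolding len_def M_def by (intro mult_mono) auto
  finally show "surface_integral \<psi> h (\<lambda>x. (fe u x)\<^sup>2) \<le> (48 * \<Lambda>)\<^sup>2 * surface_form \<psi> h (fe u) (fe u)"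
    by (simp add: power2_eq_square)
qed

end

section \<open>The curved setting\<close>

lemma bilinear_diff_const:
  assumes "u' k = u k - c" "u' (k + (1, 0)) = u (k + (1, 0)) - c" "u' (k + (0, 1)) = u (k + (0, 1)) - c"
    "u' (k + (1, 1)) = u (k + (1, 1)) - c"
  shows "bilinear u' k a b = bilinear u k a b - c"
  unfolding bilinear_def assms by (simp add: algebra_simps)

locale extrapolated_mesh = cut_mesh +
  fixes lay :: layer and R :: "node \<Rightarrow> node \<Rightarrow> real" and B :: nat
  assumes inv: "invertible_on (gamma2 \<psi> h) (layer_kernel \<psi> h lay)"
    and extrapolation: "local_extrapolation \<psi> h B R"
begin

definition nodal :: "(node \<Rightarrow> real) \<Rightarrow> node \<Rightarrow> real" where
  "nodal v \<xi> = (\<Sum>j\<in>gamma2 \<psi> h. E_matrix \<psi> h lay R \<xi> j * v j)"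

lemma E_fe_nodal: "E_fe \<psi> h lay R v = fe (nodal v)"
  by (simp add: E_fe_def nodal_def[abs_def])

text \<open>Translates the block matrix into functions: \<open>nodal v\<close> is a discrete
  Dirichlet solution with data v on the first two blocks, extrapolated to the third. The bound on
  \<open>nodal\<close> and its value on constants follow from this alone.\<close>

lemma nodal_extension:
  obtains U where "\<And>x. x \<in> interior_nodes \<psi> h \<Longrightarrow> discrete_laplacian U x = 0"
    "\<And>i. i \<in> gamma2 \<psi> h \<Longrightarrow> U i = v i"
    "\<And>\<xi>. \<xi> \<in> gamma1 \<psi> h \<union> gamma2 \<psi> h \<Longrightarrow> nodal v \<xi> = U \<xi>"
    "\<And>\<eta>. \<eta> \<in> gamma3 \<psi> h \<Longrightarrow> nodal v \<eta> = - (\<Sum>\<xi>\<in>gamma1 \<psi> h \<union> gamma2 \<psi> h. R \<eta> \<xi> * U \<xi>)"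
proof -
  let ?I = "gamma2 \<psi> h"
  obtain U where U: "\<And>x. x \<in> interior_nodes \<psi> h \<Longrightarrow> discrete_laplacian U x = 0"
    "\<And>i. i \<in> ?I \<Longrightarrow> U i = v i"
    "\<And>i. U i = (\<Sum>j\<in>?I. harmonic_map \<psi> h lay i j * v j)"
    by (rule harmonic_map_extension[OF inv, of v]) blast
  show thesis
  proof (rule that[OF U(1,2)])
    fix \<xi> assume \<xi>: "\<xi> \<in> gamma1 \<psi> h \<union> ?I"
    show "nodal v \<xi> = U \<xi>"
    proof (cases "\<xi> \<in> gamma1 \<psi> h")
      case True
      then show ?thesis unfolding nodal_def E_matrix_def U(3)[of \<xi>] by simp
    next
      case False
      then have m: "\<xi> \<in> ?I" using \<xi> by blast
      have "nodal v \<xi> = (\<Sum>j\<in>?I. of_bool (\<xi> = j) * v j)"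
        unfolding nodal_def E_matrix_def using False m by simp
      also have "\<dots> = (\<Sum>j\<in>?I. if \<xi> = j then v j else 0)" by (intro sum.cong) auto
      also have "\<dots> = U \<xi>" using m finite_gammas(2) U(2) by simp
      finally show ?thesis .
    qed
  next
    fix \<eta> assume \<eta>: "\<eta> \<in> gamma3 \<psi> h"
    then have n: "\<eta> \<notin> gamma1 \<psi> h" "\<eta> \<notin> ?I" using gammas_disjoint by blast+
    have "- nodal v \<eta> = (\<Sum>j\<in>?I. J_matrix \<psi> h lay R \<eta> j * v j)"
      unfolding nodal_def E_matrix_def using n by (simp add: sum_negf)
    also have "\<dots> = (\<Sum>j\<in>?I. \<Sum>\<xi>\<in>gamma1 \<psi> h. R \<eta> \<xi> * harmonic_map \<psi> h lay \<xi> j * v j) + (\<Sum>j\<in>?I. R \<eta> j * v j)"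
      by (simp add: J_matrix_def algebra_simps sum.distrib sum_distrib_left)
    also have "(\<Sum>j\<in>?I. \<Sum>\<xi>\<in>gamma1 \<psi> h. R \<eta> \<xi> * harmonic_map \<psi> h lay \<xi> j * v j)
      = (\<Sum>\<xi>\<in>gamma1 \<psi> h. \<Sum>j\<in>?I. R \<eta> \<xi> * harmonic_map \<psi> h lay \<xi> j * v j)" by (rule sum.swap)
    also have "\<dots> = (\<Sum>\<xi>\<in>gamma1 \<psi> h. R \<eta> \<xi> * U \<xi>)"
      unfolding U(3) by (simp add: sum_distrib_left mult.assoc)
    also have "(\<Sum>j\<in>?I. R \<eta> j * v j) = (\<Sum>j\<in>?I. R \<eta> j * U j)"
      using U(2) by simp
    also have "(\<Sum>\<xi>\<in>gamma1 \<psi> h. R \<eta> \<xi> * U \<xi>) + (\<Sum>j\<in>?I. R \<eta> j * U j)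
      = (\<Sum>\<xi>\<in>gamma1 \<psi> h \<union> ?I. R \<eta> \<xi> * U \<xi>)"
      using finite_gammas gammas_disjoint by (intro sum.union_disjoint[symmetric]) auto
    finally show "nodal v \<eta> = - (\<Sum>\<xi>\<in>gamma1 \<psi> h \<union> ?I. R \<eta> \<xi> * U \<xi>)" by simp
  qed
qed

lemma nodal_gamma2:
  assumes "j \<in> gamma2 \<psi> h"
  shows "nodal v j = v j"
proof (rule nodal_extension[of v])
  fix U
  assume "\<And>i. i \<in> gamma2 \<psi> h \<Longrightarrow> U i = v i" "\<And>\<xi>. \<xi> \<in> gamma1 \<psi> h \<union> gamma2 \<psi> h \<Longrightarrow> nodal v \<xi> = U \<xi>"
  then show ?thesis using assms by simp
qed

lemma nodal_bound:
  "(\<Sum>\<xi>\<in>active_nodes \<psi> h. (nodal v \<xi>)\<^sup>2) \<le> 21 * (1 + real (B + 4) ^ 4) * (\<Sum>j\<in>gamma2 \<psi> h. (v j)\<^sup>2)"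
proof -
  let ?\<Gamma> = "gamma1 \<psi> h \<union> gamma2 \<psi> h"
  obtain U where U: "\<And>x. x \<in> interior_nodes \<psi> h \<Longrightarrow> discrete_laplacian U x = 0"
    "\<And>i. i \<in> gamma2 \<psi> h \<Longrightarrow> U i = v i" "\<And>\<xi>. \<xi> \<in> ?\<Gamma> \<Longrightarrow> nodal v \<xi> = U \<xi>"
    "\<And>\<eta>. \<eta> \<in> gamma3 \<psi> h \<Longrightarrow> nodal v \<eta> = - (\<Sum>\<xi>\<in>?\<Gamma>. R \<eta> \<xi> * U \<xi>)"
    using nodal_extension[of v] by blast
  define s where "s = (\<Sum>\<xi>\<in>?\<Gamma>. (U \<xi>)\<^sup>2)"
  have "s = (\<Sum>\<xi>\<in>gamma1 \<psi> h. (U \<xi>)\<^sup>2) + (\<Sum>\<xi>\<in>gamma2 \<psi> h. (U \<xi>)\<^sup>2)"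
    unfolding s_def using finite_gammas gammas_disjoint by (intro sum.union_disjoint) auto
  also have "\<dots> \<le> 20 * (\<Sum>\<xi>\<in>gamma2 \<psi> h. (U \<xi>)\<^sup>2) + (\<Sum>\<xi>\<in>gamma2 \<psi> h. (U \<xi>)\<^sup>2)"
    by (intro add_mono interior_harmonic_bound U(1)) auto
  \<comment> \<open>21 = 20 + 1: the Dirichlet bound on \<open>gamma1\<close> plus the data on
    \<open>gamma2\<close>.\<close>
  also have "\<dots> = 21 * (\<Sum>j\<in>gamma2 \<psi> h. (v j)\<^sup>2)" using U(2) by simp
  finally have s: "s \<le> 21 * (\<Sum>j\<in>gamma2 \<psi> h. (v j)\<^sup>2)" .
  have "(\<Sum>\<xi>\<in>active_nodes \<psi> h. (nodal v \<xi>)\<^sup>2) = (\<Sum>\<xi>\<in>?\<Gamma>. (nodal v \<xi>)\<^sup>2) + (\<Sum>\<eta>\<in>gamma3 \<psi> h. (nodal v \<eta>)\<^sup>2)"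
    unfolding active_nodes_partition using finite_gammas gammas_disjoint by (intro sum.union_disjoint) auto
  also have "(\<Sum>\<xi>\<in>?\<Gamma>. (nodal v \<xi>)\<^sup>2) = s" unfolding s_def using U(3) by (intro sum.cong) auto
  also have "(\<Sum>\<eta>\<in>gamma3 \<psi> h. (nodal v \<eta>)\<^sup>2) = (\<Sum>\<eta>\<in>gamma3 \<psi> h. (\<Sum>\<xi>\<in>?\<Gamma>. R \<eta> \<xi> * U \<xi>)\<^sup>2)"
    using U(4) by simp
  also have "\<dots> \<le> real (B + 4) ^ 4 * s"
    unfolding s_def by (rule extrapolation_bound[OF extrapolation])
  also have "s + real (B + 4) ^ 4 * s = (1 + real (B + 4) ^ 4) * s" by (simp add: algebra_simps)
  also have "\<dots> \<le> (1 + real (B + 4) ^ 4) * (21 * (\<Sum>j\<in>gamma2 \<psi> h. (v j)\<^sup>2))"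
    by (intro mult_left_mono s) simp
  finally show ?thesis by (simp only: mult_ac)
qed

text \<open>U - 1 is harmonic with zero data, so it vanishes on \<open>gamma1\<close>; on
  \<open>gamma3\<close> the row sums -1 of the extrapolation reproduce the constant. This puts the
  constants into the kernel of the form.\<close>

lemma nodal_one:
  assumes \<xi>: "\<xi> \<in> active_nodes \<psi> h"
  shows "nodal (\<lambda>_. 1) \<xi> = 1"
proof -
  let ?\<Gamma> = "gamma1 \<psi> h \<union> gamma2 \<psi> h"
  obtain U where U: "\<And>x. x \<in> interior_nodes \<psi> h \<Longrightarrow> discrete_laplacian U x = 0"
    "\<And>i. i \<in> gamma2 \<psi> h \<Longrightarrow> U i = 1" "\<And>\<xi>. \<xi> \<in> ?\<Gamma> \<Longrightarrow> nodal (\<lambda>_. 1) \<xi> = U \<xi>"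
    "\<And>\<eta>. \<eta> \<in> gamma3 \<psi> h \<Longrightarrow> nodal (\<lambda>_. 1) \<eta> = - (\<Sum>\<xi>\<in>?\<Gamma>. R \<eta> \<xi> * U \<xi>)"
    using nodal_extension[of "\<lambda>_. 1"] by blast
  have "discrete_laplacian (\<lambda>x. U x - 1) x = 0" if "x \<in> interior_nodes \<psi> h" for x
    using U(1)[OF that] by (simp add: discrete_laplacian_def sum_axis_directions)
  then have "(\<Sum>x\<in>gamma1 \<psi> h. (U x - 1)\<^sup>2) \<le> 20 * (\<Sum>x\<in>gamma2 \<psi> h. (U x - 1)\<^sup>2)"
    by (rule interior_harmonic_bound)
  also have "\<dots> = 0" using U(2) by simp
  finally have "(\<Sum>x\<in>gamma1 \<psi> h. (U x - 1)\<^sup>2) = 0" by (simp add: order_antisym sum_nonneg)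
  then have "\<forall>x\<in>gamma1 \<psi> h. (U x - 1)\<^sup>2 = 0"
    using finite_gammas(1) by (subst (asm) sum_nonneg_eq_0_iff) auto
  then have U1: "U x = 1" if "x \<in> ?\<Gamma>" for x using that U(2)[of x] by auto
  show ?thesis
  proof (cases "\<xi> \<in> ?\<Gamma>")
    case True
    then show ?thesis using U(3) U1 by simp
  next
    case False
    then have g3: "\<xi> \<in> gamma3 \<psi> h" using \<xi> active_nodes_partition by blast
    have "(\<Sum>\<zeta>\<in>?\<Gamma>. R \<xi> \<zeta> * U \<zeta>) = (\<Sum>\<zeta>\<in>?\<Gamma>. R \<xi> \<zeta>)" using U1 by (intro sum.cong) auto
    also have "\<dots> = -1" using local_extrapolation_row[OF extrapolation g3] by blast
    finally show ?thesis using U(4)[OF g3] by simp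
  qed
qed

lemma nodal_shift: "\<xi> \<in> active_nodes \<psi> h \<Longrightarrow> nodal (\<lambda>j. v j - a) \<xi> = nodal v \<xi> - a"
  using nodal_one[of \<xi>]
  by (simp add: nodal_def sum_subtractf right_diff_distrib sum_distrib_right[symmetric])

lemma fe_cong: "(\<And>\<xi>. \<xi> \<in> active_nodes \<psi> h \<Longrightarrow> u \<xi> = w \<xi>) \<Longrightarrow> fe u = fe w"
  by (simp add: fe_function_def fun_eq_iff)

text \<open>\<open>tangential_gradient\<close> is built on \<open>deriv\<close>, which is additive
  only where derivatives exist. The hat functions are therefore rewritten as finite element
  functions, for which \<open>surface_form_sum\<close> provides bilinearity.\<close>

lemma K_reduced_surface_form:
  "K_reduced \<psi> h lay R i j
    = surface_form \<psi> h (fe (\<lambda>\<xi>. E_matrix \<psi> h lay R \<xi> i)) (fe (\<lambda>\<xi>. E_matrix \<psi> h lay R \<xi> j))"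
proof -
  let ?N = "active_nodes \<psi> h"
  have hat: "hat_basis h \<xi> = fe (\<lambda>\<zeta>. of_bool (\<zeta> = \<xi>))" if "\<xi> \<in> ?N" for \<xi>
  proof
    fix x
    have "fe (\<lambda>\<zeta>. of_bool (\<zeta> = \<xi>)) x = (\<Sum>\<zeta>\<in>?N. if \<zeta> = \<xi> then hat_basis h \<zeta> x else 0)"
      unfolding fe_function_def by (intro sum.cong) auto
    then show "hat_basis h \<xi> x = fe (\<lambda>\<zeta>. of_bool (\<zeta> = \<xi>)) x" using that finite_active_nodes by simp
  qed
  have expand: "fe u = fe (\<lambda>\<zeta>. \<Sum>\<xi>\<in>?N. u \<xi> * of_bool (\<zeta> = \<xi>))" for u
  proof (rule fe_cong)
    fix \<zeta> assume "\<zeta> \<in> ?N"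
    moreover have "(\<Sum>\<xi>\<in>?N. u \<xi> * of_bool (\<zeta> = \<xi>)) = (\<Sum>\<xi>\<in>?N. if \<zeta> = \<xi> then u \<xi> else 0)"
      by (intro sum.cong) auto
    ultimately show "u \<zeta> = (\<Sum>\<xi>\<in>?N. u \<xi> * of_bool (\<zeta> = \<xi>))" using finite_active_nodes by simp
  qed
  have "K_reduced \<psi> h lay R i j = (\<Sum>\<xi>\<in>?N. \<Sum>\<eta>\<in>?N. E_matrix \<psi> h lay R \<xi> i * E_matrix \<psi> h lay R \<eta> j *
      surface_form \<psi> h (fe (\<lambda>\<zeta>. of_bool (\<zeta> = \<xi>))) (fe (\<lambda>\<zeta>. of_bool (\<zeta> = \<eta>))))"
    unfolding K_reduced_def by (intro sum.cong refl) (simp add: hat mult_ac)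
  also have "\<dots> = surface_form \<psi> h (fe (\<lambda>\<zeta>. \<Sum>\<xi>\<in>?N. E_matrix \<psi> h lay R \<xi> i * of_bool (\<zeta> = \<xi>)))
      (fe (\<lambda>\<zeta>. \<Sum>\<xi>\<in>?N. E_matrix \<psi> h lay R \<xi> j * of_bool (\<zeta> = \<xi>)))"
    by (rule surface_form_sum[OF finite_active_nodes finite_active_nodes, symmetric])
  finally show ?thesis unfolding expand[symmetric] .
qed

lemma K_reduced_form:
  "symmetric_with_form (gamma2 \<psi> h) (K_reduced \<psi> h lay R)
     (\<lambda>v. surface_form \<psi> h (E_fe \<psi> h lay R v) (E_fe \<psi> h lay R v))"
  unfolding symmetric_with_form_def
proof (intro conjI ballI allI)
  show "K_reduced \<psi> h lay R i j = K_reduced \<psi> h lay R j i" for i j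
    unfolding K_reduced_surface_form by (rule surface_form_commute)
  fix v
  have "nodal v = (\<lambda>\<xi>. \<Sum>j\<in>gamma2 \<psi> h. v j * E_matrix \<psi> h lay R \<xi> j)"
    by (simp add: nodal_def[abs_def] mult.commute)
  then have "surface_form \<psi> h (E_fe \<psi> h lay R v) (E_fe \<psi> h lay R v)
    = (\<Sum>i\<in>gamma2 \<psi> h. \<Sum>j\<in>gamma2 \<psi> h. v i * v j * K_reduced \<psi> h lay R i j)"
    unfolding E_fe_nodal K_reduced_surface_form
    by (simp only: surface_form_sum[OF finite_gammas(2) finite_gammas(2)])
  then show "(\<Sum>i\<in>gamma2 \<psi> h. \<Sum>j\<in>gamma2 \<psi> h. v i * K_reduced \<psi> h lay R i j * v j)
    = surface_form \<psi> h (E_fe \<psi> h lay R v) (E_fe \<psi> h lay R v)"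
    by (simp add: mult_ac)
qed

theorem K_reduced_spectral_bounds:
  assumes conn: "connected (discrete_interface \<psi> h)" and trace: "trace_estimate \<psi> h lay R Ctr"
    and c: "c = 1 / (36 * max Ctr 1 * (48 * (\<Lambda> + 1))\<^sup>2)"
    and C: "C = 128 * (21 * (1 + real (B + 4) ^ 4))"
  shows "spectral_bounds (gamma2 \<psi> h) (K_reduced \<psi> h lay R) h c C (C / c)"
proof -
  let ?q = "\<lambda>v. surface_form \<psi> h (E_fe \<psi> h lay R v) (E_fe \<psi> h lay R v)"
  let ?I = "gamma2 \<psi> h"
  \<comment> \<open>\<open>max Ctr 1\<close> and \<Lambda> + 1 keep the constant positive even for
    degenerate Ctr and \<Lambda>. In c, 36 is the mass bound and the square is the Poincare
    constant; C is the 128 of the form times the nodal bound.\<close>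
  have c0: "c > 0" unfolding c using Lambda_nonneg by simp
  have C0: "C > 0" unfolding C by (simp add: add_pos_nonneg)
  have upper: "?q v \<le> C / h * (\<Sum>i\<in>?I. (v i)\<^sup>2)" for v
  proof -
    have "?q v \<le> 128 / h * (\<Sum>\<xi>\<in>active_nodes \<psi> h. (nodal v \<xi>)\<^sup>2)"
      unfolding E_fe_nodal by (rule surface_form_upper)
    also have "\<dots> \<le> 128 / h * (21 * (1 + real (B + 4) ^ 4) * (\<Sum>j\<in>?I. (v j)\<^sup>2))"
      using h by (intro mult_left_mono nodal_bound) simp
    also have "\<dots> = C / h * (\<Sum>j\<in>?I. (v j)\<^sup>2)"
      unfolding C by (simp only: times_divide_eq_left mult.assoc)
    finally show ?thesis .
  qed
  have lower: "\<exists>a. c * h * (\<Sum>i\<in>?I. (v i - a)\<^sup>2) \<le> ?q v" for v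
  proof -
    obtain k where k: "k \<in> active_cells \<psi> h"
    proof -
      have "gamma2 \<psi> h \<noteq> {}" using gamma2_ge_2 by auto
      then show thesis using that by (auto simp: gamma2_def active_nodes_def)
    qed
    define x0 where "x0 = P k"
    have x0: "x0 \<in> discrete_interface \<psi> h"
      unfolding discrete_interface_def x0_def P_def using k by (auto simp: case_prod_beta)
    \<comment> \<open>The value at a crossing point is subtracted because that point lies in a known
      active cell, where the finite element function is an explicit bilinear one.\<close>
    define a where "a = fe (nodal v) x0"
    define w where "w = (\<lambda>j. v j - a)"
    have w: "nodal w \<xi> = nodal v \<xi> - a" if "\<xi> \<in> active_nodes \<psi> h" for \<xi>
      unfolding w_def by (rule nodal_shift[OF that])
    have "x0 \<in> cell h k" unfolding x0_def by (rule crossings_in_cell(1)[OF k])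
    note cellk = fe_function_cell[OF h this finite_active_nodes cell_vertices_active[OF k]]
    have v4: "k \<in> active_nodes \<psi> h" "k + (1, 0) \<in> active_nodes \<psi> h" "k + (0, 1) \<in> active_nodes \<psi> h"
      "k + (1, 1) \<in> active_nodes \<psi> h"
      using cell_vertices_active[OF k] by (auto simp: cell_vertices_def)
    have "fe (nodal w) x0 = fe (nodal v) x0 - a"
      unfolding cellk by (rule bilinear_diff_const) (rule w, rule v4)+
    then have z: "fe (nodal w) x0 = 0" by (simp add: a_def)
    note poincare = discrete_interface_poincare[OF conn x0 z]
    have qw: "surface_form \<psi> h (fe (nodal w)) (fe (nodal w)) = ?q v"
      unfolding E_fe_nodal by (rule surface_form_add_const[of _ _ a]) (rule w)
    have q0: "0 \<le> ?q v" unfolding E_fe_nodal by (rule surface_form_nonneg)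
    define m where "m = max Ctr 1"
    have m: "m \<ge> 1" "Ctr \<le> m" by (auto simp: m_def)
    let ?s = "surface_integral \<psi> h (\<lambda>x. (fe (nodal w) x)\<^sup>2)"
    have "h\<^sup>2 / 36 * (\<Sum>j\<in>?I. (w j)\<^sup>2) \<le> h\<^sup>2 / 36 * (\<Sum>\<xi>\<in>active_nodes \<psi> h. (nodal w \<xi>)\<^sup>2)"
    proof (rule mult_left_mono)
      have "(\<Sum>j\<in>?I. (w j)\<^sup>2) = (\<Sum>j\<in>?I. (nodal w j)\<^sup>2)" by (simp add: nodal_gamma2)
      also have "\<dots> \<le> (\<Sum>\<xi>\<in>active_nodes \<psi> h. (nodal w \<xi>)\<^sup>2)"
        using finite_active_nodes active_nodes_partition by (intro sum_mono2) auto
      finally show "(\<Sum>j\<in>?I. (w j)\<^sup>2) \<le> (\<Sum>\<xi>\<in>active_nodes \<psi> h. (nodal w \<xi>)\<^sup>2)" .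
    qed simp
    also have "\<dots> \<le> (LINT x:active_band \<psi> h|lborel. (fe (nodal w) x)\<^sup>2)"
      unfolding active_band_def by (rule cells_mass_lower[OF h finite_active_cells active_nodes_def])
    also have "\<dots> \<le> Ctr * h * ?s"
      using trace unfolding trace_estimate_def E_fe_nodal by blast
    also have "\<dots> \<le> m * h * ?s" using m h poincare(2) by (intro mult_right_mono) auto
    also have "\<dots> \<le> m * h * ((48 * \<Lambda>)\<^sup>2 * ?q v)"
      using m h poincare(1) unfolding qw by (intro mult_left_mono) auto
    also have "\<dots> \<le> m * h * ((48 * (\<Lambda> + 1))\<^sup>2 * ?q v)"
      using m h q0 Lambda_nonneg by (intro mult_left_mono mult_right_mono power_mono) auto
    \<comment> \<open>The mass bound has h^2 and the trace estimate h, so one factor h cancels and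
      one stays: the h of the lower bound.\<close>
    finally have "h * (h * (\<Sum>j\<in>?I. (w j)\<^sup>2)) \<le> h * (36 * m * (48 * (\<Lambda> + 1))\<^sup>2 * ?q v)"
      by (simp add: power2_eq_square mult_ac)
    then have "h * (\<Sum>j\<in>?I. (w j)\<^sup>2) \<le> 36 * m * (48 * (\<Lambda> + 1))\<^sup>2 * ?q v"
      using h by simp
    moreover have "36 * m * (48 * (\<Lambda> + 1))\<^sup>2 > 0" using m Lambda_nonneg by simp
    ultimately have "1 / (36 * m * (48 * (\<Lambda> + 1))\<^sup>2) * (h * (\<Sum>j\<in>?I. (w j)\<^sup>2)) \<le> ?q v"
      by (simp add: pos_divide_le_eq mult.commute)
    then show ?thesis unfolding c m_def[symmetric] w_def by (intro exI[of _ a]) (simp add: mult.assoc)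
  qed
  have const: "?q (\<lambda>_. 1) = 0"
    unfolding E_fe_nodal by (rule surface_form_const[of _ 1]) (rule nodal_one)
  show ?thesis
    by (rule spectral_boundsI[OF finite_gammas(2) gamma2_ge_2 h c0 C0 K_reduced_form upper lower const])
qed

end

section \<open>The moved curve as an instance of the abstract mesh\<close>

lemma smooth_closed_curve_lipschitz:
  assumes "smooth_closed_curve g"
  shows "\<exists>\<Lambda>. \<forall>s\<in>{0..1}. \<forall>t\<in>{0..1}. norm (g s - g t) \<le> \<Lambda> * \<bar>s - t\<bar>"
proof -
  obtain D where D: "D 0 = g" "\<And>n t. (D n has_vector_derivative D (Suc n) t) (at t)"
    using assms unfolding smooth_closed_curve_def by metis
  have "continuous_on {0..1} (D 1)"
    using D(2)[of 1] by (meson continuous_at_imp_continuous_on has_vector_derivative_continuous)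
  then have "bounded (D 1 ` {0..1})" by (intro compact_imp_bounded compact_continuous_image) auto
  then obtain \<Lambda> where \<Lambda>: "\<And>t. t \<in> {0..1} \<Longrightarrow> norm (D 1 t) \<le> \<Lambda>" unfolding bounded_iff by blast
  have main: "norm (g t - g s) \<le> \<Lambda> * (t - s)" if st: "s \<in> {0..1}" "t \<in> {0..1}" "s < t" for s t
  proof -
    have der: "(g has_vector_derivative D 1 r) (at r)" for r using D(2)[of 0 r] D(1) by simp
    have "continuous_on {s..t} g"
      using der by (meson continuous_at_imp_continuous_on has_vector_derivative_continuous)
    then obtain r where r: "r \<in> {s<..<t}" "norm (g t - g s) \<le> norm ((t - s) *\<^sub>R D 1 r)"
      using mvt_general[of s t g "\<lambda>r x. x *\<^sub>R D 1 r"] st(3) der unfolding has_vector_derivative_def by blast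
    have "norm ((t - s) *\<^sub>R D 1 r) = (t - s) * norm (D 1 r)" using st by simp
    also have "\<dots> \<le> (t - s) * \<Lambda>" using st r \<Lambda>[of r] by (intro mult_left_mono) auto
    finally show ?thesis using r(2) by (simp add: mult.commute)
  qed
  have "norm (g s - g t) \<le> \<Lambda> * \<bar>s - t\<bar>" if "s \<in> {0..1}" "t \<in> {0..1}" for s t
    using main[of s t] main[of t s] that
    by (cases s t rule: linorder_cases) (auto simp: norm_minus_commute)
  then show ?thesis by blast
qed

text \<open>\<Lambda> belongs to the unmoved curve and survives because the linear part of T
  preserves norms. This is where independence of the cut position comes from.\<close>

lemma cut_mesh_rigid_motion:
  assumes dom: "smooth_domain \<Omega> g" and lev: "level_set_function \<Omega> \<psi>"
    and lip: "\<And>s t. s \<in> {0..1} \<Longrightarrow> t \<in> {0..1} \<Longrightarrow> norm (g s - g t) \<le> \<Lambda> * \<bar>s - t\<bar>"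
    and T: "rigid_motion T" and h: "h > 0" and geom: "active_grid_geometry (\<psi> \<circ> inv T) h (T \<circ> g)"
  shows "cut_mesh (\<psi> \<circ> inv T) h (T \<circ> g) \<Lambda>"
proof
  obtain A a where A: "orthogonal_transformation A" "T = (\<lambda>x. a + A x)"
    using T unfolding rigid_motion_def by blast
  have linA: "linear A" using A(1) by (rule orthogonal_transformation_linear)
  have bijA: "bij A" using A(1) by (rule orthogonal_transformation_bij)
  have bijT: "bij T"
  proof (rule bijI)
    show "inj T" using bij_is_inj[OF bijA] by (auto simp: A(2) inj_on_def)
    show "surj T"
    proof (rule surjI[of _ "\<lambda>y. inv A (y - a)"])
      show "T (inv A (y - a)) = y" for y using bijA by (simp add: A(2) bij_is_surj surj_f_inv_f)
    qed
  qed
  have invT: "inv T = (\<lambda>y. inv A (y - a))"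
    using bijT bijA by (intro inv_equality) (auto simp: A(2) bij_is_surj surj_f_inv_f bij_is_inj)
  have "linear (inv A)" using A(1) by (intro orthogonal_transformation_linear orthogonal_transformation_inv)
  then have "continuous_on UNIV (inv A)" by (simp add: linear_continuous_on linear_conv_bounded_linear)
  then have contI: "continuous_on S (inv T)" for S
    unfolding invT
    by (rule continuous_on_compose2[OF _ continuous_on_diff[OF continuous_on_id continuous_on_const] subset_UNIV])
  have fr: "frontier \<Omega> = {x. \<psi> x = 0}" using lev unfolding level_set_function_def by (elim conjE)
  have zero: "\<psi> x = 0 \<longleftrightarrow> x \<in> frontier \<Omega>" for x by (simp add: fr)
  have neg: "\<psi> x < 0" if "x \<in> \<Omega>" for x using lev that unfolding level_set_function_def by blast
  have pos: "\<psi> x > 0" if "x \<notin> closure \<Omega>" for x using lev that unfolding level_set_function_def by blast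
  show "h > 0" by (rule h)
  show "active_grid_geometry (\<psi> \<circ> inv T) h (T \<circ> g)" by (rule geom)
  show "interface (\<psi> \<circ> inv T) = range (T \<circ> g)"
  proof -
    have "interface (\<psi> \<circ> inv T) = {x. inv T x \<in> range g}"
      unfolding interface_def using dom by (simp add: zero smooth_domain_def)
    also have "\<dots> = inv T -` range g" by auto
    also have "\<dots> = inv (inv T) ` range g" by (rule bij_vimage_eq_inv_image[OF bij_imp_bij_inv[OF bijT]])
    also have "\<dots> = range (T \<circ> g)" using bijT by (simp add: inv_inv_eq image_comp)
    finally show ?thesis .
  qed
  have per: "g (t + 1) = g t" and inj: "inj_on g {0..<1}" for t
    using dom unfolding smooth_domain_def smooth_closed_curve_def by auto
  show "(T \<circ> g) (t + 1) = (T \<circ> g) t" for t using per by simp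
  show "inj_on (T \<circ> g) {0..<1}" using inj bij_is_inj[OF bijT] by (intro comp_inj_on) (auto intro: inj_on_subset)
  show "norm ((T \<circ> g) s - (T \<circ> g) t) \<le> \<Lambda> * \<bar>s - t\<bar>" if "s \<in> {0..1}" "t \<in> {0..1}" for s t
  proof -
    have "(T \<circ> g) s - (T \<circ> g) t = A (g s - g t)" using linA by (simp add: A(2) linear_diff)
    then show ?thesis using lip[OF that] orthogonal_transformation_norm[OF A(1)] by simp
  qed
  show "((T \<circ> g) has_vector_derivative vector_derivative (T \<circ> g) (at t)) (at t)" for t
  proof -
    obtain D where D: "D 0 = g" "\<And>n t. (D n has_vector_derivative D (Suc n) t) (at t)"
      using dom unfolding smooth_domain_def smooth_closed_curve_def by metis
    have "(g has_vector_derivative D 1 t) (at t)" using D(2)[of 0 t] D(1) by simp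
    moreover have "bounded_linear A" using linA by (simp add: linear_conv_bounded_linear)
    ultimately have "((\<lambda>t. A (g t)) has_vector_derivative A (D 1 t)) (at t)"
      by (rule bounded_linear.has_vector_derivative[rotated])
    from has_vector_derivative_add[OF has_vector_derivative_const this]
    have "((\<lambda>t. a + A (g t)) has_vector_derivative A (D 1 t)) (at t)" by (simp only: add_0)
    moreover have "T \<circ> g = (\<lambda>t. a + A (g t))" by (simp add: A(2) fun_eq_iff)
    ultimately have der: "(T \<circ> g has_vector_derivative A (D 1 t)) (at t)" by (simp only:)
    show ?thesis unfolding vector_derivative_at[OF der] by (rule der)
  qed
  fix S :: "plane set" assume S: "connected S" "S \<inter> interface (\<psi> \<circ> inv T) = {}"
  \<comment> \<open>Pulled back to the fixed domain, a connected set that misses the frontier lies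
    either in \<Omega> or outside its closure.\<close>
  let ?S = "inv T ` S"
  have cS: "connected ?S" using contI S(1) by (rule connected_continuous_image)
  have disj: "?S \<inter> frontier \<Omega> = {}" unfolding fr using S(2) by (fastforce simp: interface_def)
  show "(\<forall>x\<in>S. (\<psi> \<circ> inv T) x < 0) \<or> (\<forall>x\<in>S. (\<psi> \<circ> inv T) x > 0)"
  proof (cases "?S \<inter> \<Omega> = {}")
    case True
    have "\<psi> y > 0" if y: "y \<in> ?S" for y
    proof -
      have "y \<notin> \<Omega>" "y \<notin> frontier \<Omega>" using True disj y by blast+
      then have "y \<notin> closure \<Omega>" by (simp add: closure_Un_frontier)
      then show ?thesis by (rule pos)
    qed
    then show ?thesis by simp
  next
    case False
    have sub: "?S - \<Omega> = {}"
    proof (rule ccontr)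
      assume "?S - \<Omega> \<noteq> {}"
      from connected_Int_frontier[OF cS False this] disj show False by contradiction
    qed
    have "\<psi> y < 0" if y: "y \<in> ?S" for y
    proof -
      have "y \<in> \<Omega>" using sub y by blast
      then show ?thesis by (rule neg)
    qed
    then show ?thesis by simp
  qed
qed

section \<open>Harmonic functions on a periodic strip\<close>

lemma periodic_mod:
  assumes "\<And>m. f (m + int M) = f m"
  shows "f (m mod int M) = f m"
proof -
  have nat: "f (m + int n * int M) = f m" for m n
  proof (induction n)
    case (Suc n)
    have "f (m + int (Suc n) * int M) = f ((m + int n * int M) + int M)" by (simp add: algebra_simps)
    then show ?case using Suc assms by simp
  qed simp
  have all: "f (m + k * int M) = f m" for m k
  proof (cases "k \<ge> 0")
    case True
    then show ?thesis using nat[of m "nat k"] by simp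
  next
    case False
    then show ?thesis using nat[of "m + k * int M" "nat (- k)"] by simp
  qed
  have "m mod int M = m + (- (m div int M)) * int M" by (simp add: minus_div_mult_eq_mod[symmetric])
  then show ?thesis using all by metis
qed

lemma sum_periodic_shift:
  fixes f :: "int \<Rightarrow> real"
  assumes per: "\<And>m. f (m + int M) = f m"
  shows "(\<Sum>m\<in>{0..<int M}. f (m + 1)) = (\<Sum>m\<in>{0..<int M}. f m)"
proof (cases "M = 0")
  case False
  have "(\<Sum>m\<in>{0..<int M}. f (m + 1)) = (\<Sum>m\<in>{1..<int M + 1}. f m)"
    by (rule sum.reindex_bij_witness[of _ "\<lambda>m. m - 1" "\<lambda>m. m + 1"]) auto
  also have "{1..<int M + 1} = insert (int M) {1..<int M}" using False by auto
  also have "(\<Sum>m\<in>insert (int M) {1..<int M}. f m) = f (0 + int M) + (\<Sum>m\<in>{1..<int M}. f m)" by simp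
  also have "\<dots> = f 0 + (\<Sum>m\<in>{1..<int M}. f m)" by (simp only: per)
  also have "\<dots> = (\<Sum>m\<in>insert 0 {1..<int M}. f m)" by simp
  also have "insert 0 {1..<int M} = {0..<int M}" using False by auto
  finally show ?thesis .
qed simp

lemma sum_periodic_shift_back:
  fixes f :: "int \<Rightarrow> real"
  assumes per: "\<And>m. f (m + int M) = f m"
  shows "(\<Sum>m\<in>{0..<int M}. f (m - 1)) = (\<Sum>m\<in>{0..<int M}. f m)"
  using sum_periodic_shift[of "\<lambda>m. f (m - 1)" M] per[of "_ - 1"] by (simp add: algebra_simps)

text \<open>By convexity a single positive increment persists and forces linear growth, against the
  upper bound.\<close>

lemma convex_bounded_antimono:
  fixes f :: "nat \<Rightarrow> real"
  assumes conv: "\<And>j. 2 * f (Suc j) \<le> f (Suc (Suc j)) + f j" and bd: "\<And>j. f j \<le> b"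
  shows "f (Suc j) \<le> f j"
proof (rule ccontr)
  define d where "d = f (Suc j) - f j"
  assume "\<not> ?thesis"
  then have d: "d > 0" by (simp add: d_def)
  have step: "d \<le> f (Suc (j + n)) - f (j + n)" for n
  proof (induction n)
    case (Suc n)
    then show ?case using conv[of "j + n"] by simp
  qed (simp add: d_def)
  have lin: "f j + real n * d \<le> f (j + n)" for n
  proof (induction n)
    case (Suc n)
    then show ?case using step[of n] by (simp add: algebra_simps)
  qed simp
  obtain n where "(b - f j) / d < real n" using reals_Archimedean2 by blast
  then have "b < f j + real n * d" using d by (simp add: divide_less_eq)
  then show False using lin[of n] bd[of "j + n"] by linarith
qed

locale strip_harmonic =
  fixes M :: nat and U :: "nat \<Rightarrow> int \<Rightarrow> real"
  assumes per: "\<And>j m. U j (m + int M) = U j m"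
    and bdd: "\<exists>b. \<forall>j m. \<bar>U j m\<bar> \<le> b"
    and five_point: "\<And>j m. U (Suc (Suc j)) m + U j m + U (Suc j) (m + 1) + U (Suc j) (m - 1) = 4 * U (Suc j) m"
begin

abbreviation (input) "Z \<equiv> {0..<int M}"

definition energy :: "nat \<Rightarrow> real" where "energy j = (\<Sum>m\<in>Z. (U j m)\<^sup>2)"

lemma energy_nonneg: "0 \<le> energy j"
  by (simp add: energy_def sum_nonneg)

lemma energy_bounded: "\<exists>b. \<forall>j. energy j \<le> b"
proof -
  obtain b where b: "\<And>j m. \<bar>U j m\<bar> \<le> b" using bdd by blast
  have "energy j \<le> (\<Sum>m\<in>Z. b\<^sup>2)" for j
    unfolding energy_def
  proof (rule sum_mono)
    fix m
    have "\<bar>U j m\<bar>\<^sup>2 \<le> b\<^sup>2" using b by (intro power_mono) auto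
    then show "(U j m)\<^sup>2 \<le> b\<^sup>2" by simp
  qed
  then show ?thesis by blast
qed

lemma shifted_energy: "(\<Sum>m\<in>Z. (U j (m + 1))\<^sup>2) = energy j" "(\<Sum>m\<in>Z. (U j (m - 1))\<^sup>2) = energy j"
proof -
  have p: "(U j (m + int M))\<^sup>2 = (U j m)\<^sup>2" for m by (simp add: per)
  show "(\<Sum>m\<in>Z. (U j (m + 1))\<^sup>2) = energy j"
    unfolding energy_def by (rule sum_periodic_shift[of "\<lambda>m. (U j m)\<^sup>2", OF p])
  show "(\<Sum>m\<in>Z. (U j (m - 1))\<^sup>2) = energy j"
    unfolding energy_def by (rule sum_periodic_shift_back[of "\<lambda>m. (U j m)\<^sup>2", OF p])
qed

lemma dirichlet_by_parts:
  "(\<Sum>m\<in>Z. U j m * (2 * U j m - U j (m + 1) - U j (m - 1))) = (\<Sum>m\<in>Z. (U j (m + 1) - U j m)\<^sup>2)"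
proof -
  have p: "U j (m + int M + 1) * U j (m + int M) = U j (m + 1) * U j m" for m
    using per[of j "m + 1"] per[of j m] by (simp add: algebra_simps)
  have "(\<Sum>m\<in>Z. U j m * U j (m - 1)) = (\<Sum>m\<in>Z. U j (m + 1) * U j m)"
    using sum_periodic_shift_back[of "\<lambda>m. U j (m + 1) * U j m", OF p] by simp
  then show ?thesis
    using shifted_energy(1)[of j, unfolded energy_def]
    by (simp add: power2_eq_square algebra_simps sum.distrib sum_subtractf sum_distrib_left[symmetric])
qed

text \<open>The second difference across layers is minus the tangential one; paired with the middle
  layer, it becomes a sum of squares by \<open>dirichlet_by_parts\<close>.\<close>

lemma layer_identity: "U (Suc (Suc j)) m + U j m - 2 * U (Suc j) m
    = 2 * U (Suc j) m - U (Suc j) (m + 1) - U (Suc j) (m - 1)"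
  using five_point[of j m] by linarith

text \<open>The layer energies form a convex bounded sequence.\<close>

lemma energy_antimono: "energy (Suc j) \<le> energy j"
proof -
  have "2 * energy (Suc j) \<le> energy (Suc (Suc j)) + energy j" for j
  proof -
    have id: "(U (Suc (Suc j)) m)\<^sup>2 + (U j m)\<^sup>2 - 2 * (U (Suc j) m)\<^sup>2
      = (U (Suc (Suc j)) m - U (Suc j) m)\<^sup>2 + (U (Suc j) m - U j m)\<^sup>2
        + 2 * (U (Suc j) m * (U (Suc (Suc j)) m + U j m - 2 * U (Suc j) m))" for m
      by (simp add: power2_eq_square algebra_simps)
    have "energy (Suc (Suc j)) + energy j - 2 * energy (Suc j)
      = (\<Sum>m\<in>Z. (U (Suc (Suc j)) m)\<^sup>2 + (U j m)\<^sup>2 - 2 * (U (Suc j) m)\<^sup>2)"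
      by (simp add: energy_def sum.distrib sum_subtractf sum_distrib_left)
    also have "\<dots> = (\<Sum>m\<in>Z. (U (Suc (Suc j)) m - U (Suc j) m)\<^sup>2) + (\<Sum>m\<in>Z. (U (Suc j) m - U j m)\<^sup>2)
        + 2 * (\<Sum>m\<in>Z. U (Suc j) m * (2 * U (Suc j) m - U (Suc j) (m + 1) - U (Suc j) (m - 1)))"
      unfolding id layer_identity by (simp only: sum.distrib sum_distrib_left)
    also have "\<dots> \<ge> 0"
      unfolding dirichlet_by_parts by (intro add_nonneg_nonneg mult_nonneg_nonneg sum_nonneg) auto
    finally show ?thesis by simp
  qed
  moreover obtain b where "\<And>j. energy j \<le> b" using energy_bounded by blast
  ultimately show ?thesis by (rule convex_bounded_antimono)
qed

lemma energy_le_initial: "energy j \<le> energy 0"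
  by (rule lift_Suc_antimono_le[of energy]) (auto intro: energy_antimono)

text \<open>Solve the five-point equation for layer j. Cauchy-Schwarz with weights 4, 1, 1, 1 costs
  7, and the energies on the right, again weighted 4 + 1 + 1 + 1, are bounded by that of layer j +
  1: 7 * 7 = 49.\<close>

lemma energy_step_lower: "energy j \<le> 49 * energy (Suc j)"
proof -
  have cs: "(4 * a - b - c - d)\<^sup>2 \<le> 7 * (4 * a\<^sup>2 + b\<^sup>2 + c\<^sup>2 + d\<^sup>2)" for a b c d :: real
  proof -
    have "7 * (4 * a\<^sup>2 + b\<^sup>2 + c\<^sup>2 + d\<^sup>2) - (4 * a - b - c - d)\<^sup>2
      = 4 * (a + b)\<^sup>2 + 4 * (a + c)\<^sup>2 + 4 * (a + d)\<^sup>2 + (b - c)\<^sup>2 + (b - d)\<^sup>2 + (c - d)\<^sup>2"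
      by (simp add: power2_eq_square algebra_simps)
    moreover have "0 \<le> 4 * (a + b)\<^sup>2 + 4 * (a + c)\<^sup>2 + 4 * (a + d)\<^sup>2 + (b - c)\<^sup>2 + (b - d)\<^sup>2 + (c - d)\<^sup>2"
      by simp
    ultimately show ?thesis by linarith
  qed
  let ?V = "U (Suc j)"
  have "U j m = 4 * ?V m - ?V (m + 1) - ?V (m - 1) - U (Suc (Suc j)) m" for m
    using five_point[of j m] by linarith
  then have "energy j \<le> (\<Sum>m\<in>Z. 7 * (4 * (?V m)\<^sup>2 + (?V (m + 1))\<^sup>2 + (?V (m - 1))\<^sup>2 + (U (Suc (Suc j)) m)\<^sup>2))"
    unfolding energy_def by (intro sum_mono) (simp only: cs)
  also have "\<dots> = 7 * (4 * energy (Suc j) + energy (Suc j) + energy (Suc j) + energy (Suc (Suc j)))"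
    unfolding sum_distrib_left[symmetric] sum.distrib shifted_energy by (simp only: energy_def)
  also have "\<dots> \<le> 49 * energy (Suc j)" using energy_antimono[of "Suc j"] by simp
  finally show ?thesis .
qed

lemma energy_lower: "energy 0 \<le> 49 ^ j * energy j"
proof (induction j)
  case (Suc j)
  have "49 ^ j * energy j \<le> 49 ^ j * (49 * energy (Suc j))" by (intro mult_left_mono energy_step_lower) simp
  with Suc have "energy 0 \<le> 49 ^ j * (49 * energy (Suc j))" by (rule order_trans)
  then show ?case by (simp add: mult_ac)
qed simp

text \<open>Excludes cancellation between the two layers that form the trace. With p j the inner
  product, the layer equation gives p j + p (j + 1) \<ge> 2 energy (j + 1), while p (j + 1) is at
  most energy (j + 1) by monotonicity.\<close>

lemma consecutive_layers_inner: "0 \<le> (\<Sum>m\<in>Z. U j m * U (Suc j) m)"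
proof -
  let ?p = "\<lambda>j. \<Sum>m\<in>Z. U j m * U (Suc j) m"
  have "?p j + ?p (Suc j) - 2 * energy (Suc j)
    = (\<Sum>m\<in>Z. U (Suc j) m * (U (Suc (Suc j)) m + U j m - 2 * U (Suc j) m))"
    by (simp add: energy_def power2_eq_square algebra_simps sum.distrib sum_subtractf sum_distrib_left)
  also have "\<dots> \<ge> 0"
    unfolding layer_identity dirichlet_by_parts by (simp add: sum_nonneg)
  finally have 1: "2 * energy (Suc j) \<le> ?p j + ?p (Suc j)" by simp
  have "x * y \<le> (x\<^sup>2 + y\<^sup>2) / 2" for x y :: real
    using zero_le_power2[of "x - y"] by (simp add: power2_eq_square algebra_simps)
  then have "?p (Suc j) \<le> (\<Sum>m\<in>Z. ((U (Suc j) m)\<^sup>2 + (U (Suc (Suc j)) m)\<^sup>2) / 2)" by (intro sum_mono)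
  also have "\<dots> = (energy (Suc j) + energy (Suc (Suc j))) / 2"
    by (simp add: energy_def sum.distrib sum_divide_distrib[symmetric])
  also have "\<dots> \<le> energy (Suc j)" using energy_antimono[of "Suc j"] by simp
  finally show ?thesis using 1 energy_nonneg[of "Suc j"] by linarith
qed

text \<open>This is the zero Fourier mode: the layer sums s satisfy a vanishing second difference
  and are bounded, so the convexity lemma applies to s and to - s.\<close>

lemma layer_sum_const: "(\<Sum>m\<in>Z. U j m) = (\<Sum>m\<in>Z. U 0 m)"
proof -
  define s where "s j = (\<Sum>m\<in>Z. U j m)" for j
  have rec: "s (Suc (Suc j)) + s j = 2 * s (Suc j)" for j
  proof -
    have "(\<Sum>m\<in>Z. U (Suc (Suc j)) m + U j m + U (Suc j) (m + 1) + U (Suc j) (m - 1)) = (\<Sum>m\<in>Z. 4 * U (Suc j) m)"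
      using five_point by simp
    then show ?thesis
      using sum_periodic_shift[of "U (Suc j)" M, OF per] sum_periodic_shift_back[of "U (Suc j)" M, OF per]
      by (simp add: s_def sum.distrib sum_distrib_left[symmetric])
  qed
  obtain b where b: "\<And>j m. \<bar>U j m\<bar> \<le> b" using bdd by blast
  have "\<bar>s j\<bar> \<le> (\<Sum>m\<in>Z. b)" for j
    unfolding s_def by (rule order_trans[OF sum_abs]) (intro sum_mono b)
  then have sb: "s j \<le> (\<Sum>m\<in>Z. b)" "- s j \<le> (\<Sum>m\<in>Z. b)" for j using abs_le_iff by blast+
  have "s (Suc j) \<le> s j" for j by (rule convex_bounded_antimono[of s, OF _ sb(1)]) (simp add: rec)
  moreover have "- s (Suc j) \<le> - s j" for j
  proof (rule convex_bounded_antimono[of "\<lambda>j. - s j", OF _ sb(2)])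
    show "2 * - s (Suc j) \<le> - s (Suc (Suc j)) + - s j" for j using rec[of j] by simp
  qed
  ultimately have "s (Suc j) = s j" for j by (simp add: order_antisym)
  then have "s j = s 0" by (induction j) auto
  then show ?thesis by (simp add: s_def)
qed

end

section \<open>Existence, uniqueness and linearity of the bounded extension\<close>

lemma strip_harmonic_zero:
  assumes "strip_harmonic M U" "M > 0" and z: "\<And>m. m \<in> {0..<int M} \<Longrightarrow> U 0 m = 0"
  shows "U j m = 0"
proof -
  interpret strip_harmonic M U by (rule assms(1))
  have "energy 0 = 0" using z by (simp add: energy_def)
  then have "energy j = 0" using energy_le_initial[of j] energy_nonneg[of j] by simp
  then have "U j n = 0" if "n \<in> Z" for n
    using that unfolding energy_def by (subst (asm) sum_nonneg_eq_0_iff) auto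
  then have "U j (m mod int M) = 0" using assms(2) by simp
  then show ?thesis using periodic_mod[of "U j" M m] per by simp
qed

lemma strip_harmonic_sum:
  assumes fin: "finite I" and U: "\<And>i. i \<in> I \<Longrightarrow> strip_harmonic M (U i)"
  shows "strip_harmonic M (\<lambda>j m. \<Sum>i\<in>I. c i * U i j m)"
proof
  show "(\<Sum>i\<in>I. c i * U i j (m + int M)) = (\<Sum>i\<in>I. c i * U i j m)" for j m
    using strip_harmonic.per[OF U] by simp
  have "\<forall>i\<in>I. \<exists>b. \<forall>j m. \<bar>U i j m\<bar> \<le> b" using strip_harmonic.bdd[OF U] by blast
  then obtain b where b: "\<And>i j m. i \<in> I \<Longrightarrow> \<bar>U i j m\<bar> \<le> b i" by metis
  have "\<bar>\<Sum>i\<in>I. c i * U i j m\<bar> \<le> (\<Sum>i\<in>I. \<bar>c i\<bar> * b i)" for j m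
    by (rule order_trans[OF sum_abs]) (auto simp: abs_mult intro!: sum_mono mult_left_mono b)
  then show "\<exists>b. \<forall>j m. \<bar>\<Sum>i\<in>I. c i * U i j m\<bar> \<le> b" by blast
  show "(\<Sum>i\<in>I. c i * U i (Suc (Suc j)) m) + (\<Sum>i\<in>I. c i * U i j m) + (\<Sum>i\<in>I. c i * U i (Suc j) (m + 1))
      + (\<Sum>i\<in>I. c i * U i (Suc j) (m - 1)) = 4 * (\<Sum>i\<in>I. c i * U i (Suc j) m)" for j m
  proof -
    have "(\<Sum>i\<in>I. c i * U i (Suc (Suc j)) m) + (\<Sum>i\<in>I. c i * U i j m) + (\<Sum>i\<in>I. c i * U i (Suc j) (m + 1))
      + (\<Sum>i\<in>I. c i * U i (Suc j) (m - 1))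
      = (\<Sum>i\<in>I. c i * (U i (Suc (Suc j)) m + U i j m + U i (Suc j) (m + 1) + U i (Suc j) (m - 1)))"
      by (simp add: sum.distrib distrib_left)
    also have "\<dots> = (\<Sum>i\<in>I. c i * (4 * U i (Suc j) m))" using strip_harmonic.five_point[OF U] by simp
    finally show ?thesis by (simp add: sum_distrib_left mult.left_commute)
  qed
qed

lemma strip_harmonic_diff:
  assumes "strip_harmonic M U" "strip_harmonic M W"
  shows "strip_harmonic M (\<lambda>j m. U j m - a * W j m)"
proof -
  \<comment> \<open>A family indexed by \<open>bool\<close> reduces the combination of two functions
    to the finite sum.\<close>
  have "strip_harmonic M (\<lambda>j m. \<Sum>i\<in>UNIV. (if i then 1 else - a) * (if i then U else W) j m)"
    by (rule strip_harmonic_sum) (use assms in auto)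
  then show ?thesis by (simp add: UNIV_bool add.commute)
qed

lemma strip_harmonic_const: "strip_harmonic M (\<lambda>_ _. a)"
  by standard auto

text \<open>After multiplication by 2 sin (x / 2) the sum telescopes; that factor is nonzero because
  d is not a multiple of M.\<close>

lemma sum_cos_multiples:
  fixes d :: int
  assumes d: "d \<noteq> 0" "\<bar>d\<bar> < int M"
  shows "(\<Sum>k\<in>{0..<M}. cos (2 * pi * real k * of_int d / real M)) = 0"
proof -
  define x where "x = 2 * pi * of_int d / real M"
  have M: "M > 0" using d by auto
  have tele: "2 * sin (x / 2) * (\<Sum>k\<in>{0..<n}. cos (real k * x)) = sin (real n * x - x / 2) + sin (x / 2)" for n
  proof (induction n)
    case (Suc n)
    have "2 * sin (x / 2) * (\<Sum>k\<in>{0..<Suc n}. cos (real k * x))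
      = 2 * sin (x / 2) * (\<Sum>k\<in>{0..<n}. cos (real k * x)) + 2 * sin (x / 2) * cos (real n * x)"
      by (simp add: distrib_left)
    also have "2 * sin (x / 2) * cos (real n * x) = sin (real n * x + x / 2) - sin (real n * x - x / 2)"
      by (simp add: sin_add sin_diff)
    also have "real n * x + x / 2 = real (Suc n) * x - x / 2" by (simp add: field_simps)
    finally show ?case using Suc by simp
  qed simp
  have "real M * x - x / 2 = 2 * pi * of_int d - x / 2" using M by (simp add: x_def)
  then have "sin (real M * x - x / 2) = - sin (x / 2)"
    by (simp only: sin_diff sin_int_2pin cos_int_2pin)
  then have "2 * sin (x / 2) * (\<Sum>k\<in>{0..<M}. cos (real k * x)) = 0" using tele[of M] by simp
  moreover have "sin (x / 2) \<noteq> 0"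
  proof
    assume "sin (x / 2) = 0"
    then obtain i :: int where "x / 2 = of_int i * pi" by (auto simp: sin_zero_iff_int2)
    then have "of_int d = (of_int (i * int M) :: real)" using M by (simp add: x_def field_simps)
    then have "d = i * int M" by linarith
    then show False using d M by (metis abs_ge_self abs_mult abs_of_nat dvd_imp_le_int dvd_triv_right not_less)
  qed
  moreover have "real k * x = 2 * pi * real k * of_int d / real M" for k by (simp add: x_def)
  ultimately show ?thesis by simp
qed

text \<open>Here \<open>r = exp (- \<alpha>)\<close> with \<open>cosh \<alpha> = 2 - c\<close> and \<open>c = cos \<theta>\<close>.\<close>

lemma strip_root:
  fixes c :: real
  assumes "\<bar>c\<bar> \<le> 1"
  obtains r where "0 \<le> r" "r \<le> 1" "r\<^sup>2 + 1 + 2 * r * c = 4 * r"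
proof -
  define s where "s = 2 - c"
  have s: "1 \<le> s" using assms by (simp add: s_def)
  then have s2: "0 \<le> s\<^sup>2 - 1" by simp
  define r where "r = s - sqrt (s\<^sup>2 - 1)"
  have "sqrt (s\<^sup>2 - 1) \<le> sqrt (s\<^sup>2)" by (rule real_sqrt_le_mono) simp
  then have r0: "0 \<le> r" using s by (simp add: r_def)
  have "(s - 1)\<^sup>2 \<le> s\<^sup>2 - 1" using s by (simp add: power2_eq_square algebra_simps)
  then have "s - 1 \<le> sqrt (s\<^sup>2 - 1)" by (rule real_le_rsqrt)
  then have r1: "r \<le> 1" by (simp add: r_def)
  have "r\<^sup>2 - 2 * s * r + 1 = 0"
    using s2 unfolding r_def by (simp add: power2_eq_square algebra_simps)
  then have "r\<^sup>2 + 1 + 2 * r * c = 4 * r" by (simp add: s_def algebra_simps)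
  then show thesis using r0 r1 that by blast
qed

text \<open>Discrete Fourier inversion with real cosines: for each node n and frequency k the cosine
  mode centred at n, with layer factor r k, is bounded and harmonic. Summed over k with weight 1 /
  M, these modes give the point mass at n on layer 0.\<close>

lemma strip_extension_exists:
  assumes M: "M > 0"
  obtains U where "strip_harmonic M U" "\<And>m. m \<in> {0..<int M} \<Longrightarrow> U 0 m = V m"
proof -
  define \<theta> where "\<theta> k = 2 * pi * real k / real M" for k
  have "\<exists>r. 0 \<le> r \<and> r \<le> 1 \<and> r\<^sup>2 + 1 + 2 * r * cos (\<theta> k) = 4 * r" for k
    using strip_root[of "cos (\<theta> k)"] by auto
  then obtain r where r: "\<And>k. 0 \<le> r k" "\<And>k. r k \<le> 1" "\<And>k. (r k)\<^sup>2 + 1 + 2 * r k * cos (\<theta> k) = 4 * r k" by metis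
  define P where "P = (\<lambda>(n, k) j m. r k ^ j * cos (\<theta> k * of_int (m - n)))"
  have P: "strip_harmonic M (P nk)" for nk
  proof -
    obtain n k where nk: "nk = (n, k)" by (cases nk)
    show ?thesis
    proof
      show "P nk j (m + int M) = P nk j m" for j m
      proof -
        have "\<theta> k * of_int (m + int M - n) = \<theta> k * of_int (m - n) + of_int (int k) * (2 * pi)"
          using M by (simp add: \<theta>_def field_simps)
        moreover have "cos (y + of_int i * (2 * pi)) = cos y" for y and i :: int
          using cos_int_2pin[of i] sin_int_2pin[of i] by (simp add: cos_add mult.commute)
        ultimately show ?thesis unfolding P_def nk by (simp only: prod.case)
      qed
      have "\<bar>P nk j m\<bar> \<le> 1" for j m
      proof -
        have "\<bar>P nk j m\<bar> = r k ^ j * \<bar>cos (\<theta> k * of_int (m - n))\<bar>"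
          using r(1) by (simp add: P_def nk abs_mult)
        also have "\<dots> \<le> 1 * 1" using r by (intro mult_mono power_le_one) auto
        finally show ?thesis by simp
      qed
      then show "\<exists>b. \<forall>j m. \<bar>P nk j m\<bar> \<le> b" by blast
      show "P nk (Suc (Suc j)) m + P nk j m + P nk (Suc j) (m + 1) + P nk (Suc j) (m - 1) = 4 * P nk (Suc j) m" for j m
      proof -
        define y where "y = \<theta> k * of_int (m - n)"
        have "\<theta> k * of_int (m + 1 - n) = y + \<theta> k" "\<theta> k * of_int (m - 1 - n) = y - \<theta> k"
          by (simp_all add: y_def algebra_simps)
        then have "P nk (Suc (Suc j)) m + P nk j m + P nk (Suc j) (m + 1) + P nk (Suc j) (m - 1)
          = r k ^ j * cos y * ((r k)\<^sup>2 + 1 + 2 * r k * cos (\<theta> k))"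
          unfolding P_def nk prod.case y_def[symmetric]
          by (simp only: cos_add cos_diff) (simp add: power2_eq_square algebra_simps)
        also have "\<dots> = 4 * P nk (Suc j) m"
          unfolding r(3) P_def nk prod.case y_def[symmetric] by simp
        finally show ?thesis .
      qed
    qed
  qed
  define I where "I = {0..<int M} \<times> {0..<M}"
  define U where "U j m = (\<Sum>nk\<in>I. (V (fst nk) / real M) * P nk j m)" for j m
  have "strip_harmonic M U"
    unfolding U_def by (rule strip_harmonic_sum) (auto simp: I_def P)
  moreover have "U 0 m = V m" if m: "m \<in> {0..<int M}" for m
  proof -
    have inner: "(\<Sum>k\<in>{0..<M}. cos (\<theta> k * of_int (m - n))) = (if n = m then real M else 0)" if n: "n \<in> {0..<int M}" for n
    proof (cases "n = m")
      case False
      then have "(\<Sum>k\<in>{0..<M}. cos (2 * pi * real k * of_int (m - n) / real M)) = 0"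
        using m n by (intro sum_cos_multiples) auto
      moreover have "\<theta> k * of_int (m - n) = 2 * pi * real k * of_int (m - n) / real M" for k
        by (simp add: \<theta>_def)
      ultimately show ?thesis using False by simp
    qed simp
    have "U 0 m = (\<Sum>n\<in>{0..<int M}. (V n / real M) * (\<Sum>k\<in>{0..<M}. cos (\<theta> k * of_int (m - n))))"
      unfolding U_def I_def P_def by (simp add: sum.cartesian_product' sum_distrib_left case_prod_beta)
    also have "\<dots> = (\<Sum>n\<in>{0..<int M}. if n = m then V n else 0)"
    proof (rule sum.cong[OF refl])
      fix n assume n: "n \<in> {0..<int M}"
      show "V n / real M * (\<Sum>k\<in>{0..<M}. cos (\<theta> k * of_int (m - n))) = (if n = m then V n else 0)"
        unfolding inner[OF n] using M by simp
    qed
    also have "\<dots> = V m" using m by simp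
    finally show ?thesis .
  qed
  ultimately show thesis using that by blast
qed

lemma bounded_harmonic_extension_iff:
  "bounded_harmonic_extension M V U \<longleftrightarrow> strip_harmonic M U \<and> (\<forall>m\<in>{0..<int M}. U 0 m = V m)"
  unfolding bounded_harmonic_extension_def strip_harmonic_def by blast

lemma flat_U_eqI:
  assumes M: "M > 0" and U: "strip_harmonic M U" "\<And>m. m \<in> {0..<int M} \<Longrightarrow> U 0 m = V m"
  shows "flat_U M V = U"
  unfolding flat_U_def
proof (rule the_equality)
  show "bounded_harmonic_extension M V U" unfolding bounded_harmonic_extension_iff using U by blast
  fix W assume "bounded_harmonic_extension M V W"
  then have W: "strip_harmonic M W" "\<And>m. m \<in> {0..<int M} \<Longrightarrow> W 0 m = V m"
    unfolding bounded_harmonic_extension_iff by blast+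
  have "W j m - 1 * U j m = 0" for j m
    by (rule strip_harmonic_zero[OF strip_harmonic_diff[OF W(1) U(1), of 1] M]) (simp add: W U)
  then show "W = U" by (simp add: fun_eq_iff)
qed

lemma flat_U_extension:
  assumes M: "M > 0"
  shows "strip_harmonic M (flat_U M V)" "\<And>m. m \<in> {0..<int M} \<Longrightarrow> flat_U M V 0 m = V m"
proof -
  obtain U where U: "strip_harmonic M U" "\<And>m. m \<in> {0..<int M} \<Longrightarrow> U 0 m = V m"
    using strip_extension_exists[OF M, of V] by blast
  have "flat_U M V = U" by (rule flat_U_eqI[OF M U])
  then show "strip_harmonic M (flat_U M V)" "\<And>m. m \<in> {0..<int M} \<Longrightarrow> flat_U M V 0 m = V m" using U by auto
qed

text \<open>Linearity in V is a consequence of uniqueness: the superposition of the extended point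
  masses has the right data on layer 0.\<close>

lemma flat_U_sum:
  assumes M: "M > 0"
  shows "flat_U M V j m = (\<Sum>n\<in>{0..<int M}. V n * flat_U M (\<lambda>i. of_bool (i = n)) j m)"
proof -
  have "flat_U M V = (\<lambda>j m. \<Sum>n\<in>{0..<int M}. V n * flat_U M (\<lambda>i. of_bool (i = n)) j m)"
  proof (rule flat_U_eqI[OF M])
    show "strip_harmonic M (\<lambda>j m. \<Sum>n\<in>{0..<int M}. V n * flat_U M (\<lambda>i. of_bool (i = n)) j m)"
      by (rule strip_harmonic_sum) (auto intro: flat_U_extension[OF M])
    fix m assume m: "m \<in> {0..<int M}"
    have "(\<Sum>n\<in>{0..<int M}. V n * flat_U M (\<lambda>i. of_bool (i = n)) 0 m) = (\<Sum>n\<in>{0..<int M}. if n = m then V n else 0)"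
      by (intro sum.cong refl) (simp add: flat_U_extension(2)[OF M m])
    then show "(\<Sum>n\<in>{0..<int M}. V n * flat_U M (\<lambda>i. of_bool (i = n)) 0 m) = V m" using m by simp
  qed
  then show ?thesis by simp
qed

lemma flat_U_shift:
  assumes M: "M > 0"
  shows "flat_U M (\<lambda>i. V i - a) j m = flat_U M V j m - a"
proof -
  have "flat_U M (\<lambda>i. V i - a) = (\<lambda>j m. flat_U M V j m - a * 1)"
    by (rule flat_U_eqI[OF M strip_harmonic_diff[OF flat_U_extension(1)[OF M] strip_harmonic_const]])
       (simp add: flat_U_extension(2)[OF M])
  then show ?thesis by simp
qed

section \<open>The flat setting\<close>

text \<open>F is left unspecified at the finitely many breakpoints, which suits a derivative that
  need not exist at kinks.\<close>

lemma set_integral_step_function: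
  fixes F :: "real \<Rightarrow> real" and c :: "int \<Rightarrow> real"
  assumes M: "M > 0"
    and F: "\<And>t m. m \<in> {0..<int M} \<Longrightarrow> of_int m < t * real M \<Longrightarrow> t * real M < of_int m + 1 \<Longrightarrow> F t = c m"
  shows "(LINT t:{0..1}|lborel. F t) = (\<Sum>m\<in>{0..<int M}. c m) / real M"
proof -
  define S where "S m = {of_int m / real M<..<(of_int m + 1) / real M}" for m :: int
  define X where "X = (\<lambda>m. of_int m / real M) ` {0..int M}"
  have S: "t \<in> S m \<longleftrightarrow> of_int m < t * real M \<and> t * real M < of_int m + 1" for t m
    using M by (simp add: S_def divide_less_eq less_divide_eq)
  have "(LINT t:{0..1}|lborel. F t) = (LINT t|lborel. (\<Sum>m\<in>{0..<int M}. indicator (S m) t *\<^sub>R c m))"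
    unfolding set_lebesgue_integral_def
  proof (rule integral_discrete_difference[of X])
    show "countable X" by (simp add: X_def)
    fix t assume t: "t \<notin> X"
    have uniq: "m = \<lfloor>t * real M\<rfloor>" if "t \<in> S m" for m
      using that unfolding S by linarith
    show "indicator {0..1} t *\<^sub>R F t = (\<Sum>m\<in>{0..<int M}. indicator (S m) t *\<^sub>R c m)"
    proof (cases "t \<in> {0..1}")
      case True
      define n where "n = \<lfloor>t * real M\<rfloor>"
      have n0: "of_int n \<le> t * real M" "t * real M < of_int n + 1" by (auto simp: n_def)
      have tM: "t * real M \<le> real M" "0 \<le> t * real M"
        using True by (auto simp: mult_left_le_one_le)
      then have n1: "0 \<le> n" by (simp add: n_def)
      have "real_of_int n \<le> of_int (int M)" using n0(1) tM(1) by simp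
      then have n2: "n \<le> int M" by (simp only: of_int_le_iff)
      have ne: "t * real M \<noteq> of_int n"
      proof
        assume "t * real M = of_int n"
        then have "t = of_int n / real M" using M by (simp add: field_simps)
        then have "t \<in> X" unfolding X_def using n1 n2 by (intro image_eqI[of _ _ n]) auto
        with t show False by contradiction
      qed
      have n3: "n \<noteq> int M"
      proof
        assume "n = int M"
        then have "real_of_int n = real M" by simp
        with n0(1) tM(1) ne show False by linarith
      qed
      have n: "n \<in> {0..<int M}" using n1 n2 n3 by simp
      have "t \<in> S n" unfolding S using n0 ne by linarith
      note n = n this
      have "(\<Sum>m\<in>{0..<int M}. indicator (S m) t *\<^sub>R c m) = (\<Sum>m\<in>{0..<int M}. if m = n then c m else 0)"
      proof (rule sum.cong[OF refl])
        fix m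
        have "t \<in> S m \<longleftrightarrow> m = n" using uniq[of m] n(2) unfolding n_def[symmetric] by blast
        then show "indicator (S m) t *\<^sub>R c m = (if m = n then c m else 0)" by (simp add: indicator_def)
      qed
      also have "\<dots> = F t" using n F[of n t] unfolding S by simp
      finally show ?thesis using True by simp
    next
      case False
      have "t \<notin> S m" if "m \<in> {0..<int M}" for m
      proof
        assume tm: "t \<in> S m"
        have "real_of_int (m + 1) \<le> of_int (int M)" unfolding of_int_le_iff using that by simp
        then have a: "real_of_int m + 1 \<le> real M" by simp
        have b: "0 \<le> real_of_int m" using that by simp
        have "t * real M < real M" using a tm[unfolded S] by linarith
        then have "t < 1" using M by simp
        moreover have "0 < t * real M" using b tm[unfolded S] by linarith
        then have "0 < t" by (simp add: zero_less_mult_iff)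
        ultimately have "t \<in> {0..1}" by simp
        then show False using False by simp
      qed
      then show ?thesis using False by (simp add: indicator_def)
    qed
  qed auto
  also have "\<dots> = (\<Sum>m\<in>{0..<int M}. (LINT t|lborel. indicator (S m) t *\<^sub>R c m))"
  proof (intro Bochner_Integration.integral_sum integrable_scaleR_left integrable_real_indicator)
    show "S m \<in> sets lborel" for m by (simp add: S_def)
    show "emeasure lborel (S m) < \<infinity>" for m
      by (rule emeasure_bounded_finite) (simp add: S_def)
  qed
  also have "\<dots> = (\<Sum>m\<in>{0..<int M}. c m / real M)"
  proof (rule sum.cong[OF refl])
    fix m
    have "measure lborel (S m) = 1 / real M"
      using M by (simp add: S_def field_simps diff_divide_distrib[symmetric])
    then show "(LINT t|lborel. indicator (S m) t *\<^sub>R c m) = c m / real M" by simp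
  qed
  finally show ?thesis by (simp add: sum_divide_distrib)
qed

section \<open>The trace on the line and its stiffness matrix\<close>

context
  fixes M :: nat and h :: real and d Jm Jp :: nat and \<rho> :: real and J :: "node \<Rightarrow> int \<Rightarrow> real"
  assumes M: "M \<ge> 2" and h: "h > 0" and dJ: "d + 1 \<le> Jp" and \<rho>: "0 \<le> \<rho>" "\<rho> \<le> 1"
begin

private abbreviation (input) "Z \<equiv> {0..<int M}"

definition flat_trace :: "(int \<Rightarrow> real) \<Rightarrow> int \<Rightarrow> real" where
  "flat_trace V m = (1 - \<rho>) * flat_U M V d m + \<rho> * flat_U M V (Suc d) m"

definition flat_increment :: "(int \<Rightarrow> real) \<Rightarrow> int \<Rightarrow> real" where
  "flat_increment V m = flat_trace V (m + 1) - flat_trace V m"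

lemma M0: "M > 0" using M by simp

lemma flat_trace_periodic: "flat_trace V (m + int M) = flat_trace V m"
  unfolding flat_trace_def using strip_harmonic.per[OF flat_U_extension(1)[OF M0]] by simp

text \<open>Within a cell between layers d and d + 1 the bilinear function is affine along the line.
  The node column M, needed by the last cell, carries the values of column 0 through
  \<open>mod\<close>.\<close>

lemma flat_fe_on_line:
  assumes m: "m \<in> Z" and t: "of_int m \<le> t * real M" "t * real M \<le> of_int m + 1"
  shows "flat_E_fe M h Jm Jp J V (t * (real M * h), (real d + \<rho>) * h)
    = flat_trace V m + (t * real M - of_int m) * flat_increment V m"
proof -
  let ?x = "(t * (real M * h), (real d + \<rho>) * h)"
  define N where "N = {0..int M} \<times> {- int Jm..int Jp}"
  define k where "k = (m, int d)"
  define u where "u = (\<lambda>(m, j). flat_E M J V (m mod int M, j))"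
  have c: "fst ?x / h - fst k = t * real M - of_int m" "snd ?x / h - snd k = \<rho>"
    using h by (simp_all add: k_def)
  have cell: "?x \<in> cell h k" unfolding mem_cell_iff[OF h] c using t \<rho> by simp
  have N: "finite N" "cell_vertices k \<subseteq> N"
    using m dJ by (auto simp: N_def cell_vertices_def k_def)
  have modU: "flat_U M V j (i mod int M) = flat_U M V j i" for i j
    by (rule periodic_mod) (rule strip_harmonic.per[OF flat_U_extension(1)[OF M0]])
  have u: "u (i, int j) = flat_U M V j i" for i j
    by (simp add: u_def flat_E_def modU)
  have v: "u k = flat_U M V d m" "u (k + (1, 0)) = flat_U M V d (m + 1)"
    "u (k + (0, 1)) = flat_U M V (Suc d) m" "u (k + (1, 1)) = flat_U M V (Suc d) (m + 1)"
    using u[of _ d] u[of _ "Suc d"] by (simp_all add: k_def add.commute)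
  have "flat_E_fe M h Jm Jp J V ?x = fe_function h N u ?x"
    by (simp add: flat_E_fe_def N_def u_def)
  also have "\<dots> = bilinear u k (t * real M - of_int m) \<rho>"
    unfolding fe_function_cell[OF h cell N] c ..
  also have "\<dots> = flat_trace V m + (t * real M - of_int m) * flat_increment V m"
  proof -
    define s where "s = t * real M - of_int m"
    show ?thesis unfolding s_def[symmetric] bilinear_def v flat_increment_def flat_trace_def
      by (simp add: algebra_simps)
  qed
  finally show ?thesis .
qed

text \<open>In the parameter t the slope is M times the increment, each piece has length 1 / M, and
  the segment has length M h. The powers of M cancel and leave 1 / h, as for the usual
  one-dimensional stiffness matrix.\<close>

lemma flat_form_increments:
  "flat_form M h d \<rho> (flat_E_fe M h Jm Jp J V) (flat_E_fe M h Jm Jp J W)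
    = (\<Sum>m\<in>Z. flat_increment V m * flat_increment W m) / h"
proof -
  define y where "y = (real d + \<rho>) * h"
  define F where "F V t = real M * flat_increment V \<lfloor>t * real M\<rfloor>" for V t
  define X where "X = (\<lambda>m. of_int m / real M) ` {0..int M}"
  have deriv: "((\<lambda>s. flat_E_fe M h Jm Jp J V ((0, y) + s *\<^sub>R ((real M * h, y) - (0, y)))) has_real_derivative F V t) (at t)"
    if t: "t \<in> {0<..<1} - X" for V t
  proof -
    define n where "n = \<lfloor>t * real M\<rfloor>"
    have "0 < t * real M" "t * real M < 1 * real M"
      using t M0 by (auto intro!: mult_strict_right_mono)
    then have n: "n \<in> Z" unfolding n_def by (auto simp: floor_less_iff)
    have "t * real M \<noteq> of_int n"
    proof
      assume "t * real M = of_int n"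
      then have "t = of_int n / real M" using M0 by (simp add: field_simps)
      then show False using t n by (auto simp: X_def)
    qed
    then have tn: "of_int n < t * real M" "t * real M < of_int n + 1"
      unfolding n_def by linarith+
    let ?S = "{of_int n / real M<..<(of_int n + 1) / real M}"
    have S: "s \<in> ?S \<longleftrightarrow> of_int n < s * real M \<and> s * real M < of_int n + 1" for s
      using M0 by (simp add: divide_less_eq less_divide_eq)
    have lin: "((\<lambda>s. flat_trace V n + (s * real M - of_int n) * flat_increment V n) has_real_derivative F V t) (at t)"
      unfolding F_def n_def[symmetric] by (auto intro!: derivative_eq_intros)
    show ?thesis
    proof (rule has_field_derivative_transform_within_open[OF lin, where S = ?S])
      show "t \<in> ?S" using tn S by blast
      fix s assume "s \<in> ?S"
      then have "of_int n \<le> s * real M" "s * real M \<le> of_int n + 1" using S by auto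
      from flat_fe_on_line[OF n this, of V]
      show "flat_trace V n + (s * real M - of_int n) * flat_increment V n
        = flat_E_fe M h Jm Jp J V ((0, y) + s *\<^sub>R ((real M * h, y) - (0, y)))"
        by (simp add: y_def)
    qed simp
  qed
  have "finite X" by (simp add: X_def)
  have "flat_form M h d \<rho> (flat_E_fe M h Jm Jp J V) (flat_E_fe M h Jm Jp J W)
    = (LINT t:{0..1}|lborel. F V t * F W t) / norm ((real M * h, y) - (0, y))"
    unfolding flat_form_def y_def[symmetric] by (rule segment_form_eq[OF \<open>finite X\<close> deriv deriv])
  also have "norm ((real M * h, y) - (0, y)) = real M * h" using h by (simp add: norm_Pair)
  also have "(LINT t:{0..1}|lborel. F V t * F W t)
    = (\<Sum>m\<in>Z. (real M)\<^sup>2 * (flat_increment V m * flat_increment W m)) / real M"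
  proof (rule set_integral_step_function[OF M0])
    fix t m assume "of_int m < t * real M" "t * real M < of_int m + 1"
    then have "\<lfloor>t * real M\<rfloor> = m" by linarith
    then show "F V t * F W t = (real M)\<^sup>2 * (flat_increment V m * flat_increment W m)"
      by (simp add: F_def power2_eq_square)
  qed
  finally show ?thesis
    using M0 by (simp add: sum_distrib_left[symmetric] power2_eq_square)
qed

lemma flat_increment_sum:
  "flat_increment V m = (\<Sum>n\<in>Z. V n * flat_increment (\<lambda>i. of_bool (i = n)) m)"
proof -
  have "flat_trace V m = (\<Sum>n\<in>Z. V n * flat_trace (\<lambda>i. of_bool (i = n)) m)" for m
    unfolding flat_trace_def flat_U_sum[OF M0, of V]
    by (simp add: sum_distrib_left sum.distrib distrib_left mult.left_commute)
  then show ?thesis unfolding flat_increment_def by (simp add: sum_subtractf right_diff_distrib)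
qed

lemma flat_K_reduced_form:
  "symmetric_with_form Z (flat_K_reduced M h Jm Jp J d \<rho>)
    (\<lambda>V. flat_form M h d \<rho> (flat_E_fe M h Jm Jp J V) (flat_E_fe M h Jm Jp J V))"
  unfolding symmetric_with_form_def flat_K_reduced_def flat_form_increments
proof (intro conjI ballI allI)
  let ?e = "\<lambda>n i :: int. of_bool (i = n) :: real"
  show "(\<Sum>k\<in>Z. flat_increment (?e m) k * flat_increment (?e n) k) / h
      = (\<Sum>k\<in>Z. flat_increment (?e n) k * flat_increment (?e m) k) / h" for m n
    by (simp add: mult.commute)
  fix V
  have "(\<Sum>k\<in>Z. flat_increment V k * flat_increment V k) / h
    = (\<Sum>k\<in>Z. \<Sum>m\<in>Z. \<Sum>n\<in>Z. V m * flat_increment (?e m) k * (V n * flat_increment (?e n) k)) / h"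
    by (subst (1 2) flat_increment_sum) (simp only: sum_product)
  also have "\<dots> = (\<Sum>m\<in>Z. \<Sum>k\<in>Z. \<Sum>n\<in>Z. V m * flat_increment (?e m) k * (V n * flat_increment (?e n) k)) / h"
    by (subst sum.swap) (rule refl)
  also have "\<dots> = (\<Sum>m\<in>Z. \<Sum>n\<in>Z. \<Sum>k\<in>Z. V m * flat_increment (?e m) k * (V n * flat_increment (?e n) k)) / h"
    by (intro arg_cong[where f = "\<lambda>x. x / h"] sum.cong refl sum.swap)
  also have "\<dots> = (\<Sum>m\<in>Z. \<Sum>n\<in>Z. V m * ((\<Sum>k\<in>Z. flat_increment (?e m) k * flat_increment (?e n) k) / h) * V n)"
    by (simp add: sum_divide_distrib sum_distrib_left sum_distrib_right mult_ac)
  finally show "(\<Sum>m\<in>Z. \<Sum>n\<in>Z. V m * ((\<Sum>k\<in>Z. flat_increment (?e m) k * flat_increment (?e n) k) / h) * V n)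
    = (\<Sum>k\<in>Z. flat_increment V k * flat_increment V k) / h" by simp
qed

lemma flat_trace_upper: "(\<Sum>m\<in>Z. (flat_trace V m)\<^sup>2) \<le> (\<Sum>m\<in>Z. (V m)\<^sup>2)"
proof -
  interpret S: strip_harmonic M "flat_U M V" by (rule flat_U_extension(1)[OF M0])
  have conv: "((1 - \<rho>) * x + \<rho> * y)\<^sup>2 \<le> (1 - \<rho>) * x\<^sup>2 + \<rho> * y\<^sup>2" for x y :: real
  proof -
    have "(1 - \<rho>) * x\<^sup>2 + \<rho> * y\<^sup>2 - ((1 - \<rho>) * x + \<rho> * y)\<^sup>2 = \<rho> * (1 - \<rho>) * (x - y)\<^sup>2"
      by (simp add: power2_eq_square algebra_simps)
    also have "\<dots> \<ge> 0" using \<rho> by simp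
    finally show ?thesis by simp
  qed
  have "(\<Sum>m\<in>Z. (flat_trace V m)\<^sup>2) \<le> (1 - \<rho>) * S.energy d + \<rho> * S.energy (Suc d)"
    unfolding flat_trace_def S.energy_def sum_distrib_left sum.distrib[symmetric] by (rule sum_mono) (rule conv)
  also have "\<dots> \<le> (1 - \<rho>) * S.energy 0 + \<rho> * S.energy 0"
    using \<rho> by (intro add_mono mult_left_mono S.energy_le_initial) auto
  also have "\<dots> = (\<Sum>m\<in>Z. (V m)\<^sup>2)"
    unfolding S.energy_def using flat_U_extension(2)[OF M0, of _ V] by (simp add: algebra_simps)
  finally show ?thesis .
qed

text \<open>Dropping the nonnegative cross term leaves at least (1 - \<rho>)^2 + \<rho>^2 \<ge> 1/2
  times the smaller energy, that of layer d + 1. This is the 2, and d + 1 reverse energy steps give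
  the power of 49.\<close>

lemma flat_trace_lower: "(\<Sum>m\<in>Z. (V m)\<^sup>2) \<le> 2 * 49 ^ Suc d * (\<Sum>m\<in>Z. (flat_trace V m)\<^sup>2)"
proof -
  interpret S: strip_harmonic M "flat_U M V" by (rule flat_U_extension(1)[OF M0])
  have expand: "(flat_trace V m)\<^sup>2 = (1 - \<rho>)\<^sup>2 * (flat_U M V d m)\<^sup>2 + \<rho>\<^sup>2 * (flat_U M V (Suc d) m)\<^sup>2
      + 2 * \<rho> * (1 - \<rho>) * (flat_U M V d m * flat_U M V (Suc d) m)" for m
    by (simp add: flat_trace_def power2_eq_square algebra_simps)
  have "1 \<le> 2 * ((1 - \<rho>)\<^sup>2 + \<rho>\<^sup>2)"
    using zero_le_power2[of "1 - 2 * \<rho>"] by (simp add: power2_eq_square algebra_simps)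
  then have "1 * S.energy (Suc d) \<le> 2 * ((1 - \<rho>)\<^sup>2 + \<rho>\<^sup>2) * S.energy (Suc d)"
    by (intro mult_right_mono S.energy_nonneg)
  also have "\<dots> \<le> 2 * ((1 - \<rho>)\<^sup>2 * S.energy d + \<rho>\<^sup>2 * S.energy (Suc d))"
    using mult_left_mono[OF S.energy_antimono[of d], of "(1 - \<rho>)\<^sup>2"] by (simp add: algebra_simps)
  also have "\<dots> \<le> 2 * ((1 - \<rho>)\<^sup>2 * S.energy d + \<rho>\<^sup>2 * S.energy (Suc d)
      + 2 * \<rho> * (1 - \<rho>) * (\<Sum>m\<in>Z. flat_U M V d m * flat_U M V (Suc d) m))"
    using \<rho> S.consecutive_layers_inner[of d] by simp
  also have "\<dots> = 2 * (\<Sum>m\<in>Z. (flat_trace V m)\<^sup>2)"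
    unfolding expand S.energy_def by (simp only: sum.distrib sum_distrib_left)
  finally have "S.energy (Suc d) \<le> 2 * (\<Sum>m\<in>Z. (flat_trace V m)\<^sup>2)" by simp
  then have "49 ^ Suc d * S.energy (Suc d) \<le> 49 ^ Suc d * (2 * (\<Sum>m\<in>Z. (flat_trace V m)\<^sup>2))"
    by (rule mult_left_mono) simp
  with S.energy_lower[of "Suc d"] have "S.energy 0 \<le> 49 ^ Suc d * (2 * (\<Sum>m\<in>Z. (flat_trace V m)\<^sup>2))"
    by (rule order_trans)
  moreover have "S.energy 0 = (\<Sum>m\<in>Z. (V m)\<^sup>2)"
    unfolding S.energy_def using flat_U_extension(2)[OF M0, of _ V] by simp
  ultimately show ?thesis by (simp only: mult_ac)
qed

text \<open>Layer sums are constant, so the trace inherits mean zero and each value is an average of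
  differences. These are at most the total variation T, whose square costs one factor M by
  Cauchy-Schwarz; the second M counts the nodes.\<close>

lemma flat_poincare:
  assumes mean: "(\<Sum>m\<in>Z. V m) = 0"
  shows "(\<Sum>m\<in>Z. (flat_trace V m)\<^sup>2) \<le> (real M)\<^sup>2 * (\<Sum>m\<in>Z. (flat_increment V m)\<^sup>2)"
proof -
  interpret S: strip_harmonic M "flat_U M V" by (rule flat_U_extension(1)[OF M0])
  let ?w = "flat_trace V"
  define T where "T = (\<Sum>m\<in>Z. \<bar>flat_increment V m\<bar>)"
  have "(\<Sum>m\<in>Z. flat_U M V j m) = 0" for j
    using S.layer_sum_const[of j] flat_U_extension(2)[OF M0, of _ V] mean by simp
  then have w0: "(\<Sum>m\<in>Z. ?w m) = 0"
    by (simp add: flat_trace_def sum.distrib sum_distrib_left[symmetric])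
  have path: "\<bar>?w (n + int i) - ?w n\<bar> \<le> (\<Sum>m\<in>{n..<n + int i}. \<bar>flat_increment V m\<bar>)" for n i
  proof (induction i)
    case (Suc i)
    have "{n..<n + int (Suc i)} = insert (n + int i) {n..<n + int i}" by auto
    then have "(\<Sum>m\<in>{n..<n + int (Suc i)}. \<bar>flat_increment V m\<bar>)
      = \<bar>flat_increment V (n + int i)\<bar> + (\<Sum>m\<in>{n..<n + int i}. \<bar>flat_increment V m\<bar>)" by simp
    moreover have "n + int i + 1 = n + int (Suc i)" by simp
    then have "flat_increment V (n + int i) = ?w (n + int (Suc i)) - ?w (n + int i)"
      unfolding flat_increment_def by (simp only:)
    ultimately show ?case using Suc by linarith
  qed simp
  have osc: "\<bar>?w m - ?w n\<bar> \<le> T" if mn: "m \<in> Z" "n \<in> Z" for m n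
  proof -
    have le: "\<bar>?w m - ?w n\<bar> \<le> T" if mn: "m \<in> Z" "n \<in> Z" "n \<le> m" for m n
    proof -
      have "\<bar>?w m - ?w n\<bar> \<le> (\<Sum>m\<in>{n..<m}. \<bar>flat_increment V m\<bar>)"
        using path[of n "nat (m - n)"] mn by simp
      also have "\<dots> \<le> T" unfolding T_def using mn by (intro sum_mono2) auto
      finally show ?thesis .
    qed
    show ?thesis using le[of m n] le[of n m] mn by (cases "n \<le> m") (auto simp: abs_minus_commute)
  qed
  have T2: "T\<^sup>2 \<le> real M * (\<Sum>m\<in>Z. (flat_increment V m)\<^sup>2)"
    using sum_squared_le_sum_of_squares[of "\<lambda>m. \<bar>flat_increment V m\<bar>" Z]
    by (simp add: T_def mult.commute)
  have "(?w m)\<^sup>2 \<le> T\<^sup>2" if m: "m \<in> Z" for m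
  proof -
    have "real M * ?w m = (\<Sum>n\<in>Z. ?w m - ?w n)" using w0 by (simp add: sum_subtractf)
    then have "real M * \<bar>?w m\<bar> = \<bar>\<Sum>n\<in>Z. ?w m - ?w n\<bar>"
      by (metis abs_mult abs_of_nat)
    also have "\<dots> \<le> (\<Sum>n\<in>Z. T)" by (rule order_trans[OF sum_abs]) (intro sum_mono osc m)
    also have "\<dots> = real M * T" by simp
    finally have "\<bar>?w m\<bar> \<le> T" using M0 by simp
    then have "\<bar>?w m\<bar>\<^sup>2 \<le> T\<^sup>2" by (intro power_mono) auto
    then show ?thesis by simp
  qed
  then have "(\<Sum>m\<in>Z. (?w m)\<^sup>2) \<le> (\<Sum>m\<in>Z. T\<^sup>2)" by (rule sum_mono)
  also have "\<dots> = real M * T\<^sup>2" by simp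
  also have "\<dots> \<le> real M * (real M * (\<Sum>m\<in>Z. (flat_increment V m)\<^sup>2))"
    by (intro mult_left_mono T2) simp
  finally show ?thesis by (simp add: power2_eq_square mult.assoc)
qed

theorem flat_spectral_bounds:
  assumes L: "L = real M * h" and D: "d \<le> D" and c: "c = 1 / (2 * 49 ^ Suc D * L\<^sup>2)"
  shows "spectral_bounds Z (flat_K_reduced M h Jm Jp J d \<rho>) h c 4 (4 / c)"
proof -
  let ?q = "\<lambda>V. flat_form M h d \<rho> (flat_E_fe M h Jm Jp J V) (flat_E_fe M h Jm Jp J V)"
  have L0: "L > 0" using L h M0 by simp
  have c0: "c > 0" unfolding c using L0 by simp
  have q: "?q V = (\<Sum>m\<in>Z. (flat_increment V m)\<^sup>2) / h" for V
    unfolding flat_form_increments by (simp add: power2_eq_square)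
  have card: "2 \<le> card Z" using M by simp
  have upper: "?q V \<le> 4 / h * (\<Sum>i\<in>Z. (V i)\<^sup>2)" for V
  proof -
    have per: "(flat_trace V (m + int M))\<^sup>2 = (flat_trace V m)\<^sup>2" for m by (simp add: flat_trace_periodic)
    have "(a - b)\<^sup>2 \<le> 2 * a\<^sup>2 + 2 * b\<^sup>2" for a b :: real
      using zero_le_power2[of "a + b"] by (simp add: power2_eq_square algebra_simps)
    then have "(\<Sum>m\<in>Z. (flat_increment V m)\<^sup>2) \<le> (\<Sum>m\<in>Z. 2 * (flat_trace V (m + 1))\<^sup>2 + 2 * (flat_trace V m)\<^sup>2)"
      unfolding flat_increment_def by (intro sum_mono)
    also have "\<dots> = 4 * (\<Sum>m\<in>Z. (flat_trace V m)\<^sup>2)"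
      using sum_periodic_shift[of "\<lambda>m. (flat_trace V m)\<^sup>2" M, OF per]
      by (simp add: sum.distrib sum_distrib_left[symmetric])
    also have "\<dots> \<le> 4 * (\<Sum>i\<in>Z. (V i)\<^sup>2)" by (intro mult_left_mono flat_trace_upper) simp
    finally show ?thesis unfolding q using h by (simp add: divide_right_mono)
  qed
  have shift: "flat_increment (\<lambda>i. V i - a) m = flat_increment V m" for V a m
    unfolding flat_increment_def flat_trace_def flat_U_shift[OF M0] by (simp add: algebra_simps)
  have lower: "\<exists>a. c * h * (\<Sum>i\<in>Z. (V i - a)\<^sup>2) \<le> ?q V" for V
  proof -
    \<comment> \<open>Here the mean is subtracted rather than a point value, since it is passed on
      unchanged from the data to the trace.\<close>
    define a where "a = (\<Sum>i\<in>Z. V i) / real M"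
    define W where "W = (\<lambda>i. V i - a)"
    have "(\<Sum>i\<in>Z. W i) = 0" using M0 by (simp add: W_def a_def sum_subtractf)
    note poincare = flat_poincare[OF this]
    let ?s = "\<Sum>m\<in>Z. (flat_increment V m)\<^sup>2"
    have s0: "0 \<le> ?s" by (simp add: sum_nonneg)
    have "(\<Sum>m\<in>Z. (W m)\<^sup>2) \<le> 2 * 49 ^ Suc d * (\<Sum>m\<in>Z. (flat_trace W m)\<^sup>2)" by (rule flat_trace_lower)
    also have "\<dots> \<le> 2 * 49 ^ Suc d * ((real M)\<^sup>2 * ?s)"
      using poincare unfolding W_def shift by (intro mult_left_mono) auto
    also have "\<dots> \<le> 2 * 49 ^ Suc D * ((real M)\<^sup>2 * ?s)"
      using D s0 by (intro mult_right_mono mult_left_mono power_increasing) auto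
    \<comment> \<open>The factor h^2 turns M^2 into L^2, so that the bound involves the fixed period
      only.\<close>
    finally have "h\<^sup>2 * (\<Sum>m\<in>Z. (W m)\<^sup>2) \<le> h\<^sup>2 * (2 * 49 ^ Suc D * ((real M)\<^sup>2 * ?s))"
      by (rule mult_left_mono) simp
    also have "\<dots> = (2 * 49 ^ Suc D * L\<^sup>2) * ?s" unfolding L by (simp only: power_mult_distrib mult_ac)
    finally have "1 / (2 * 49 ^ Suc D * L\<^sup>2) * (h\<^sup>2 * (\<Sum>m\<in>Z. (W m)\<^sup>2)) \<le> ?s"
      using L0 by (simp add: divide_le_eq mult.commute)
    then have "c * h\<^sup>2 * (\<Sum>m\<in>Z. (W m)\<^sup>2) \<le> ?s" by (simp only: c mult.assoc)
    then have "c * h * (\<Sum>m\<in>Z. (W m)\<^sup>2) \<le> ?s / h"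
      using h by (simp add: pos_le_divide_eq power2_eq_square mult_ac)
    then show ?thesis unfolding q W_def by blast
  qed
  have const: "?q (\<lambda>_. 1) = 0"
  proof -
    have "flat_increment (\<lambda>_. 1) m = flat_increment (\<lambda>_. 0) m" for m
      using shift[of "\<lambda>_. 1" 1 m] by simp
    moreover have "flat_increment (\<lambda>_. 0) m = 0" for m
      using flat_increment_sum[of "\<lambda>_. 0" m] by simp
    ultimately show ?thesis unfolding q by simp
  qed
  show ?thesis
    by (rule spectral_boundsI[OF _ card h c0 _ flat_K_reduced_form upper lower const]) auto
qed

end

section \<open>Uniform constants and the two settings together\<close>

lemma curved_spectral_bounds:
  assumes dom: "smooth_domain \<Omega> g" and lev: "level_set_function \<Omega> \<psi>"
  shows "\<exists>c>0. \<exists>C>0. \<exists>C'>0. \<forall>T h lay R \<psi>'.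
     rigid_motion T \<and> h > 0 \<and> \<psi>' = \<psi> \<circ> inv T \<and>
     active_grid_geometry \<psi>' h (T \<circ> g) \<and>
     local_extrapolation \<psi>' h B R \<and>
     invertible_on (gamma2 \<psi>' h) (layer_kernel \<psi>' h lay) \<and>
     connected (discrete_interface \<psi>' h) \<and>
     trace_estimate \<psi>' h lay R Ctr \<longrightarrow>
       symmetric_with_form (gamma2 \<psi>' h) (K_reduced \<psi>' h lay R)
         (\<lambda>v. surface_form \<psi>' h (E_fe \<psi>' h lay R v) (E_fe \<psi>' h lay R v)) \<and>
       spectral_bounds (gamma2 \<psi>' h) (K_reduced \<psi>' h lay R) h c C C'"
proof -
  obtain \<Lambda> where \<Lambda>: "\<And>s t. s \<in> {0..1} \<Longrightarrow> t \<in> {0..1} \<Longrightarrow> norm (g s - g t) \<le> \<Lambda> * \<bar>s - t\<bar>"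
    using smooth_closed_curve_lipschitz[of g] dom unfolding smooth_domain_def by blast
  have "0 \<le> \<Lambda>" using order_trans[OF norm_ge_zero \<Lambda>[of 1 0]] by simp
  \<comment> \<open>Both constants are fixed from \<Lambda>, \<open>Ctr\<close> and B before T, h,
    the layer type and R are introduced; this order is the claimed uniformity.\<close>
  define c where "c = 1 / (36 * max Ctr 1 * (48 * (\<Lambda> + 1))\<^sup>2)"
  define C where "C = 128 * (21 * (1 + real (B + 4) ^ 4))"
  have "c > 0" unfolding c_def using \<open>0 \<le> \<Lambda>\<close> by simp
  moreover have "C > 0" unfolding C_def by (simp add: add_pos_nonneg)
  ultimately have "C / c > 0" by simp
  have main: "symmetric_with_form (gamma2 \<psi>' h) (K_reduced \<psi>' h lay R)
         (\<lambda>v. surface_form \<psi>' h (E_fe \<psi>' h lay R v) (E_fe \<psi>' h lay R v)) \<and>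
       spectral_bounds (gamma2 \<psi>' h) (K_reduced \<psi>' h lay R) h c C (C / c)"
    if T: "rigid_motion T" and h: "h > 0" and \<psi>': "\<psi>' = \<psi> \<circ> inv T"
      and geom: "active_grid_geometry \<psi>' h (T \<circ> g)" and R: "local_extrapolation \<psi>' h B R"
      and inv: "invertible_on (gamma2 \<psi>' h) (layer_kernel \<psi>' h lay)"
      and conn: "connected (discrete_interface \<psi>' h)" and trace: "trace_estimate \<psi>' h lay R Ctr"
    for T h lay R \<psi>'
  proof -
    interpret cut_mesh \<psi>' h "T \<circ> g" \<Lambda>
      unfolding \<psi>' by (rule cut_mesh_rigid_motion[OF dom lev \<Lambda> T h geom[unfolded \<psi>']])
    interpret extrapolated_mesh \<psi>' h "T \<circ> g" \<Lambda> lay R B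
      by unfold_locales (rule inv R)+
    show ?thesis
      using K_reduced_form K_reduced_spectral_bounds[OF conn trace c_def C_def] by (rule conjI)
  qed
  show ?thesis
    by (intro exI[of _ c] exI[of _ C] exI[of _ "C / c"] conjI[OF \<open>c > 0\<close>] conjI[OF \<open>C > 0\<close>]
        conjI[OF \<open>C / c > 0\<close>] allI impI, elim conjE) (rule main)
qed

theorem theorem31:
  shows
    "(\<forall>\<Omega> g \<psi> Ctr B. smooth_domain \<Omega> g \<and> level_set_function \<Omega> \<psi> \<longrightarrow>
        (\<exists>c>0. \<exists>C>0. \<exists>C'>0. \<forall>T h lay R \<psi>'.
           rigid_motion T \<and> h > 0 \<and> \<psi>' = \<psi> \<circ> inv T \<and>
           active_grid_geometry \<psi>' h (T \<circ> g) \<and>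
           local_extrapolation \<psi>' h B R \<and>
           invertible_on (gamma2 \<psi>' h) (layer_kernel \<psi>' h lay) \<and>
           connected (discrete_interface \<psi>' h) \<and>
           trace_estimate \<psi>' h lay R Ctr \<longrightarrow>
             symmetric_with_form (gamma2 \<psi>' h) (K_reduced \<psi>' h lay R)
               (\<lambda>v. surface_form \<psi>' h (E_fe \<psi>' h lay R v) (E_fe \<psi>' h lay R v)) \<and>
             spectral_bounds (gamma2 \<psi>' h) (K_reduced \<psi>' h lay R) h c C C')) \<and>
     (\<forall>L Jm Jp D CJ. L > 0 \<and> D + 1 \<le> Jp \<longrightarrow>
        (\<exists>c>0. \<exists>C>0. \<exists>C'>0. \<forall>M h d \<rho> J.
           M \<ge> 2 \<and> h > 0 \<and> L = real M * h \<and> d \<le> D \<and> 0 \<le> \<rho> \<and> \<rho> \<le> 1 \<and>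
           flat_J_bound CJ h M Jm J \<longrightarrow>
             symmetric_with_form {0..<int M} (flat_K_reduced M h Jm Jp J d \<rho>)
               (\<lambda>V. flat_form M h d \<rho> (flat_E_fe M h Jm Jp J V) (flat_E_fe M h Jm Jp J V)) \<and>
             spectral_bounds {0..<int M} (flat_K_reduced M h Jm Jp J d \<rho>) h c C C'))"
proof (intro conjI[of "\<forall>\<Omega> g \<psi> Ctr B. _ \<Omega> g \<psi> Ctr B"] allI impI)
  fix \<Omega> g \<psi> Ctr B
  assume "smooth_domain \<Omega> g \<and> level_set_function \<Omega> \<psi>"
  then show "\<exists>c>0. \<exists>C>0. \<exists>C'>0. \<forall>T h lay R \<psi>'.
           rigid_motion T \<and> h > 0 \<and> \<psi>' = \<psi> \<circ> inv T \<and>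
           active_grid_geometry \<psi>' h (T \<circ> g) \<and>
           local_extrapolation \<psi>' h B R \<and>
           invertible_on (gamma2 \<psi>' h) (layer_kernel \<psi>' h lay) \<and>
           connected (discrete_interface \<psi>' h) \<and>
           trace_estimate \<psi>' h lay R Ctr \<longrightarrow>
             symmetric_with_form (gamma2 \<psi>' h) (K_reduced \<psi>' h lay R)
               (\<lambda>v. surface_form \<psi>' h (E_fe \<psi>' h lay R v) (E_fe \<psi>' h lay R v)) \<and>
             spectral_bounds (gamma2 \<psi>' h) (K_reduced \<psi>' h lay R) h c C C'"
    by (elim conjE) (rule curved_spectral_bounds)
next
  fix L :: real and Jm Jp D :: nat and CJ :: real
  assume L: "L > 0 \<and> D + 1 \<le> Jp"
  define c where "c = 1 / (2 * 49 ^ Suc D * L\<^sup>2)"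
  have c: "c > 0" using L by (simp add: c_def)
  have "symmetric_with_form {0..<int M} (flat_K_reduced M h Jm Jp J d \<rho>)
      (\<lambda>V. flat_form M h d \<rho> (flat_E_fe M h Jm Jp J V) (flat_E_fe M h Jm Jp J V)) \<and>
    spectral_bounds {0..<int M} (flat_K_reduced M h Jm Jp J d \<rho>) h c 4 (4 / c)"
    if "M \<ge> 2 \<and> h > 0 \<and> L = real M * h \<and> d \<le> D \<and> 0 \<le> \<rho> \<and> \<rho> \<le> 1 \<and> flat_J_bound CJ h M Jm J"
    for M h d \<rho> J
  proof -
    have a: "M \<ge> 2" "h > 0" "d + 1 \<le> Jp" "0 \<le> \<rho>" "\<rho> \<le> 1" "L = real M * h" "d \<le> D" using that L by auto
    show ?thesis
      using flat_K_reduced_form[OF a(1-5)] flat_spectral_bounds[OF a c_def] by (rule conjI)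
  qed
  then show "\<exists>c>0. \<exists>C>0. \<exists>C'>0. \<forall>M h d \<rho> J.
           M \<ge> 2 \<and> h > 0 \<and> L = real M * h \<and> d \<le> D \<and> 0 \<le> \<rho> \<and> \<rho> \<le> 1 \<and>
           flat_J_bound CJ h M Jm J \<longrightarrow>
             symmetric_with_form {0..<int M} (flat_K_reduced M h Jm Jp J d \<rho>)
               (\<lambda>V. flat_form M h d \<rho> (flat_E_fe M h Jm Jp J V) (flat_E_fe M h Jm Jp J V)) \<and>
             spectral_bounds {0..<int M} (flat_K_reduced M h Jm Jp J d \<rho>) h c C C'"
    using c by (intro exI[of _ c] exI[of _ 4] exI[of _ "4 / c"] conjI allI impI) simp_all
qed

end
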